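(* Let $C$ be the non-complete intersection Gorenstein monomial curve $x_i=t^{n_i}$ ($1\le i\le4$) in $\mathbb{A}^4(K)$, with $n_1<n_2<n_3<n_4$. Suppose that $I(C)$ is given as in case 2(b), i.e. $I(C)$ is minimally generated by $$f_1=x_1^{a_1}-x_2^{a_{12}}x_3^{a_{13}},\quad f_2=x_2^{a_2}-x_1^{a_{21}}x_4^{a_{24}},\quad f_3=x_3^{a_3}-x_2^{a_{32}}x_4^{a_{34}},$$ $$f_4=x_4^{a_4}-x_1^{a_{41}}x_3^{a_{43}},\quad f_5=x_1^{a_{41}}x_2^{a_{32}}-x_3^{a_{13}}x_4^{a_{24}}.$$ Then $C$ has Cohen-Macaulay tangent cone at the origin if and only if (1) $a_2\le a_{21}+a_{24}$, and (2) for every monomial $M=x_2^{u_2}x_3^{u_3}x_4^{u_4}$, where $u_2<a_{12}$, $u_3\ge a_3$ and $u_4<a_{24}$, with $u_2n_2+u_3n_3+u_4n_4\in n_1+\mathcal{S}$, there exists a monomial $N$ with $1\in\mathrm{supp}(N)$ such that $M-N\in I(C)$ and $\deg(M)\le\deg(N)$.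
   Context: $K$ is a field and $n_1,\dots,n_4$ are positive integers with $\gcd(n_1,\dots,n_4)=1$. $\mathbb{N}$ denotes the non-negative integers (exponents $u_i$ are in $\mathbb{N}$), $\mathcal{S}=\{g_1n_1+\cdots+g_4n_4: g_i\in\mathbb{N}\}$ and $n_1+\mathcal{S}=\{n_1+m:m\in\mathcal{S}\}$. $I(C)$ is the kernel of the $K$-algebra homomorphism $K[x_1,\dots,x_4]\to K[t]$, $x_i\mapsto t^{n_i}$. $C$ is Gorenstein if $\mathcal{S}$ is symmetric. For a monomial, $\deg(x_1^{u_1}\cdots x_4^{u_4})=u_1+\cdots+u_4$, and $\mathrm{supp}$ is the set of indices $i$ such that $x_i$ divides it. In the description of $I(C)$, all exponents are integers with $0<a_{ij}<a_j$, and (by Bresinsky) $a_1=a_{21}+a_{41}$, $a_2=a_{12}+a_{32}$, $a_3=a_{13}+a_{43}$, $a_4=a_{24}+a_{34}$. $C$ has Cohen-Macaulay tangent cone at the origin if the ring $K[x_1,\dots,x_4]/I(C)_*$ is Cohen-Macaulay, where $I(C)_*$ is generated by the homogeneous (standard grading) summands $f_*$ of least degree of the polynomials $f\in I(C)$. *)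

theory Defs
  imports
    "HOL-Library.Poly_Mapping"
    "HOL-Library.Numeral_Type"
    "HOL-Library.Extended_Nat"
    "HOL-Computational_Algebra.Polynomial"
    "HOL-Algebra.QuotRing"
    "HOL-Algebra.Ring_Divisibility"
begin

section \<open>Cohen-Macaulay rings\<close>

text \<open>
  The localization of a commutative ring \<open>R\<close> at a prime ideal \<open>P\<close>: fractions \<open>a/s\<close> with
  \<open>s \<notin> P\<close>, where \<open>a/s = b/t\<close> iff \<open>u (a t - b s) = 0\<close> for some \<open>u \<notin> P\<close>.
\<close>

definition loc_rel :: "('a, 'm) ring_scheme \<Rightarrow> 'a set \<Rightarrow> (('a \<times> 'a) \<times> ('a \<times> 'a)) set" where
  "loc_rel R P =
    {((a, s), (b, t)) | a s b t.
       a \<in> carrier R \<and> s \<in> carrier R - P \<and> b \<in> carrier R \<and> t \<in> carrier R - P \<and>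
       (\<exists>u \<in> carrier R - P. u \<otimes>\<^bsub>R\<^esub> ((a \<otimes>\<^bsub>R\<^esub> t) \<ominus>\<^bsub>R\<^esub> (b \<otimes>\<^bsub>R\<^esub> s)) = \<zero>\<^bsub>R\<^esub>)}"

definition loc_frac :: "('a, 'm) ring_scheme \<Rightarrow> 'a set \<Rightarrow> 'a \<Rightarrow> 'a \<Rightarrow> ('a \<times> 'a) set" where
  "loc_frac R P a s = loc_rel R P `` {(a, s)}"

text \<open>The unions below are unions of one and the same class, by independence of representatives.\<close>

definition localization :: "('a, 'm) ring_scheme \<Rightarrow> 'a set \<Rightarrow> (('a \<times> 'a) set) ring" where
  "localization R P =
    \<lparr>carrier = (carrier R \<times> (carrier R - P)) // loc_rel R P,
     mult = (\<lambda>X Y. \<Union>(a, s)\<in>X. \<Union>(b, t)\<in>Y. loc_frac R P (a \<otimes>\<^bsub>R\<^esub> b) (s \<otimes>\<^bsub>R\<^esub> t)),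
     one = loc_frac R P \<one>\<^bsub>R\<^esub> \<one>\<^bsub>R\<^esub>,
     zero = loc_frac R P \<zero>\<^bsub>R\<^esub> \<one>\<^bsub>R\<^esub>,
     add = (\<lambda>X Y. \<Union>(a, s)\<in>X. \<Union>(b, t)\<in>Y.
       loc_frac R P ((a \<otimes>\<^bsub>R\<^esub> t) \<oplus>\<^bsub>R\<^esub> (b \<otimes>\<^bsub>R\<^esub> s)) (s \<otimes>\<^bsub>R\<^esub> t))\<rparr>"

definition krull_dim :: "('a, 'm) ring_scheme \<Rightarrow> enat" where
  "krull_dim R =
    Sup {enat k | k. \<exists>p. (\<forall>i\<le>k. primeideal (p i) R) \<and> (\<forall>i<k. p i \<subset> p (Suc i))}"

definition regular_sequence :: "('a, 'm) ring_scheme \<Rightarrow> 'a list \<Rightarrow> bool" where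
  "regular_sequence R xs \<longleftrightarrow>
    set xs \<subseteq> carrier R \<and>
    Idl\<^bsub>R\<^esub> (set xs) \<noteq> carrier R \<and>
    (\<forall>i<length xs. \<forall>y\<in>carrier R.
       xs ! i \<otimes>\<^bsub>R\<^esub> y \<in> Idl\<^bsub>R\<^esub> (set (take i xs)) \<longrightarrow> y \<in> Idl\<^bsub>R\<^esub> (set (take i xs)))"

text \<open>For a Noetherian local ring with maximal ideal \<open>M\<close>, \<open>depth_in M R\<close> is its depth.\<close>

definition depth_in :: "'a set \<Rightarrow> ('a, 'm) ring_scheme \<Rightarrow> enat" where
  "depth_in M R = Sup {enat (length xs) | xs. regular_sequence R xs \<and> set xs \<subseteq> M}"

definition cohen_macaulay_local :: "('a, 'm) ring_scheme \<Rightarrow> bool" where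
  "cohen_macaulay_local R \<longleftrightarrow>
    cring R \<and> noetherian_ring R \<and>
    (\<exists>M. maximalideal M R \<and> (\<forall>M'. maximalideal M' R \<longrightarrow> M' = M) \<and> depth_in M R = krull_dim R)"

definition cohen_macaulay :: "('a, 'm) ring_scheme \<Rightarrow> bool" where
  "cohen_macaulay R \<longleftrightarrow>
    cring R \<and> noetherian_ring R \<and>
    (\<forall>P. maximalideal P R \<longrightarrow> cohen_macaulay_local (localization R P))"


section \<open>Polynomials in finitely many variables\<close>

text \<open>
  Monomials in variables indexed by \<open>'i\<close> are represented by their exponent vectors
  \<open>'i \<Rightarrow>\<^sub>0 nat\<close>, and polynomials by finitely supported coefficient functions on these, with the
  (convolution) ring structure of \<open>HOL-Library.Poly_Mapping\<close>.  The support of a monomial \<open>m\<close> is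
  \<open>Poly_Mapping.keys m\<close>.
\<close>

type_synonym ('i, 'k) mpoly = "('i \<Rightarrow>\<^sub>0 nat) \<Rightarrow>\<^sub>0 'k"

definition mdeg :: "('i::finite \<Rightarrow>\<^sub>0 nat) \<Rightarrow> nat" where
  "mdeg m = (\<Sum>i\<in>UNIV. Poly_Mapping.lookup m i)"

definition monomial :: "('i \<Rightarrow>\<^sub>0 nat) \<Rightarrow> ('i, 'k::comm_ring_1) mpoly" where
  "monomial m = Poly_Mapping.single m 1"

definition var :: "'i \<Rightarrow> ('i, 'k::comm_ring_1) mpoly" where
  "var i = monomial (Poly_Mapping.single i 1)"

definition mpoly_ring :: "('i, 'k::comm_ring_1) mpoly ring" where
  "mpoly_ring = \<lparr>carrier = UNIV, mult = (*), one = 1, zero = 0, add = (+)\<rparr>"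

definition minimally_generates ::
    "('i, 'k::comm_ring_1) mpoly set \<Rightarrow> ('i, 'k) mpoly set \<Rightarrow> bool" where
  "minimally_generates F I \<longleftrightarrow>
    Idl\<^bsub>mpoly_ring\<^esub> F = I \<and> (\<forall>G. G \<subset> F \<longrightarrow> Idl\<^bsub>mpoly_ring\<^esub> G \<noteq> I)"

text \<open>The sum of the terms of least degree; it is \<open>0\<close> for \<open>f = 0\<close>.\<close>

definition initial_form :: "('i::finite, 'k::comm_ring_1) mpoly \<Rightarrow> ('i, 'k) mpoly" where
  "initial_form f =
    (\<Sum>m \<in> {m \<in> Poly_Mapping.keys f. mdeg m = Min (mdeg ` Poly_Mapping.keys f)}.
       Poly_Mapping.single m (Poly_Mapping.lookup f m))"

definition initial_ideal :: "('i::finite, 'k::comm_ring_1) mpoly set \<Rightarrow> ('i, 'k) mpoly set" where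
  "initial_ideal I = Idl\<^bsub>mpoly_ring\<^esub> (initial_form ` I)"


section \<open>Monomial curves\<close>

text \<open>The type \<open>4\<close> is used as index set; its elements are \<open>1, 2, 3, 4\<close>, where \<open>4 = 0\<close>.\<close>

lemma UNIV_4: "(UNIV :: 4 set) = {1, 2, 3, 4}" "distinct [1, 2, 3, 4 :: 4]"
proof -
  show "distinct [1, 2, 3, 4 :: 4]" by simp
  then have "card {1, 2, 3, 4 :: 4} = CARD(4)" by simp
  then show "(UNIV :: 4 set) = {1, 2, 3, 4}"
    using card_subset_eq[of "UNIV :: 4 set" "{1, 2, 3, 4}"] by simp
qed

text \<open>The value at \<open>f\<close> of the \<open>K\<close>-algebra homomorphism \<open>x\<^sub>i \<mapsto> t\<^bsup>n i\<^esup>\<close> into \<open>K[t]\<close>.\<close>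

definition curve_hom :: "('i::finite \<Rightarrow> nat) \<Rightarrow> ('i, 'k::field) mpoly \<Rightarrow> 'k poly" where
  "curve_hom n f =
    (\<Sum>m \<in> Poly_Mapping.keys f. Polynomial.smult (Poly_Mapping.lookup f m)
       (\<Prod>i\<in>UNIV. (Polynomial.monom 1 (n i)) ^ Poly_Mapping.lookup m i))"

definition curve_ideal :: "('i::finite \<Rightarrow> nat) \<Rightarrow> ('i, 'k::field) mpoly set" where
  "curve_ideal n = {f. curve_hom n f = 0}"

definition num_semigroup :: "('i::finite \<Rightarrow> nat) \<Rightarrow> nat set" where
  "num_semigroup n = {\<Sum>i\<in>UNIV. g i * n i | g. True}"

text \<open>
  The Frobenius number is taken among the integers, so that it is \<open>-1\<close> when every natural number
  lies in the semigroup.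
\<close>

definition frobenius_number :: "nat set \<Rightarrow> int" where
  "frobenius_number S = (GREATEST z. z \<notin> int ` S)"

definition symmetric_semigroup :: "nat set \<Rightarrow> bool" where
  "symmetric_semigroup S \<longleftrightarrow> (\<forall>z::int. z \<in> int ` S \<longleftrightarrow> frobenius_number S - z \<notin> int ` S)"

definition gorenstein_curve :: "('i::finite \<Rightarrow> nat) \<Rightarrow> bool" where
  "gorenstein_curve n \<longleftrightarrow> symmetric_semigroup (num_semigroup n)"

text \<open>The ideal of a curve in affine \<open>d\<close>-space has height \<open>d - 1\<close>.\<close>

definition complete_intersection_curve :: "('i::finite, 'k::field) mpoly set \<Rightarrow> bool" where
  "complete_intersection_curve I \<longleftrightarrow>
    (\<exists>F. finite F \<and> card F = CARD('i) - 1 \<and> Idl\<^bsub>mpoly_ring\<^esub> F = I)"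

definition cm_tangent_cone :: "('i::finite, 'k::field) mpoly set \<Rightarrow> bool" where
  "cm_tangent_cone I \<longleftrightarrow> cohen_macaulay (mpoly_ring Quot (initial_ideal I))"

end

theory Submission
  imports Defs
begin

text \<open>
  Let the weight of a monomial \<open>M\<close> with exponents \<open>m\<^sub>i\<close> be \<open>\<Sum>\<^sub>i m\<^sub>i n\<^sub>i\<close>, and call \<open>M\<close> a top
  monomial if no monomial of the same weight has a larger degree.  Two monomials differ by an
  element of \<open>I(C)\<close> iff their weights agree.  A monomial that is not top is therefore the initial
  form of a binomial in \<open>I(C)\<close>, and the difference of two top monomials of one weight is its own
  initial form; conversely the initial form of an element of \<open>I(C)\<close> has coefficient sum zero over
  the top monomials of each weight.  This condition describes the initial ideal
  (\<open>initial_ideal_curve\<close>).  So the coordinate ring \<open>A\<close> of the tangent cone has a basis indexed by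
  \<open>\<S>\<close>, and multiplication by \<open>x\<^sub>1\<close> sends the basis element at \<open>s\<close> to the one at \<open>s + n\<^sub>1\<close> or to
  zero, according to whether the largest degree grows by exactly one or by more.

  Because \<open>n\<^sub>1\<close> is the smallest weight, \<open>x\<^sub>2, x\<^sub>3, x\<^sub>4\<close> are nilpotent in \<open>A\<close>, and modulo nilpotents
  \<open>A\<close> is the polynomial ring \<open>K[x\<^sub>1]\<close>.  Such a ring has dimension one at each maximal ideal.  If it
  is Cohen-Macaulay at the origin, then some nonzerodivisor lies in the maximal ideal there; it
  acts on an element killed by \<open>x\<^sub>1\<close> as a nilpotent does, so there is no such element except zero
  (\<open>cohen_macaulayD\<close>).  If all nonzero polynomials in \<open>x\<^sub>1\<close> are nonzerodivisors, then each
  localization at a maximal ideal has depth one (\<open>cohen_macaulayI\<close>).  For the tangent cone this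
  already follows when \<open>x\<^sub>1\<close> is a nonzerodivisor, by looking at components of lowest weight.  In
  terms of monomials, \<open>A\<close> is Cohen-Macaulay iff every monomial whose weight lies in \<open>n\<^sub>1 + \<S>\<close> is
  matched by a monomial of the same weight that is divisible by \<open>x\<^sub>1\<close> and has at least the same
  degree (\<open>cm_tangent_cone_iff\<close>).

  It remains to compare this criterion with (1) and (2).  Monomials of the same weight are
  connected by moves that replace one term of a generator \<open>f\<^sub>i\<close>, inside a monomial, by the other
  term (\<open>binomial_ideal_class\<close>).  The monomial \<open>x\<^sub>2\<^bsup>a2\<^esup>\<close> allows only the move along \<open>f\<^sub>2\<close>, which leads to
  \<open>x\<^sub>1\<^bsup>a21\<^esup> x\<^sub>4\<^bsup>a24\<^esup>\<close> and from there only back; hence the criterion implies (1), and (2) is a special case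
  of it.  Conversely the moves along \<open>f\<^sub>1, f\<^sub>4, f\<^sub>5\<close> that create \<open>x\<^sub>1\<close> do not lower the degree because of
  \<open>n\<^sub>1 < n\<^sub>2 < n\<^sub>3 < n\<^sub>4\<close>, and the one along \<open>f\<^sub>2\<close> does not because of (1).  A monomial in
  \<open>x\<^sub>2, x\<^sub>3, x\<^sub>4\<close> that allows none of them either has \<open>u3 \<ge> a3\<close> and is covered by (2), or can be moved
  only along \<open>f\<^sub>3\<close>; in the latter case \<open>x\<^sub>1\<close> never appears, so its weight is not in \<open>n\<^sub>1 + \<S>\<close>.
\<close>


section \<open>Localization at a prime ideal\<close>

context primeideal
begin

lemma compl_one: "\<one> \<in> carrier R - I"
  using I_notcarr one_imp_carrier by auto

lemma compl_mult: "s \<in> carrier R - I \<Longrightarrow> t \<in> carrier R - I \<Longrightarrow> s \<otimes> t \<in> carrier R - I"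
  using I_prime by auto

text \<open>With differences replaced by equations, the relation can be handled by commutativity and
  associativity alone.\<close>

lemma loc_rel_iff:
  "((a, s), (b, t)) \<in> loc_rel R I \<longleftrightarrow>
     a \<in> carrier R \<and> s \<in> carrier R - I \<and> b \<in> carrier R \<and> t \<in> carrier R - I \<and>
     (\<exists>u \<in> carrier R - I. u \<otimes> (a \<otimes> t) = u \<otimes> (b \<otimes> s))"
proof -
  have "u \<otimes> (a \<otimes> t \<ominus> b \<otimes> s) = \<zero> \<longleftrightarrow> u \<otimes> (a \<otimes> t) = u \<otimes> (b \<otimes> s)"
    if "u \<in> carrier R" "a \<in> carrier R" "s \<in> carrier R" "b \<in> carrier R" "t \<in> carrier R" for u
  proof -
    have "u \<otimes> (a \<otimes> t \<ominus> b \<otimes> s) = u \<otimes> (a \<otimes> t) \<ominus> u \<otimes> (b \<otimes> s)"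
      using that by algebra
    then show ?thesis using that by simp
  qed
  then show ?thesis unfolding loc_rel_def by auto
qed

lemma equiv_loc_rel: "equiv (carrier R \<times> (carrier R - I)) (loc_rel R I)"
proof (rule equivI)
  show "loc_rel R I \<subseteq> (carrier R \<times> (carrier R - I)) \<times> (carrier R \<times> (carrier R - I))"
    by (auto simp: loc_rel_def)
  show "refl_on (carrier R \<times> (carrier R - I)) (loc_rel R I)"
    using compl_one by (auto simp: refl_on_def loc_rel_iff)
  show "sym (loc_rel R I)"
  proof (rule symI)
    fix x y assume "(x, y) \<in> loc_rel R I"
    then show "(y, x) \<in> loc_rel R I"
      by (cases x; cases y) (simp add: loc_rel_iff, metis)
  qed
  show "trans (loc_rel R I)"
  proof (rule transI)
    fix x y z assume xy: "(x, y) \<in> loc_rel R I" and yz: "(y, z) \<in> loc_rel R I"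
    obtain a s b t c r where e: "x = (a, s)" "y = (b, t)" "z = (c, r)"
      by (cases x; cases y; cases z) auto
    from xy e obtain u where u: "u \<in> carrier R - I" "u \<otimes> (a \<otimes> t) = u \<otimes> (b \<otimes> s)"
      and as: "a \<in> carrier R" "s \<in> carrier R - I" "b \<in> carrier R" "t \<in> carrier R - I"
      by (auto simp: loc_rel_iff)
    from yz e obtain v where v: "v \<in> carrier R - I" "v \<otimes> (b \<otimes> r) = v \<otimes> (c \<otimes> t)"
      and cr: "c \<in> carrier R" "r \<in> carrier R - I"
      by (auto simp: loc_rel_iff)
    have m: "s \<in> carrier R" "t \<in> carrier R" "r \<in> carrier R" "u \<in> carrier R" "v \<in> carrier R"
      using u v as cr by auto
    note m = m as(1,3) cr(1)
    have "(u \<otimes> v \<otimes> t) \<otimes> (a \<otimes> r) = (v \<otimes> r) \<otimes> (u \<otimes> (a \<otimes> t))" using m by algebra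
    also have "\<dots> = (u \<otimes> s) \<otimes> (v \<otimes> (b \<otimes> r))" unfolding u(2) using m by algebra
    also have "\<dots> = (u \<otimes> v \<otimes> t) \<otimes> (c \<otimes> s)" unfolding v(2) using m by algebra
    finally show "(x, z) \<in> loc_rel R I"
      using e as cr compl_mult[OF compl_mult[OF u(1) v(1)] as(4)] by (auto simp: loc_rel_iff)
  qed
qed

lemma loc_frac_eq_iff:
  assumes "a \<in> carrier R" "s \<in> carrier R - I" "b \<in> carrier R" "t \<in> carrier R - I"
  shows "loc_frac R I a s = loc_frac R I b t \<longleftrightarrow>
    (\<exists>u \<in> carrier R - I. u \<otimes> (a \<otimes> t) = u \<otimes> (b \<otimes> s))"
  unfolding loc_frac_def
  using eq_equiv_class_iff[OF equiv_loc_rel, of "(a, s)" "(b, t)"] assms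
  by (simp add: loc_rel_iff)

lemma loc_frac_eqI:
  assumes "a \<in> carrier R" "s \<in> carrier R - I" "b \<in> carrier R" "t \<in> carrier R - I"
    and "a \<otimes> t = b \<otimes> s"
  shows "loc_frac R I a s = loc_frac R I b t"
  using compl_one assms by (subst loc_frac_eq_iff) auto

lemma in_loc_frac_iff:
  assumes "a \<in> carrier R" "s \<in> carrier R - I"
  shows "(b, t) \<in> loc_frac R I a s \<longleftrightarrow>
    b \<in> carrier R \<and> t \<in> carrier R - I \<and> loc_frac R I b t = loc_frac R I a s"
proof -
  have "(b, t) \<in> loc_frac R I a s \<longleftrightarrow> ((a, s), (b, t)) \<in> loc_rel R I"
    by (simp add: loc_frac_def)
  also have "\<dots> \<longleftrightarrow> b \<in> carrier R \<and> t \<in> carrier R - I \<and> loc_frac R I a s = loc_frac R I b t"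
    unfolding loc_rel_iff using assms by (simp add: loc_frac_eq_iff cong: conj_cong)
  finally show ?thesis by auto
qed

lemma carrier_localization:
  "carrier (localization R I) = {loc_frac R I a s | a s. a \<in> carrier R \<and> s \<in> carrier R - I}"
  unfolding localization_def loc_frac_def by (auto simp: quotient_def)

lemma loc_frac_closed:
  "a \<in> carrier R \<Longrightarrow> s \<in> carrier R - I \<Longrightarrow> loc_frac R I a s \<in> carrier (localization R I)"
  by (auto simp: carrier_localization)

text \<open>The operations of \<open>localization R I\<close> are unions over all representatives.  Such a union
  collapses to a single term as soon as this term does not depend on the representatives.\<close>

lemma UN_loc_frac:
  assumes "a \<in> carrier R" "s \<in> carrier R - I" "b \<in> carrier R" "t \<in> carrier R - I"
    and "\<And>a' s' b' t'. \<lbrakk>a' \<in> carrier R; s' \<in> carrier R - I; b' \<in> carrier R; t' \<in> carrier R - I;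
      loc_frac R I a' s' = loc_frac R I a s; loc_frac R I b' t' = loc_frac R I b t\<rbrakk>
      \<Longrightarrow> F a' s' b' t' = F a s b t"
  shows "(\<Union>(a', s') \<in> loc_frac R I a s. \<Union>(b', t') \<in> loc_frac R I b t. F a' s' b' t') = F a s b t"
    (is "?U = _")
proof
  show "?U \<subseteq> F a s b t"
  proof (intro UN_least, clarify)
    fix a' s' b' t' z
    assume *: "(a', s') \<in> loc_frac R I a s" "(b', t') \<in> loc_frac R I b t" "z \<in> F a' s' b' t'"
    have "F a' s' b' t' = F a s b t"
      using *(1,2) unfolding in_loc_frac_iff[OF assms(1,2)] in_loc_frac_iff[OF assms(3,4)]
      by (rule_tac assms(5)) blast+
    then show "z \<in> F a s b t" using *(3) by simp
  qed
  have "(a, s) \<in> loc_frac R I a s" "(b, t) \<in> loc_frac R I b t"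
    using in_loc_frac_iff[OF assms(1,2), of a s] in_loc_frac_iff[OF assms(3,4), of b t] assms(1-4)
    by blast+
  then show "F a s b t \<subseteq> ?U" by blast
qed

lemma loc_mult:
  assumes "a \<in> carrier R" "s \<in> carrier R - I" "b \<in> carrier R" "t \<in> carrier R - I"
  shows "loc_frac R I a s \<otimes>\<^bsub>localization R I\<^esub> loc_frac R I b t = loc_frac R I (a \<otimes> b) (s \<otimes> t)"
  unfolding localization_def monoid.simps ring.simps
proof (rule UN_loc_frac[OF assms])
  fix a' s' b' t'
  assume m: "a' \<in> carrier R" "s' \<in> carrier R - I" "b' \<in> carrier R" "t' \<in> carrier R - I"
    and eq: "loc_frac R I a' s' = loc_frac R I a s" "loc_frac R I b' t' = loc_frac R I b t"
  obtain u where u: "u \<in> carrier R - I" "u \<otimes> (a' \<otimes> s) = u \<otimes> (a \<otimes> s')"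
    using eq(1) assms m by (auto simp: loc_frac_eq_iff)
  obtain v where v: "v \<in> carrier R - I" "v \<otimes> (b' \<otimes> t) = v \<otimes> (b \<otimes> t')"
    using eq(2) assms m by (auto simp: loc_frac_eq_iff)
  have c: "s \<in> carrier R" "t \<in> carrier R" "s' \<in> carrier R" "t' \<in> carrier R"
    "u \<in> carrier R" "v \<in> carrier R" using assms m u v by auto
  note c = c m(1,3) assms(1,3)
  have "(u \<otimes> v) \<otimes> ((a' \<otimes> b') \<otimes> (s \<otimes> t)) = (u \<otimes> (a' \<otimes> s)) \<otimes> (v \<otimes> (b' \<otimes> t))"
    using c by algebra
  also have "\<dots> = (u \<otimes> v) \<otimes> ((a \<otimes> b) \<otimes> (s' \<otimes> t'))"
    unfolding u v using c by algebra
  finally have E: "(u \<otimes> v) \<otimes> ((a' \<otimes> b') \<otimes> (s \<otimes> t)) = (u \<otimes> v) \<otimes> ((a \<otimes> b) \<otimes> (s' \<otimes> t'))" .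
  show "loc_frac R I (a' \<otimes> b') (s' \<otimes> t') = loc_frac R I (a \<otimes> b) (s \<otimes> t)"
    using c by (subst loc_frac_eq_iff) (use E compl_mult u v m assms in blast)+
qed

lemma loc_add:
  assumes "a \<in> carrier R" "s \<in> carrier R - I" "b \<in> carrier R" "t \<in> carrier R - I"
  shows "loc_frac R I a s \<oplus>\<^bsub>localization R I\<^esub> loc_frac R I b t
    = loc_frac R I (a \<otimes> t \<oplus> b \<otimes> s) (s \<otimes> t)"
  unfolding localization_def monoid.simps ring.simps
proof (rule UN_loc_frac[OF assms])
  fix a' s' b' t'
  assume m: "a' \<in> carrier R" "s' \<in> carrier R - I" "b' \<in> carrier R" "t' \<in> carrier R - I"
    and eq: "loc_frac R I a' s' = loc_frac R I a s" "loc_frac R I b' t' = loc_frac R I b t"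
  obtain u where u: "u \<in> carrier R - I" "u \<otimes> (a' \<otimes> s) = u \<otimes> (a \<otimes> s')"
    using eq(1) assms m by (auto simp: loc_frac_eq_iff)
  obtain v where v: "v \<in> carrier R - I" "v \<otimes> (b' \<otimes> t) = v \<otimes> (b \<otimes> t')"
    using eq(2) assms m by (auto simp: loc_frac_eq_iff)
  have c: "s \<in> carrier R" "t \<in> carrier R" "s' \<in> carrier R" "t' \<in> carrier R"
    "u \<in> carrier R" "v \<in> carrier R" using assms m u v by auto
  note c = c m(1,3) assms(1,3)
  have "(u \<otimes> v) \<otimes> ((a' \<otimes> t' \<oplus> b' \<otimes> s') \<otimes> (s \<otimes> t))
    = (u \<otimes> (a' \<otimes> s)) \<otimes> (v \<otimes> t \<otimes> t') \<oplus> (v \<otimes> (b' \<otimes> t)) \<otimes> (u \<otimes> s \<otimes> s')"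
    using c by algebra
  also have "\<dots> = (u \<otimes> v) \<otimes> ((a \<otimes> t \<oplus> b \<otimes> s) \<otimes> (s' \<otimes> t'))"
    unfolding u v using c by algebra
  finally have E: "(u \<otimes> v) \<otimes> ((a' \<otimes> t' \<oplus> b' \<otimes> s') \<otimes> (s \<otimes> t))
    = (u \<otimes> v) \<otimes> ((a \<otimes> t \<oplus> b \<otimes> s) \<otimes> (s' \<otimes> t'))" .
  have k: "a' \<otimes> t' \<oplus> b' \<otimes> s' \<in> carrier R" "a \<otimes> t \<oplus> b \<otimes> s \<in> carrier R" using c by auto
  show "loc_frac R I (a' \<otimes> t' \<oplus> b' \<otimes> s') (s' \<otimes> t') = loc_frac R I (a \<otimes> t \<oplus> b \<otimes> s) (s \<otimes> t)"
    using k by (subst loc_frac_eq_iff) (use E compl_mult u v m assms in blast)+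
qed

lemma loc_one: "\<one>\<^bsub>localization R I\<^esub> = loc_frac R I \<one> \<one>"
  and loc_zero: "\<zero>\<^bsub>localization R I\<^esub> = loc_frac R I \<zero> \<one>"
  by (simp_all add: localization_def)

lemma localizationE:
  assumes "x \<in> carrier (localization R I)"
  obtains a s where "a \<in> carrier R" "s \<in> carrier R - I" "x = loc_frac R I a s"
  using assms by (auto simp: carrier_localization)

lemma localization_cring: "cring (localization R I)"
proof -
  let ?L = "localization R I"
  note comp = compl_mult compl_one
  have "abelian_group ?L"
  proof (rule abelian_groupI)
    fix x y assume xy: "x \<in> carrier ?L" "y \<in> carrier ?L"
    then obtain a s b t where e: "a \<in> carrier R" "s \<in> carrier R - I" "x = loc_frac R I a s"
      "b \<in> carrier R" "t \<in> carrier R - I" "y = loc_frac R I b t"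
      by (meson localizationE)
    then have c: "s \<in> carrier R" "t \<in> carrier R" by auto
    show "x \<oplus>\<^bsub>?L\<^esub> y \<in> carrier ?L"
      unfolding e(3,6) loc_add[OF e(1,2,4,5)]
      using e c comp by (intro loc_frac_closed) blast+
    show "x \<oplus>\<^bsub>?L\<^esub> y = y \<oplus>\<^bsub>?L\<^esub> x"
    proof -
      have "a \<otimes> t \<oplus> b \<otimes> s = b \<otimes> s \<oplus> a \<otimes> t" "s \<otimes> t = t \<otimes> s"
        using c e(1,4) by algebra+
      then show ?thesis unfolding e(3,6) loc_add[OF e(1,2,4,5)] loc_add[OF e(4,5,1,2)] by simp
    qed
    show "\<zero>\<^bsub>?L\<^esub> \<oplus>\<^bsub>?L\<^esub> x = x"
    proof -
      have "\<zero> \<otimes> s \<oplus> a \<otimes> \<one> = a" "\<one> \<otimes> s = s" using c e(1) by algebra+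
      then show ?thesis
        unfolding loc_zero e(3) loc_add[OF zero_closed compl_one e(1,2)] by simp
    qed
    show "\<exists>y\<in>carrier ?L. y \<oplus>\<^bsub>?L\<^esub> x = \<zero>\<^bsub>?L\<^esub>"
    proof (rule bexI[of _ "loc_frac R I (\<ominus> a) s"])
      have n: "\<ominus> a \<in> carrier R" using e(1) by simp
      have "(\<ominus> a \<otimes> s \<oplus> a \<otimes> s) \<otimes> \<one> = \<zero> \<otimes> (s \<otimes> s)" using c e(1) by algebra
      then show "loc_frac R I (\<ominus> a) s \<oplus>\<^bsub>?L\<^esub> x = \<zero>\<^bsub>?L\<^esub>"
        unfolding e(3) loc_add[OF n e(2,1,2)] loc_zero
        using e c n comp by (intro loc_frac_eqI) (simp_all del: Diff_iff)
      show "loc_frac R I (\<ominus> a) s \<in> carrier ?L" using n e(2) by (rule loc_frac_closed)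
    qed
    fix z assume "z \<in> carrier ?L"
    then obtain d r where f: "d \<in> carrier R" "r \<in> carrier R - I" "z = loc_frac R I d r"
      by (meson localizationE)
    then have c': "r \<in> carrier R" by auto
    have k1: "a \<otimes> t \<oplus> b \<otimes> s \<in> carrier R" "s \<otimes> t \<in> carrier R - I"
      and k2: "b \<otimes> r \<oplus> d \<otimes> t \<in> carrier R" "t \<otimes> r \<in> carrier R - I"
      using e f c c' comp by (simp_all del: Diff_iff)
    have "(a \<otimes> t \<oplus> b \<otimes> s) \<otimes> r \<oplus> d \<otimes> (s \<otimes> t) = a \<otimes> (t \<otimes> r) \<oplus> (b \<otimes> r \<oplus> d \<otimes> t) \<otimes> s"
      "s \<otimes> t \<otimes> r = s \<otimes> (t \<otimes> r)"
      using c c' e(1,4) f(1) by algebra+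
    then show "x \<oplus>\<^bsub>?L\<^esub> y \<oplus>\<^bsub>?L\<^esub> z = x \<oplus>\<^bsub>?L\<^esub> (y \<oplus>\<^bsub>?L\<^esub> z)"
      unfolding e(3,6) f(3) loc_add[OF e(1,2,4,5)] loc_add[OF e(4,5) f(1,2)]
        loc_add[OF k1 f(1,2)] loc_add[OF e(1,2) k2] by simp
  next
    show "\<zero>\<^bsub>?L\<^esub> \<in> carrier ?L" unfolding loc_zero using compl_one by (intro loc_frac_closed) auto
  qed
  moreover have "comm_monoid ?L"
  proof (rule comm_monoidI)
    fix x y assume xy: "x \<in> carrier ?L" "y \<in> carrier ?L"
    then obtain a s b t where e: "a \<in> carrier R" "s \<in> carrier R - I" "x = loc_frac R I a s"
      "b \<in> carrier R" "t \<in> carrier R - I" "y = loc_frac R I b t"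
      by (meson localizationE)
    then have c: "s \<in> carrier R" "t \<in> carrier R" by auto
    show "x \<otimes>\<^bsub>?L\<^esub> y \<in> carrier ?L"
      unfolding e(3,6) loc_mult[OF e(1,2,4,5)]
      using e c comp by (intro loc_frac_closed) blast+
    have "a \<otimes> b = b \<otimes> a" "s \<otimes> t = t \<otimes> s" using c e(1,4) by algebra+
    then show "x \<otimes>\<^bsub>?L\<^esub> y = y \<otimes>\<^bsub>?L\<^esub> x"
      unfolding e(3,6) loc_mult[OF e(1,2,4,5)] loc_mult[OF e(4,5,1,2)] by simp
    show "\<one>\<^bsub>?L\<^esub> \<otimes>\<^bsub>?L\<^esub> x = x"
      unfolding loc_one e(3) loc_mult[OF one_closed compl_one e(1,2)] using e c by simp
    fix z assume "z \<in> carrier ?L"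
    then obtain d r where f: "d \<in> carrier R" "r \<in> carrier R - I" "z = loc_frac R I d r"
      by (meson localizationE)
    then have c': "r \<in> carrier R" by auto
    have k1: "a \<otimes> b \<in> carrier R" "s \<otimes> t \<in> carrier R - I"
      and k2: "b \<otimes> d \<in> carrier R" "t \<otimes> r \<in> carrier R - I"
      using e f c c' comp by (simp_all del: Diff_iff)
    show "x \<otimes>\<^bsub>?L\<^esub> y \<otimes>\<^bsub>?L\<^esub> z = x \<otimes>\<^bsub>?L\<^esub> (y \<otimes>\<^bsub>?L\<^esub> z)"
      unfolding e(3,6) f(3) loc_mult[OF e(1,2,4,5)] loc_mult[OF e(4,5) f(1,2)]
        loc_mult[OF k1 f(1,2)] loc_mult[OF e(1,2) k2]
      using c c' e(1,4) f(1) by (simp add: m_assoc)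
  next
    show "\<one>\<^bsub>?L\<^esub> \<in> carrier ?L" unfolding loc_one using compl_one by (intro loc_frac_closed) auto
  qed
  moreover have "(x \<oplus>\<^bsub>?L\<^esub> y) \<otimes>\<^bsub>?L\<^esub> z = x \<otimes>\<^bsub>?L\<^esub> z \<oplus>\<^bsub>?L\<^esub> y \<otimes>\<^bsub>?L\<^esub> z"
    if xyz: "x \<in> carrier ?L" "y \<in> carrier ?L" "z \<in> carrier ?L" for x y z
  proof -
    obtain a s b t d r where e: "a \<in> carrier R" "s \<in> carrier R - I" "x = loc_frac R I a s"
      "b \<in> carrier R" "t \<in> carrier R - I" "y = loc_frac R I b t"
      and f: "d \<in> carrier R" "r \<in> carrier R - I" "z = loc_frac R I d r"
      using xyz by (meson localizationE)
    then have c: "s \<in> carrier R" "t \<in> carrier R" "r \<in> carrier R" by auto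
    have k: "a \<otimes> t \<oplus> b \<otimes> s \<in> carrier R" "s \<otimes> t \<in> carrier R - I"
      "a \<otimes> d \<in> carrier R" "s \<otimes> r \<in> carrier R - I"
      "b \<otimes> d \<in> carrier R" "t \<otimes> r \<in> carrier R - I"
      using e f c comp by (simp_all del: Diff_iff)
    have "(a \<otimes> t \<oplus> b \<otimes> s) \<otimes> d \<otimes> (s \<otimes> r \<otimes> (t \<otimes> r))
      = (a \<otimes> d \<otimes> (t \<otimes> r) \<oplus> b \<otimes> d \<otimes> (s \<otimes> r)) \<otimes> (s \<otimes> t \<otimes> r)"
      using c e(1,4) f(1) by algebra
    then have "loc_frac R I ((a \<otimes> t \<oplus> b \<otimes> s) \<otimes> d) (s \<otimes> t \<otimes> r)
      = loc_frac R I (a \<otimes> d \<otimes> (t \<otimes> r) \<oplus> b \<otimes> d \<otimes> (s \<otimes> r)) (s \<otimes> r \<otimes> (t \<otimes> r))"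
      using k e(1,4) f(1,2) c comp by (intro loc_frac_eqI) (simp_all del: Diff_iff)
    then show ?thesis
      unfolding e(3,6) f(3) loc_add[OF e(1,2,4,5)] loc_mult[OF k(1,2) f(1,2)]
        loc_mult[OF e(1,2) f(1,2)] loc_mult[OF e(4,5) f(1,2)] loc_add[OF k(3-6)] .
  qed
  ultimately show ?thesis by (rule cringI)
qed

end

text \<open>These properties determine the localization \<open>R \<rightarrow> R\<^sub>P\<close> up to isomorphism.  Arguing from them
  avoids equivalence classes of fractions in everything that follows.\<close>

locale localization_map = ring_hom_cring R S h for R (structure) and S (structure) and h +
  fixes P
  assumes prime: "primeideal P R"
    and hom_eq_zeroD: "\<lbrakk>a \<in> carrier R; h a = \<zero>\<^bsub>S\<^esub>\<rbrakk> \<Longrightarrow> \<exists>u\<in>carrier R - P. u \<otimes> a = \<zero>"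
    and hom_unit: "s \<in> carrier R - P \<Longrightarrow> h s \<in> Units S"
    and fraction: "y \<in> carrier S \<Longrightarrow> \<exists>a\<in>carrier R. \<exists>s\<in>carrier R - P. y \<otimes>\<^bsub>S\<^esub> h s = h a"

theorem (in primeideal) localization_map:
  "localization_map R (localization R I) (\<lambda>a. loc_frac R I a \<one>) I"
proof -
  let ?L = "localization R I" and ?h = "\<lambda>a. loc_frac R I a \<one>"
  interpret L: cring ?L by (rule localization_cring)
  have hom: "?h \<in> ring_hom R ?L"
  proof (rule ring_hom_memI)
    fix a b assume ab: "a \<in> carrier R" "b \<in> carrier R"
    show "?h a \<in> carrier ?L" using ab(1) compl_one by (rule loc_frac_closed)
    show "?h (a \<otimes> b) = ?h a \<otimes>\<^bsub>?L\<^esub> ?h b"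
      using ab by (simp add: loc_mult compl_one del: Diff_iff)
    show "?h (a \<oplus> b) = ?h a \<oplus>\<^bsub>?L\<^esub> ?h b"
      using ab by (simp add: loc_add compl_one del: Diff_iff)
  qed (simp add: loc_one)
  have unit: "?h s \<in> Units ?L" if s: "s \<in> carrier R - I" for s
  proof -
    have c: "?h s \<in> carrier ?L" "loc_frac R I \<one> s \<in> carrier ?L" "s \<in> carrier R"
      using s compl_one by (auto intro!: loc_frac_closed)
    have "?h s \<otimes>\<^bsub>?L\<^esub> loc_frac R I \<one> s = loc_frac R I (s \<otimes> \<one>) (\<one> \<otimes> s)"
      by (rule loc_mult[OF c(3) compl_one one_closed s])
    also have "\<dots> = \<one>\<^bsub>?L\<^esub>"
      unfolding loc_one using c(3) s compl_one by (intro loc_frac_eqI) auto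
    finally have i: "?h s \<otimes>\<^bsub>?L\<^esub> loc_frac R I \<one> s = \<one>\<^bsub>?L\<^esub>" .
    then have "loc_frac R I \<one> s \<otimes>\<^bsub>?L\<^esub> ?h s = \<one>\<^bsub>?L\<^esub>"
      using L.m_comm[OF c(1,2)] by simp
    then show ?thesis using c i unfolding Units_def by blast
  qed
  show ?thesis
  proof (intro localization_map.intro localization_map_axioms.intro)
    show "ring_hom_cring R ?L ?h"
      using is_cring L.is_cring hom by (intro ring_hom_cring.intro ring_hom_cring_axioms.intro)
    show "primeideal I R" by (rule primeideal)
    show "?h s \<in> Units ?L" if "s \<in> carrier R - I" for s using unit[OF that] .
    show "\<exists>u\<in>carrier R - I. u \<otimes> a = \<zero>" if a: "a \<in> carrier R" "?h a = \<zero>\<^bsub>?L\<^esub>" for a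
    proof -
      have "loc_frac R I a \<one> = loc_frac R I \<zero> \<one>" using a by (simp add: loc_zero)
      then obtain u where "u \<in> carrier R - I" "u \<otimes> (a \<otimes> \<one>) = u \<otimes> (\<zero> \<otimes> \<one>)"
        using loc_frac_eq_iff[OF a(1) compl_one zero_closed compl_one] by blast
      then show ?thesis using a by (intro bexI[of _ u]) auto
    qed
    show "\<exists>a\<in>carrier R. \<exists>s\<in>carrier R - I. y \<otimes>\<^bsub>?L\<^esub> ?h s = ?h a" if y: "y \<in> carrier ?L" for y
    proof -
      obtain a s where e: "a \<in> carrier R" "s \<in> carrier R - I" "y = loc_frac R I a s"
        using y by (meson localizationE)
      have c: "s \<in> carrier R" "s \<otimes> \<one> \<in> carrier R - I" using e compl_mult compl_one by auto
      have "y \<otimes>\<^bsub>?L\<^esub> ?h s = loc_frac R I (a \<otimes> s) (s \<otimes> \<one>)"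
        unfolding e(3) by (rule loc_mult[OF e(1,2) c(1) compl_one])
      also have "\<dots> = ?h a"
        using e(1) c compl_one by (intro loc_frac_eqI) auto
      finally show ?thesis using e(1,2) by blast
    qed
  qed
qed

section \<open>Radicals, local rings, and ideals of a localization\<close>

definition ideal_radical :: "('a, 'm) ring_scheme \<Rightarrow> 'a set \<Rightarrow> 'a set" where
  "ideal_radical R J = {r \<in> carrier R. \<exists>k::nat. r [^]\<^bsub>R\<^esub> k \<in> J}"

lemma (in ring) ideal_of_closed:
  assumes "J \<subseteq> carrier R" "\<zero> \<in> J"
    and "\<And>a b. a \<in> J \<Longrightarrow> b \<in> J \<Longrightarrow> a \<oplus> b \<in> J"
    and "\<And>a x. a \<in> J \<Longrightarrow> x \<in> carrier R \<Longrightarrow> x \<otimes> a \<in> J"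
    and "\<And>a x. a \<in> J \<Longrightarrow> x \<in> carrier R \<Longrightarrow> a \<otimes> x \<in> J"
  shows "ideal J R"
proof (rule idealI[OF ring_axioms])
  show "subgroup J (add_monoid R)"
  proof (rule add.subgroupI)
    fix a assume a: "a \<in> J"
    have "\<ominus> a = (\<ominus> \<one>) \<otimes> a" using a assms(1) by (auto simp: l_minus)
    then show "\<ominus> a \<in> J" using assms(4)[OF a, of "\<ominus> \<one>"] by simp
  qed (use assms in auto)
qed (use assms in auto)

lemma (in ring) genideal_empty: "Idl {} = {\<zero>}"
proof
  show "Idl {} \<subseteq> {\<zero>}" by (rule genideal_minimal[OF zeroideal]) simp
  have "ideal (Idl {}) R" by (rule genideal_ideal) simp
  then show "{\<zero>} \<subseteq> Idl {}" by (simp add: additive_subgroup.zero_closed ideal.axioms(1))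
qed

lemma (in ideal) unit_imp_carrier: "u \<in> I \<Longrightarrow> u \<in> Units R \<Longrightarrow> I = carrier R"
  by (metis I_l_closed Units_inv_closed Units_l_inv one_imp_carrier)

lemma (in ideal) unit_mult_mem_iff:
  assumes "u \<in> Units R" "x \<in> carrier R"
  shows "u \<otimes> x \<in> I \<longleftrightarrow> x \<in> I" "x \<otimes> u \<in> I \<longleftrightarrow> x \<in> I"
proof -
  have c: "u \<in> carrier R" "inv u \<in> carrier R" using assms by auto
  have "inv u \<otimes> (u \<otimes> x) = x" using assms c by (simp add: m_assoc[symmetric])
  moreover have "(x \<otimes> u) \<otimes> inv u = x" using assms c by (simp add: m_assoc)
  ultimately show "u \<otimes> x \<in> I \<longleftrightarrow> x \<in> I" "x \<otimes> u \<in> I \<longleftrightarrow> x \<in> I"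
    using I_l_closed I_r_closed c by metis+
qed

lemma (in ideal) add_mem_iff:
  assumes "a \<in> carrier R" "b \<in> I"
  shows "a \<oplus> b \<in> I \<longleftrightarrow> a \<in> I" "a \<ominus> b \<in> I \<longleftrightarrow> a \<in> I"
proof -
  have b: "b \<in> carrier R" using assms(2) Icarr by simp
  have m: "\<ominus> b \<in> I" using assms(2) by simp
  have *: "a \<oplus> c \<in> I \<longleftrightarrow> a \<in> I" if c: "c \<in> I" for c
  proof
    assume "a \<oplus> c \<in> I"
    then have "a \<oplus> c \<oplus> \<ominus> c \<in> I" using c by simp
    moreover have "a \<oplus> c \<oplus> \<ominus> c = a" using assms(1) c Icarr[of c] by algebra
    ultimately show "a \<in> I" by simp
  qed (use c in simp)
  show "a \<oplus> b \<in> I \<longleftrightarrow> a \<in> I" "a \<ominus> b \<in> I \<longleftrightarrow> a \<in> I"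
    using *[OF assms(2)] *[OF m] by (simp_all add: minus_eq)
qed

context cring
begin

text \<open>This replaces the binomial theorem in the proof that radicals are closed under addition.
  Splitting off one factor \<open>x + y\<close> at a time leaves products \<open>x\<^sup>iy\<^sup>j\<close> of total degree at least
  \<open>m + n\<close>, and in each of them one exponent is large enough.\<close>

lemma pow_mult_pow_add_pow_mem:
  assumes J: "ideal J R" and x: "x \<in> carrier R" "x [^] (m::nat) \<in> J"
    and y: "y \<in> carrier R" "y [^] (n::nat) \<in> J"
  shows "m + n \<le> i + j + k \<Longrightarrow> x [^] i \<otimes> y [^] j \<otimes> (x \<oplus> y) [^] k \<in> J"
proof (induction k arbitrary: i j)
  case 0
  interpret J: ideal J R by (rule J)
  have big: "z [^] l \<in> J" if "z \<in> carrier R" "z [^] k \<in> J" "k \<le> l" for z and k l :: nat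
  proof -
    have "z [^] l = z [^] k \<otimes> z [^] (l - k)" using that by (simp add: nat_pow_mult)
    then show ?thesis using that J.I_r_closed by simp
  qed
  have "m \<le> i \<or> n \<le> j" using 0 by linarith
  then show ?case using big[OF x, of i] big[OF y, of j] x y J.I_l_closed J.I_r_closed by auto
next
  case (Suc k)
  interpret J: ideal J R by (rule J)
  have "x [^] i \<otimes> y [^] j \<otimes> (x \<oplus> y) [^] Suc k =
     x [^] Suc i \<otimes> y [^] j \<otimes> (x \<oplus> y) [^] k \<oplus> x [^] i \<otimes> y [^] Suc j \<otimes> (x \<oplus> y) [^] k"
  proof -
    define X Y Z where "X = x [^] i" "Y = y [^] j" "Z = (x \<oplus> y) [^] k"
    have c: "X \<in> carrier R" "Y \<in> carrier R" "Z \<in> carrier R" using x y by (auto simp: X_Y_Z_def)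
    have "X \<otimes> Y \<otimes> (Z \<otimes> (x \<oplus> y)) = (X \<otimes> x) \<otimes> Y \<otimes> Z \<oplus> X \<otimes> (Y \<otimes> y) \<otimes> Z"
      using c x(1) y(1) by algebra
    then show ?thesis by (simp add: X_Y_Z_def)
  qed
  then show ?case using Suc.IH[of "Suc i" j] Suc.IH[of i "Suc j"] Suc.prems by simp
qed

lemma ideal_radical_ideal:
  assumes J: "ideal J R"
  shows "ideal (ideal_radical R J) R"
proof (rule ideal_of_closed)
  interpret J: ideal J R by (rule J)
  show "ideal_radical R J \<subseteq> carrier R" by (auto simp: ideal_radical_def)
  have "\<zero> [^] (1::nat) \<in> J" by simp
  then show "\<zero> \<in> ideal_radical R J" unfolding ideal_radical_def by blast
  show "a \<oplus> b \<in> ideal_radical R J" if ab: "a \<in> ideal_radical R J" "b \<in> ideal_radical R J" for a b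
  proof -
    obtain m n :: nat where "a [^] m \<in> J" "b [^] n \<in> J" and c: "a \<in> carrier R" "b \<in> carrier R"
      using ab by (auto simp: ideal_radical_def)
    then have "a [^] (0::nat) \<otimes> b [^] (0::nat) \<otimes> (a \<oplus> b) [^] (m + n) \<in> J"
      by (intro pow_mult_pow_add_pow_mem[OF J]) auto
    then show ?thesis using c by (auto simp: ideal_radical_def)
  qed
  show l: "x \<otimes> a \<in> ideal_radical R J" if a: "a \<in> ideal_radical R J" and x: "x \<in> carrier R" for a x
  proof -
    obtain m :: nat where "a [^] m \<in> J" and c: "a \<in> carrier R"
      using a by (auto simp: ideal_radical_def)
    then have "(x \<otimes> a) [^] m \<in> J" using x J.I_l_closed by (simp add: nat_pow_distrib)
    then show ?thesis using c x by (auto simp: ideal_radical_def)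
  qed
  show "a \<otimes> x \<in> ideal_radical R J" if a: "a \<in> ideal_radical R J" and x: "x \<in> carrier R" for a x
    using l[OF a x] a x m_comm[of a x] by (auto simp: ideal_radical_def)
qed

lemma ideal_subset_radical: "ideal J R \<Longrightarrow> J \<subseteq> ideal_radical R J"
proof -
  assume "ideal J R"
  then interpret J: ideal J R .
  have "x [^] (1::nat) \<in> J" if "x \<in> J" for x using that J.Icarr by simp
  then show ?thesis unfolding ideal_radical_def using J.Icarr by blast
qed

lemma radical_pow:
  assumes "x \<in> carrier R" "x [^] (k::nat) \<in> ideal_radical R J"
  shows "x \<in> ideal_radical R J"
  using assms by (auto simp: ideal_radical_def nat_pow_pow)

lemma radical_mono: "I \<subseteq> J \<Longrightarrow> ideal_radical R I \<subseteq> ideal_radical R J"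
  by (auto simp: ideal_radical_def)

lemma zero_radical_subset: "ideal J R \<Longrightarrow> ideal_radical R {\<zero>} \<subseteq> ideal_radical R J"
  by (intro radical_mono) (simp add: additive_subgroup.zero_closed ideal.axioms(1))

lemma nilpotent_in_prime: "primeideal Q R \<Longrightarrow> ideal_radical R {\<zero>} \<subseteq> Q"
proof
  fix x assume "primeideal Q R" and x: "x \<in> ideal_radical R {\<zero>}"
  then interpret Q: primeideal Q R by simp
  obtain k :: nat where c: "x \<in> carrier R" and k: "x [^] k = \<zero>"
    using x by (auto simp: ideal_radical_def)
  have "x [^] n \<in> Q \<Longrightarrow> x \<in> Q" for n :: nat
  proof (induction n)
    case 0 then show ?case using Q.I_notcarr Q.one_imp_carrier by auto
  next
    case (Suc n) then show ?case using Q.I_prime[of "x [^] n" x] c by auto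
  qed
  then show "x \<in> Q" using k Q.zero_closed by metis
qed

text \<open>For nilpotent \<open>v\<close> this shows that a power of \<open>b\<close> annihilates \<open>y\<close>.\<close>

lemma pow_mult_eq_of_mult_eq:
  assumes "b \<in> carrier R" "v \<in> carrier R" "y \<in> carrier R" "b \<otimes> y = v \<otimes> y"
  shows "b [^] (m::nat) \<otimes> y = v [^] m \<otimes> y"
proof (induction m)
  case (Suc m)
  have "b [^] Suc m \<otimes> y = b [^] m \<otimes> (b \<otimes> y)" using assms by (simp add: m_assoc)
  also have "\<dots> = v \<otimes> (b [^] m \<otimes> y)" using assms by (simp add: m_lcomm)
  also have "\<dots> = v [^] Suc m \<otimes> y" using assms Suc by (simp add: m_assoc m_lcomm)
  finally show ?case .
qed simp

lemma nonunits_maximal: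
  assumes M: "ideal (carrier R - Units R) R"
  shows "maximalideal (carrier R - Units R) R"
    and "maximalideal M' R \<Longrightarrow> M' = carrier R - Units R"
proof -
  interpret M: ideal "carrier R - Units R" R by (rule M)
  show "maximalideal (carrier R - Units R) R"
  proof (rule maximalidealI[OF M])
    show "carrier R \<noteq> carrier R - Units R" by blast
    fix J assume J: "ideal J R" "carrier R - Units R \<subseteq> J" "J \<subseteq> carrier R"
    then show "J = carrier R - Units R \<or> J = carrier R"
      using ideal.unit_imp_carrier[OF J(1)] by blast
  qed
  assume M': "maximalideal M' R"
  then interpret M': maximalideal M' R .
  have "M' \<subseteq> carrier R - Units R"
    using M'.unit_imp_carrier M'.I_notcarr M'.Icarr by blast
  then show "M' = carrier R - Units R"
    using M'.I_maximal[OF M] by blast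
qed

lemma prime_subset_nonunits: "primeideal Q R \<Longrightarrow> Q \<subseteq> carrier R - Units R"
proof -
  assume "primeideal Q R"
  then interpret Q: primeideal Q R .
  show ?thesis using Q.unit_imp_carrier Q.I_notcarr Q.Icarr by blast
qed

end

context localization_map
begin

lemma one_ne_zero: "\<one>\<^bsub>S\<^esub> \<noteq> \<zero>\<^bsub>S\<^esub>"
proof
  assume "\<one>\<^bsub>S\<^esub> = \<zero>\<^bsub>S\<^esub>"
  then have "h \<one> = \<zero>\<^bsub>S\<^esub>" by simp
  then obtain u where u: "u \<in> carrier R - P" "u \<otimes> \<one> = \<zero>" using hom_eq_zeroD R.one_closed by blast
  interpret P: primeideal P R by (rule prime)
  show False using u P.zero_closed by auto
qed

text \<open>If \<open>y = a/s\<close> has the inverse \<open>b/t\<close>, then \<open>ab\<close> and \<open>st\<close> agree after multiplication with some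
  \<open>v \<notin> P\<close>; since \<open>vst \<notin> P\<close>, also \<open>a \<notin> P\<close>.\<close>

lemma unit_iff:
  assumes y: "y \<in> carrier S" and a: "a \<in> carrier R" and s: "s \<in> carrier R - P"
    and eq: "y \<otimes>\<^bsub>S\<^esub> h s = h a"
  shows "y \<in> Units S \<longleftrightarrow> a \<notin> P"
proof
  interpret P: primeideal P R by (rule prime)
  have sc: "s \<in> carrier R" using s by simp
  assume "a \<notin> P"
  then have "h a \<in> Units S" using a hom_unit by simp
  then have "y \<otimes>\<^bsub>S\<^esub> h s \<otimes>\<^bsub>S\<^esub> inv\<^bsub>S\<^esub> (h a) = \<one>\<^bsub>S\<^esub>" using eq by simp
  then have "y \<otimes>\<^bsub>S\<^esub> (h s \<otimes>\<^bsub>S\<^esub> inv\<^bsub>S\<^esub> (h a)) = \<one>\<^bsub>S\<^esub>"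
    using y sc \<open>h a \<in> Units S\<close> by (simp add: S.m_assoc)
  moreover have "h s \<otimes>\<^bsub>S\<^esub> inv\<^bsub>S\<^esub> (h a) \<in> carrier S" using sc \<open>h a \<in> Units S\<close> by simp
  ultimately show "y \<in> Units S" using y S.m_comm unfolding Units_def by (metis (mono_tags, lifting) mem_Collect_eq)
next
  interpret P: primeideal P R by (rule prime)
  assume u: "y \<in> Units S"
  define w where "w = inv\<^bsub>S\<^esub> y"
  have w: "w \<in> carrier S" "y \<otimes>\<^bsub>S\<^esub> w = \<one>\<^bsub>S\<^esub>" using u by (auto simp: w_def)
  obtain b t where bt: "b \<in> carrier R" "t \<in> carrier R - P" "w \<otimes>\<^bsub>S\<^esub> h t = h b"
    using fraction[OF w(1)] by blast
  have c: "s \<in> carrier R" "t \<in> carrier R" using s bt by auto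
  have "h (a \<otimes> b) = (y \<otimes>\<^bsub>S\<^esub> h s) \<otimes>\<^bsub>S\<^esub> (w \<otimes>\<^bsub>S\<^esub> h t)" using eq a bt by simp
  also have "\<dots> = (y \<otimes>\<^bsub>S\<^esub> w) \<otimes>\<^bsub>S\<^esub> (h s \<otimes>\<^bsub>S\<^esub> h t)" using c y w(1) by (simp add: S.m_ac)
  also have "\<dots> = h (s \<otimes> t)" using w c by simp
  finally have "h (a \<otimes> b \<ominus> s \<otimes> t) = \<zero>\<^bsub>S\<^esub>" using a bt c by (simp add: R.minus_eq S.r_neg)
  moreover have "a \<otimes> b \<ominus> s \<otimes> t \<in> carrier R" using a bt c by simp
  ultimately obtain v where v: "v \<in> carrier R - P" "v \<otimes> (a \<otimes> b \<ominus> s \<otimes> t) = \<zero>"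
    using hom_eq_zeroD by blast
  have vc: "v \<in> carrier R" using v by simp
  have "v \<otimes> (s \<otimes> t) = v \<otimes> (a \<otimes> b) \<ominus> v \<otimes> (a \<otimes> b \<ominus> s \<otimes> t)"
    using a bt(1) c vc by algebra
  then have e: "v \<otimes> (s \<otimes> t) = v \<otimes> (a \<otimes> b)" using v a bt c vc by (simp add: R.minus_eq)
  have "v \<otimes> (s \<otimes> t) \<notin> P" using P.compl_mult v s bt by blast
  then show "a \<notin> P" using e a bt vc P.I_l_closed P.I_r_closed by auto
qed

lemma hom_unit_iff: "a \<in> carrier R \<Longrightarrow> h a \<in> Units S \<longleftrightarrow> a \<notin> P"
proof -
  interpret P: primeideal P R by (rule prime)
  show "a \<in> carrier R \<Longrightarrow> h a \<in> Units S \<longleftrightarrow> a \<notin> P"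
    by (rule unit_iff[of _ _ \<one>]) (use P.compl_one in auto)
qed

lemma nonunits_ideal: "ideal (carrier S - Units S) S"
proof -
  interpret P: primeideal P R by (rule prime)
  have mult: "x \<otimes>\<^bsub>S\<^esub> y \<in> carrier S - Units S"
    if xy: "x \<in> carrier S" "y \<in> carrier S - Units S" for x y
  proof -
    obtain a s where as: "a \<in> carrier R" "s \<in> carrier R - P" "x \<otimes>\<^bsub>S\<^esub> h s = h a"
      using fraction[of x] xy by blast
    obtain b t where bt: "b \<in> carrier R" "t \<in> carrier R - P" "y \<otimes>\<^bsub>S\<^esub> h t = h b"
      using fraction[of y] xy by blast
    have c: "s \<in> carrier R" "t \<in> carrier R" "y \<in> carrier S" using as bt xy by auto
    have "b \<in> P" using unit_iff[OF c(3) bt] xy by blast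
    then have ab: "a \<otimes> b \<in> P" using as P.I_l_closed by simp
    have "(x \<otimes>\<^bsub>S\<^esub> y) \<otimes>\<^bsub>S\<^esub> h (s \<otimes> t) = (x \<otimes>\<^bsub>S\<^esub> h s) \<otimes>\<^bsub>S\<^esub> (y \<otimes>\<^bsub>S\<^esub> h t)"
      using c xy by (simp add: S.m_ac)
    also have "\<dots> = h (a \<otimes> b)" using as bt by simp
    finally have "x \<otimes>\<^bsub>S\<^esub> y \<in> Units S \<longleftrightarrow> a \<otimes> b \<notin> P"
      using as bt xy c P.compl_mult by (intro unit_iff[of _ _ "s \<otimes> t"]) auto
    then show ?thesis using ab xy by auto
  qed
  show ?thesis
  proof (rule S.ideal_of_closed)
    have "\<zero> \<in> P" by simp
    then show "\<zero>\<^bsub>S\<^esub> \<in> carrier S - Units S" using hom_unit_iff[of \<zero>] by simp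
    show "y \<otimes>\<^bsub>S\<^esub> x \<in> carrier S - Units S"
      if "y \<in> carrier S - Units S" "x \<in> carrier S" for x y
      using mult[of x y] S.m_comm[of y x] that by auto
    show "x \<oplus>\<^bsub>S\<^esub> y \<in> carrier S - Units S"
      if xy: "x \<in> carrier S - Units S" "y \<in> carrier S - Units S" for x y
    proof -
      obtain a s where as: "a \<in> carrier R" "s \<in> carrier R - P" "x \<otimes>\<^bsub>S\<^esub> h s = h a"
        using fraction[of x] xy by blast
      obtain b t where bt: "b \<in> carrier R" "t \<in> carrier R - P" "y \<otimes>\<^bsub>S\<^esub> h t = h b"
        using fraction[of y] xy by blast
      have c: "s \<in> carrier R" "t \<in> carrier R" "x \<in> carrier S" "y \<in> carrier S"
        using as bt xy by auto
      have "a \<in> P" "b \<in> P" using unit_iff[OF c(3) as] unit_iff[OF c(4) bt] xy by blast+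
      then have ab: "a \<otimes> t \<oplus> b \<otimes> s \<in> P" using c P.I_r_closed by simp
      have hc: "h s \<in> carrier S" "h t \<in> carrier S" using c by auto
      have "(x \<oplus>\<^bsub>S\<^esub> y) \<otimes>\<^bsub>S\<^esub> h (s \<otimes> t)
        = (x \<otimes>\<^bsub>S\<^esub> h s) \<otimes>\<^bsub>S\<^esub> h t \<oplus>\<^bsub>S\<^esub> (y \<otimes>\<^bsub>S\<^esub> h t) \<otimes>\<^bsub>S\<^esub> h s"
        using c hc by (simp add: S.l_distr S.r_distr S.m_ac)
      also have "\<dots> = h (a \<otimes> t \<oplus> b \<otimes> s)" using as bt c by simp
      finally have "x \<oplus>\<^bsub>S\<^esub> y \<in> Units S \<longleftrightarrow> a \<otimes> t \<oplus> b \<otimes> s \<notin> P"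
        using as bt xy c P.compl_mult by (intro unit_iff[of _ _ "s \<otimes> t"]) auto
      then show ?thesis using ab c by auto
    qed
  qed (use mult in auto)
qed

lemma hom_mem_iff:
  assumes J: "ideal J S" and y: "y \<in> carrier S" "a \<in> carrier R" "s \<in> carrier R - P"
    "y \<otimes>\<^bsub>S\<^esub> h s = h a"
  shows "y \<in> J \<longleftrightarrow> h a \<in> J"
  using ideal.unit_mult_mem_iff(2)[OF J hom_unit[OF y(3)] y(1)] y(4) by simp

text \<open>An ideal of the localization is generated by the images of any generators of its preimage.\<close>

lemma noetherian_localization:
  assumes "noetherian_ring R"
  shows "noetherian_ring S"
proof (rule S.noetherian_ringI)
  fix J assume J: "ideal J S"
  let ?K = "{r \<in> carrier R. h r \<in> J}"
  have "ideal ?K R" by (rule ring.ideal_vimage[OF J])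
  then obtain A where A: "A \<subseteq> carrier R" "finite A" "?K = Idl\<^bsub>R\<^esub> A"
    using noetherian_ring.finetely_gen[OF assms] by blast
  have hA: "h ` A \<subseteq> carrier S" using A(1) by auto
  have I: "ideal (Idl\<^bsub>S\<^esub> (h ` A)) S" by (rule S.genideal_ideal[OF hA])
  have "A \<subseteq> ?K" unfolding A(3) by (rule R.genideal_self[OF A(1)])
  then have "Idl\<^bsub>S\<^esub> (h ` A) \<subseteq> J" by (intro S.genideal_minimal[OF J]) auto
  moreover have "J \<subseteq> Idl\<^bsub>S\<^esub> (h ` A)"
  proof
    fix y assume y: "y \<in> J"
    have yc: "y \<in> carrier S" using y J by (rule ideal.Icarr[rotated])
    obtain a s where as: "a \<in> carrier R" "s \<in> carrier R - P" "y \<otimes>\<^bsub>S\<^esub> h s = h a"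
      using fraction[OF yc] by blast
    have "a \<in> Idl\<^bsub>R\<^esub> A" unfolding A(3)[symmetric] using hom_mem_iff[OF J yc as] y as by simp
    also have "Idl\<^bsub>R\<^esub> A \<subseteq> {r \<in> carrier R. h r \<in> Idl\<^bsub>S\<^esub> (h ` A)}"
      by (intro R.genideal_minimal ring.ideal_vimage I) (use S.genideal_self[OF hA] A(1) in auto)
    finally show "y \<in> Idl\<^bsub>S\<^esub> (h ` A)" using hom_mem_iff[OF I yc as] by simp
  qed
  ultimately show "\<exists>A\<subseteq>carrier S. finite A \<and> J = Idl\<^bsub>S\<^esub> A"
    using hA A(2) by (intro exI[of _ "h ` A"]) auto
qed

end

section \<open>Nilpotent thickenings of the affine line\<close>

lemma poly_ideal_principal:
  fixes T :: "'k::field poly set"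
  assumes zero: "0 \<in> T" and add: "\<And>p q. p \<in> T \<Longrightarrow> q \<in> T \<Longrightarrow> p + q \<in> T"
    and mult: "\<And>p q. p \<in> T \<Longrightarrow> q * p \<in> T"
  obtains d where "d \<in> T" "\<And>p. p \<in> T \<Longrightarrow> d dvd p"
proof (cases "T \<subseteq> {0}")
  case True
  then show ?thesis using zero that[of 0] by auto
next
  case False
  then have "\<exists>p. p \<in> T \<and> p \<noteq> 0" by blast
  then obtain d where d: "d \<in> T" "d \<noteq> 0" and min: "\<And>p. p \<in> T \<Longrightarrow> p \<noteq> 0 \<Longrightarrow> degree d \<le> degree p"
    using ex_has_least_nat[of "\<lambda>p. p \<in> T \<and> p \<noteq> 0" _ degree] by blast
  have "d dvd p" if p: "p \<in> T" for p
  proof -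
    have "p mod d = p + (- (p div d)) * d" by (simp add: algebra_simps minus_div_mult_eq_mod)
    then have "p mod d \<in> T" using add mult p d(1) by metis
    moreover have "\<not> degree d \<le> degree (p mod d)" if "p mod d \<noteq> 0"
      using degree_mod_less'[OF d(2) that] by simp
    ultimately show ?thesis using min by (auto simp: dvd_eq_mod_eq_0)
  qed
  then show ?thesis using d(1) that by blast
qed

text \<open>Let \<open>d\<close> and \<open>e\<close> generate \<open>T\<close> and \<open>U\<close>, and let \<open>d = e q\<close>.  Since \<open>e \<notin> T\<close> and \<open>T\<close> is prime, \<open>d\<close>
  divides \<open>q\<close>, and \<open>e\<close> is a unit.\<close>

lemma poly_prime_maximal:
  fixes T U :: "'k::field poly set"
  assumes T: "0 \<in> T" "\<And>p q. p \<in> T \<Longrightarrow> q \<in> T \<Longrightarrow> p + q \<in> T" "\<And>p q. p \<in> T \<Longrightarrow> q * p \<in> T"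
    and prime: "\<And>p q. p * q \<in> T \<Longrightarrow> p \<in> T \<or> q \<in> T"
    and U: "\<And>p q. p \<in> U \<Longrightarrow> q \<in> U \<Longrightarrow> p + q \<in> U" "\<And>p q. p \<in> U \<Longrightarrow> q * p \<in> U"
    and sub: "T \<subset> U" and nz: "p \<in> T" "p \<noteq> 0"
  shows "1 \<in> U"
proof -
  obtain d where d: "d \<in> T" "\<And>p. p \<in> T \<Longrightarrow> d dvd p" using poly_ideal_principal[OF T] by blast
  obtain e where e: "e \<in> U" "\<And>p. p \<in> U \<Longrightarrow> e dvd p"
    using poly_ideal_principal[of U] U sub T(1) by blast
  have d0: "d \<noteq> 0" using d(2)[OF nz(1)] nz(2) by auto
  obtain q where q: "d = e * q" using e(2)[of d] d(1) sub by blast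
  have "e \<notin> T"
  proof
    assume "e \<in> T"
    then have "U \<subseteq> T" using e(2) T(3) by (metis dvdE mult.commute subsetI)
    then show False using sub by blast
  qed
  then have "d dvd q" using prime d q by metis
  then obtain r where "q = d * r" by blast
  then have "d * (e * r) = d * 1" using q by (simp add: algebra_simps)
  then have "e * r = 1" using d0 by (metis mult_left_cancel)
  then show ?thesis using U(2)[OF e(1), of r] by (simp add: mult.commute)
qed

text \<open>A ring whose quotient by the nilpotents is \<open>K[X]\<close>, with a section \<open>\<phi>\<close> of the projection to
  \<open>K[X]\<close>.  Geometrically it is an affine line with embedded or nonreduced structure.\<close>

locale line_thickening = cring R for R (structure) +
  fixes \<phi> :: "'k::field poly \<Rightarrow> 'a"
  assumes phi_closed [simp, intro]: "\<phi> p \<in> carrier R"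
    and phi_add: "\<phi> (p + q) = \<phi> p \<oplus> \<phi> q"
    and phi_mult: "\<phi> (p * q) = \<phi> p \<otimes> \<phi> q"
    and phi_one: "\<phi> 1 = \<one>"
    and decomposition: "r \<in> carrier R \<Longrightarrow> \<exists>p. r \<ominus> \<phi> p \<in> ideal_radical R {\<zero>}"
    and phi_nilpotent: "\<phi> p \<in> ideal_radical R {\<zero>} \<Longrightarrow> p = 0"
begin

abbreviation nil where "nil \<equiv> ideal_radical R {\<zero>}"

lemma nil_ideal: "ideal nil R"
  by (rule ideal_radical_ideal[OF zeroideal])

lemma nil_closed: "v \<in> nil \<Longrightarrow> v \<in> carrier R"
  by (auto simp: ideal_radical_def)

lemma phi_zero: "\<phi> 0 = \<zero>"
  using phi_add[of 0 0] by (metis add.r_cancel_one' phi_closed add_0)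

lemma phi_uminus: "\<phi> (- p) = \<ominus> \<phi> p"
  using phi_add[of "- p" p] by (simp add: phi_zero minus_equality)

lemma phi_diff: "\<phi> (p - q) = \<phi> p \<ominus> \<phi> q"
  using phi_add[of p "- q"] by (simp add: phi_uminus minus_eq)

lemma decompose:
  assumes "r \<in> carrier R"
  obtains p v where "v \<in> nil" "r = \<phi> p \<oplus> v"
proof -
  obtain p where p: "r \<ominus> \<phi> p \<in> nil" using decomposition assms by blast
  have "r = \<phi> p \<oplus> (r \<ominus> \<phi> p)" using assms phi_closed[of p] by algebra
  then show ?thesis using that p by blast
qed

lemma nil_iff: "v \<in> nil \<Longrightarrow> \<phi> p \<oplus> v \<in> nil \<longleftrightarrow> p = 0"
  using ideal.add_mem_iff(1)[OF nil_ideal phi_closed, of v p] phi_nilpotent phi_zero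
    additive_subgroup.zero_closed[OF ideal.axioms(1)[OF nil_ideal]] by auto

lemma nil_prime: "r \<in> carrier R \<Longrightarrow> s \<in> carrier R \<Longrightarrow> r \<otimes> s \<in> nil \<Longrightarrow> r \<in> nil \<or> s \<in> nil"
proof -
  interpret N: ideal nil R by (rule nil_ideal)
  assume rs: "r \<in> carrier R" "s \<in> carrier R" "r \<otimes> s \<in> nil"
  obtain p v where p: "v \<in> nil" "r = \<phi> p \<oplus> v" using decompose[OF rs(1)] .
  obtain q w where q: "w \<in> nil" "s = \<phi> q \<oplus> w" using decompose[OF rs(2)] .
  have vw: "v \<in> carrier R" "w \<in> carrier R" using p q nil_closed by auto
  define x where "x = \<phi> p \<otimes> w \<oplus> v \<otimes> s"
  have x: "x \<in> nil" unfolding x_def using p q rs N.I_l_closed N.I_r_closed by simp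
  have "r \<otimes> s = \<phi> p \<otimes> \<phi> q \<oplus> x" unfolding x_def p(2) q(2) using vw phi_closed[of p] phi_closed[of q]
    by algebra
  then have "\<phi> (p * q) \<oplus> x \<in> nil" using rs(3) by (simp add: phi_mult)
  then have "p = 0 \<or> q = 0" using nil_iff[OF x] by simp
  then show ?thesis using p q nil_iff by auto
qed

text \<open>The maximal ideal at the origin of the line.\<close>

definition origin :: "'a set" where
  "origin = {r \<in> carrier R. \<exists>p. poly p 0 = 0 \<and> r \<ominus> \<phi> p \<in> nil}"

lemma origin_iff:
  assumes "v \<in> nil"
  shows "\<phi> p \<oplus> v \<in> origin \<longleftrightarrow> poly p 0 = 0"
proof -
  have v: "v \<in> carrier R" using assms nil_closed by simp
  have e: "\<phi> p \<oplus> v \<ominus> \<phi> q = \<phi> (p - q) \<oplus> v" for q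
  proof -
    have "\<phi> p \<oplus> v \<ominus> \<phi> q = \<phi> p \<ominus> \<phi> q \<oplus> v" using v phi_closed[of p] phi_closed[of q] by algebra
    then show ?thesis by (simp add: phi_diff)
  qed
  show ?thesis using v unfolding origin_def by (auto simp: e nil_iff[OF assms])
qed

lemma originE:
  assumes "r \<in> origin"
  obtains p v where "v \<in> nil" "r = \<phi> p \<oplus> v" "poly p 0 = 0"
proof -
  have "r \<in> carrier R" using assms by (simp add: origin_def)
  then obtain p v where "v \<in> nil" "r = \<phi> p \<oplus> v" by (rule decompose)
  then show ?thesis using that assms origin_iff by blast
qed

lemma origin_ideal: "ideal origin R"
proof (rule ideal_of_closed)
  interpret N: ideal nil R by (rule nil_ideal)
  show "origin \<subseteq> carrier R" by (auto simp: origin_def)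
  show "\<zero> \<in> origin" using origin_iff[of "\<zero>" 0] by (simp add: phi_zero)
  show "a \<oplus> b \<in> origin" if ab: "a \<in> origin" "b \<in> origin" for a b
  proof -
    obtain p v where p: "v \<in> nil" "a = \<phi> p \<oplus> v" "poly p 0 = 0" using originE[OF ab(1)] .
    obtain q w where q: "w \<in> nil" "b = \<phi> q \<oplus> w" "poly q 0 = 0" using originE[OF ab(2)] .
    have vw: "v \<in> carrier R" "w \<in> carrier R" using p q nil_closed by auto
    have "a \<oplus> b = \<phi> p \<oplus> \<phi> q \<oplus> (v \<oplus> w)"
      unfolding p(2) q(2) using vw phi_closed[of p] phi_closed[of q] by algebra
    then have "a \<oplus> b = \<phi> (p + q) \<oplus> (v \<oplus> w)" by (simp add: phi_add)
    then show ?thesis using origin_iff[of "v \<oplus> w" "p + q"] p q by simp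
  qed
  show l: "x \<otimes> a \<in> origin" if a: "a \<in> origin" and x: "x \<in> carrier R" for a x
  proof -
    obtain p v where p: "v \<in> nil" "a = \<phi> p \<oplus> v" "poly p 0 = 0" using originE[OF a] .
    obtain q w where q: "w \<in> nil" "x = \<phi> q \<oplus> w" using decompose[OF x] .
    have vw: "v \<in> carrier R" "w \<in> carrier R" using p q nil_closed by auto
    have "x \<otimes> a = \<phi> q \<otimes> \<phi> p \<oplus> (w \<otimes> \<phi> p \<oplus> x \<otimes> v)"
      unfolding p(2) q(2) using vw phi_closed[of p] phi_closed[of q] by algebra
    then have "x \<otimes> a = \<phi> (q * p) \<oplus> (w \<otimes> \<phi> p \<oplus> x \<otimes> v)" by (simp add: phi_mult)
    moreover have "w \<otimes> \<phi> p \<oplus> x \<otimes> v \<in> nil" using p q x N.I_l_closed N.I_r_closed by simp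
    ultimately show ?thesis using origin_iff[of _ "q * p"] p by simp
  qed
  show "a \<otimes> x \<in> origin" if a: "a \<in> origin" and x: "x \<in> carrier R" for a x
    using l[OF a x] m_comm[of a x] a x by (simp add: origin_def)
qed

lemma origin_maximal: "maximalideal origin R"
proof (rule maximalidealI[OF origin_ideal])
  interpret N: ideal nil R by (rule nil_ideal)
  have "\<one> \<notin> origin" using origin_iff[of "\<zero>" 1] by (simp add: phi_one)
  then show "carrier R \<noteq> origin" by auto
  fix J assume J: "ideal J R" "origin \<subseteq> J" "J \<subseteq> carrier R"
  interpret J: ideal J R by (rule J)
  show "J = origin \<or> J = carrier R"
  proof (cases "J \<subseteq> origin")
    case False
    then obtain r where r: "r \<in> J" "r \<notin> origin" by blast
    obtain p v where p: "v \<in> nil" "r = \<phi> p \<oplus> v" using decompose r J.Icarr by metis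
    define c where "c = poly p 0"
    have c: "c \<noteq> 0" using p r origin_iff c_def by auto
    have v: "v \<in> carrier R" using p nil_closed by simp
    have "\<phi> (p - [:c:]) \<oplus> v \<in> J" using origin_iff[OF p(1), of "p - [:c:]"] J(2) c_def by auto
    moreover have "r = \<phi> [:c:] \<oplus> (\<phi> (p - [:c:]) \<oplus> v)"
      unfolding p(2) phi_diff using v phi_closed[of p] phi_closed[of "[:c:]"] by algebra
    ultimately have "\<phi> [:c:] \<in> J" using r(1) J.add_mem_iff(1) phi_closed by metis
    then have "\<phi> ([:1/c:] * [:c:]) \<in> J" unfolding phi_mult by (intro J.I_l_closed) auto
    moreover have "[:1/c:] * [:c:] = 1" using c by (simp add: one_pCons)
    ultimately have "\<one> \<in> J" using phi_one by metis
    then show ?thesis using J.one_imp_carrier by simp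
  qed (use J(2) in blast)
qed

end

locale localized_thickening = R?: line_thickening R \<phi> + localization_map R S h P
  for R (structure) and \<phi> :: "'k::field poly \<Rightarrow> 'a" and S (structure) and h and P +
  assumes P_maximal: "maximalideal P R"
begin

sublocale P: maximalideal P R by (rule P_maximal)
sublocale Pr: primeideal P R by (rule prime)

lemma nil_subset_P: "nil \<subseteq> P"
  by (rule R.nilpotent_in_prime[OF prime])

lemma decompose_local:
  assumes "y \<in> carrier S"
  obtains p v s where "v \<in> nil" "s \<in> carrier R - P" "y \<otimes>\<^bsub>S\<^esub> h s = h (\<phi> p) \<oplus>\<^bsub>S\<^esub> h v"
    "\<phi> p \<oplus> v \<in> P \<longleftrightarrow> \<phi> p \<in> P" "y \<otimes>\<^bsub>S\<^esub> h s = h (\<phi> p \<oplus> v)"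
proof -
  obtain a s where a: "a \<in> carrier R" "s \<in> carrier R - P" "y \<otimes>\<^bsub>S\<^esub> h s = h a"
    using fraction[OF assms] by blast
  obtain p v where p: "v \<in> nil" "a = \<phi> p \<oplus> v" using decompose[OF a(1)] .
  have v: "v \<in> carrier R" using p nil_closed by simp
  have "\<phi> p \<oplus> v \<in> P \<longleftrightarrow> \<phi> p \<in> P" by (rule P.add_mem_iff(1)) (use nil_subset_P p in auto)
  then show ?thesis using that[OF p(1) a(2)] a(3) p(2) v by simp
qed

lemma hom_nil: "v \<in> nil \<Longrightarrow> h v \<in> ideal_radical S {\<zero>\<^bsub>S\<^esub>}"
proof -
  assume "v \<in> nil"
  then obtain k :: nat where v: "v \<in> carrier R" "v [^] k = \<zero>" unfolding ideal_radical_def by blast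
  have "h v [^]\<^bsub>S\<^esub> k = h (v [^] k)" using v(1) by (simp add: ring.hom_nat_pow)
  then show ?thesis using v by (auto simp: ideal_radical_def)
qed

lemma hom_nil_iff: "a \<in> carrier R \<Longrightarrow> h a \<in> ideal_radical S {\<zero>\<^bsub>S\<^esub>} \<longleftrightarrow> a \<in> nil"
proof
  assume a: "a \<in> carrier R" and "h a \<in> ideal_radical S {\<zero>\<^bsub>S\<^esub>}"
  then obtain k :: nat where "h a [^]\<^bsub>S\<^esub> k = \<zero>\<^bsub>S\<^esub>" unfolding ideal_radical_def by blast
  then have "h (a [^] k) = \<zero>\<^bsub>S\<^esub>" using a by (simp add: ring.hom_nat_pow)
  then obtain u where u: "u \<in> carrier R - P" "u \<otimes> a [^] k = \<zero>"
    using hom_eq_zeroD[of "a [^] k"] a by auto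
  have "\<zero> \<in> nil" using nil_ideal by (simp add: additive_subgroup.zero_closed ideal.axioms(1))
  then have "u \<in> nil \<or> a [^] k \<in> nil" using nil_prime[of u "a [^] k"] u a by auto
  then have "a [^] k \<in> nil" using u nil_subset_P by auto
  then show "a \<in> nil" using R.radical_pow a by blast
qed (rule hom_nil)

lemma nilpotents_prime: "primeideal (ideal_radical S {\<zero>\<^bsub>S\<^esub>}) S"
proof (rule primeidealI)
  let ?N = "ideal_radical S {\<zero>\<^bsub>S\<^esub>}"
  show N: "ideal ?N S" by (rule S.ideal_radical_ideal[OF S.zeroideal])
  show "cring S" by (rule S.is_cring)
  have "\<one>\<^bsub>S\<^esub> \<notin> ?N" using one_ne_zero by (simp add: ideal_radical_def)
  then show "carrier S \<noteq> ?N" by blast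
  fix x y assume xy: "x \<in> carrier S" "y \<in> carrier S" "x \<otimes>\<^bsub>S\<^esub> y \<in> ?N"
  obtain a s where as: "a \<in> carrier R" "s \<in> carrier R - P" "x \<otimes>\<^bsub>S\<^esub> h s = h a"
    using fraction[OF xy(1)] by blast
  obtain b t where bt: "b \<in> carrier R" "t \<in> carrier R - P" "y \<otimes>\<^bsub>S\<^esub> h t = h b"
    using fraction[OF xy(2)] by blast
  have c: "h s \<in> carrier S" "h t \<in> carrier S" using as bt by auto
  have "h (a \<otimes> b) = (x \<otimes>\<^bsub>S\<^esub> h s) \<otimes>\<^bsub>S\<^esub> (y \<otimes>\<^bsub>S\<^esub> h t)" using as bt by simp
  also have "\<dots> = (x \<otimes>\<^bsub>S\<^esub> y) \<otimes>\<^bsub>S\<^esub> (h s \<otimes>\<^bsub>S\<^esub> h t)" using xy(1,2) c by (simp add: S.m_ac)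
  finally have "h (a \<otimes> b) \<in> ?N" using xy(3) c ideal.I_r_closed[OF N] by simp
  then have "a \<otimes> b \<in> nil" using hom_nil_iff[OF R.m_closed[OF as(1) bt(1)]] by blast
  then have "a \<in> nil \<or> b \<in> nil" using nil_prime as(1) bt(1) by simp
  then show "x \<in> ?N \<or> y \<in> ?N"
    using hom_nil_iff as(1) bt(1) hom_mem_iff[OF N xy(1) as] hom_mem_iff[OF N xy(2) bt] by blast
qed

text \<open>Up to a unit and a nilpotent, each element of the localization comes from \<open>K[X]\<close>.  So a
  prime ideal of the localization is determined by its preimage in \<open>K[X]\<close>.\<close>

lemma mem_prime_iff:
  assumes "y \<in> carrier S"
  obtains p where "\<And>Q. primeideal Q S \<Longrightarrow> y \<in> Q \<longleftrightarrow> h (\<phi> p) \<in> Q"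
proof -
  obtain p v s where d: "v \<in> nil" "s \<in> carrier R - P" "y \<otimes>\<^bsub>S\<^esub> h s = h (\<phi> p) \<oplus>\<^bsub>S\<^esub> h v"
    using decompose_local[OF assms] .
  have "y \<in> Q \<longleftrightarrow> h (\<phi> p) \<in> Q" if Q: "primeideal Q S" for Q
  proof -
    interpret Q: primeideal Q S by (rule Q)
    have "h v \<in> Q" using hom_nil[OF d(1)] S.nilpotent_in_prime[OF Q] by blast
    then have "y \<otimes>\<^bsub>S\<^esub> h s \<in> Q \<longleftrightarrow> h (\<phi> p) \<in> Q" using d(3) Q.add_mem_iff(1) by simp
    then show ?thesis using Q.unit_mult_mem_iff(2)[OF hom_unit[OF d(2)] assms] by simp
  qed
  then show ?thesis using that by blast
qed

text \<open>Chains of primes stay strict when pulled back to \<open>K[X]\<close>, where nonzero primes are maximal.\<close>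

lemma no_prime_chain:
  assumes Q: "primeideal Q0 S" "primeideal Q1 S" "primeideal Q2 S" and "Q0 \<subset> Q1" "Q1 \<subset> Q2"
  shows False
proof -
  interpret Q0: primeideal Q0 S by (rule Q)
  interpret Q1: primeideal Q1 S by (rule Q)
  interpret Q2: primeideal Q2 S by (rule Q)
  define T where "T Q = {p. h (\<phi> p) \<in> Q}" for Q
  have T_ideal: "0 \<in> T Q" "p \<in> T Q \<Longrightarrow> q \<in> T Q \<Longrightarrow> p + q \<in> T Q" "p \<in> T Q \<Longrightarrow> q * p \<in> T Q"
    "1 \<notin> T Q" "p * q \<in> T Q \<Longrightarrow> p \<in> T Q \<or> q \<in> T Q"
    if Q: "primeideal Q S" for Q p q
  proof -
    interpret Q: primeideal Q S by (rule Q)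
    show "0 \<in> T Q" "p \<in> T Q \<Longrightarrow> q \<in> T Q \<Longrightarrow> p + q \<in> T Q" "p \<in> T Q \<Longrightarrow> q * p \<in> T Q"
      "p * q \<in> T Q \<Longrightarrow> p \<in> T Q \<or> q \<in> T Q"
      using Q.I_l_closed Q.I_prime by (auto simp: T_def phi_zero phi_add phi_mult)
    show "1 \<notin> T Q" using Q.one_imp_carrier Q.I_notcarr by (auto simp: T_def phi_one)
  qed
  obtain y where y: "y \<in> Q1" "y \<notin> Q0" using assms by blast
  obtain p where "\<And>Q. primeideal Q S \<Longrightarrow> y \<in> Q \<longleftrightarrow> h (\<phi> p) \<in> Q"
    using mem_prime_iff[OF Q1.Icarr[OF y(1)]] by blast
  then have p: "p \<in> T Q1" "p \<notin> T Q0" using y Q by (auto simp: T_def)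
  obtain z where z: "z \<in> Q2" "z \<notin> Q1" using assms by blast
  obtain q where "\<And>Q. primeideal Q S \<Longrightarrow> z \<in> Q \<longleftrightarrow> h (\<phi> q) \<in> Q"
    using mem_prime_iff[OF Q2.Icarr[OF z(1)]] by blast
  then have q: "q \<in> T Q2" "q \<notin> T Q1" using z Q by (auto simp: T_def)
  have "1 \<in> T Q2"
  proof (rule poly_prime_maximal)
    show "T Q1 \<subset> T Q2" using q assms(5) by (auto simp: T_def)
    show "p \<in> T Q1" by (rule p(1))
    show "p \<noteq> 0" using p T_ideal(1)[OF Q(1)] by auto
  qed (fact T_ideal(1-3,5)[OF Q(2)] T_ideal(2,3)[OF Q(3)])+
  then show False using T_ideal(4)[OF Q(3)] by blast
qed

text \<open>Otherwise \<open>P\<close> is the set of nilpotents; but \<open>X\<close> is not invertible in the quotient \<open>K[X]\<close>.\<close>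

lemma exists_poly_in_P: "\<exists>p. p \<noteq> 0 \<and> \<phi> p \<in> P"
proof (rule ccontr)
  assume *: "\<not> ?thesis"
  let ?X = "\<phi> [:0, 1:]"
  let ?J = "P <+>\<^bsub>R\<^esub> PIdl\<^bsub>R\<^esub> ?X"
  have I: "ideal (PIdl\<^bsub>R\<^esub> ?X) R" by (rule R.cgenideal_ideal) simp
  have J: "ideal ?J R" by (rule R.add_ideals[OF P.is_ideal I])
  have J_iff: "x \<in> ?J \<longleftrightarrow> (\<exists>a\<in>P. \<exists>r\<in>carrier R. x = a \<oplus> r \<otimes> ?X)" for x
    by (auto simp: set_add_def' cgenideal_def)
  have "P \<subseteq> ?J"
  proof
    fix a assume a: "a \<in> P"
    have "a = a \<oplus> \<zero> \<otimes> ?X" using a by simp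
    then show "a \<in> ?J" unfolding J_iff using a R.zero_closed by blast
  qed
  moreover have "?J \<subseteq> carrier R" using ideal.Icarr[OF J] by blast
  ultimately have "?J = P \<or> ?J = carrier R" by (rule P.I_maximal[OF J])
  moreover have "?X \<in> ?J"
  proof -
    have "?X = \<zero> \<oplus> \<one> \<otimes> ?X" by simp
    then show ?thesis unfolding J_iff using P.zero_closed R.one_closed by blast
  qed
  moreover have "?X \<notin> P" using * by (metis pCons_eq_0_iff zero_neq_one)
  ultimately have "\<one> \<in> ?J" by auto
  then obtain a r where a: "a \<in> P" "r \<in> carrier R" "\<one> = a \<oplus> r \<otimes> ?X" using J_iff by auto
  obtain q v where q: "v \<in> nil" "r = \<phi> q \<oplus> v" using decompose[OF a(2)] .
  have v: "v \<in> carrier R" "v \<in> P" "a \<in> carrier R" using q nil_closed nil_subset_P a by auto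
  have "\<phi> (1 - q * [:0,1:]) = \<one> \<ominus> \<phi> q \<otimes> ?X" by (simp only: phi_diff phi_mult phi_one)
  also have "\<dots> = a \<oplus> v \<otimes> ?X"
    unfolding a(3) q(2) using v phi_closed[of q] phi_closed[of "[:0,1:]"] by algebra
  also have "\<dots> \<in> P" using a v P.I_r_closed by simp
  finally have "1 - q * [:0, 1:] = 0" using * by blast
  then have "poly (1 - q * [:0, 1:]) 0 = 0" by simp
  then show False by simp
qed

abbreviation MS where "MS \<equiv> carrier S - Units S"

lemma MS_maximal: "maximalideal MS S" "maximalideal M S \<Longrightarrow> M = MS"
  by (rule S.nonunits_maximal(1)[OF nonunits_ideal], rule S.nonunits_maximal(2)[OF nonunits_ideal])

lemma krull_dim_eq_one: "krull_dim S = 1"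
proof -
  let ?N = "ideal_radical S {\<zero>\<^bsub>S\<^esub>}"
  let ?C = "{enat k | k. \<exists>p. (\<forall>i\<le>k. primeideal (p i) S) \<and> (\<forall>i<k. p i \<subset> p (Suc i))}"
  have M: "primeideal MS S" by (rule S.maximalideal_prime[OF MS_maximal(1)])
  obtain p where p: "p \<noteq> 0" "\<phi> p \<in> P" using exists_poly_in_P by blast
  have "h (\<phi> p) \<in> MS" using hom_unit_iff[of "\<phi> p"] p by simp
  moreover have "h (\<phi> p) \<notin> ?N" using hom_nil_iff[of "\<phi> p"] phi_nilpotent p by auto
  moreover have "?N \<subseteq> MS" by (rule S.prime_subset_nonunits[OF nilpotents_prime])
  ultimately have "?N \<subset> MS" by blast
  then have "\<exists>q. (\<forall>i\<le>1::nat. primeideal (q i) S) \<and> (\<forall>i<1. q i \<subset> q (Suc i))"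
    using M nilpotents_prime by (intro exI[of _ "\<lambda>i::nat. if i = 0 then ?N else MS"]) simp
  then have "enat 1 \<in> ?C" by blast
  moreover have "x \<le> enat 1" if "x \<in> ?C" for x
  proof -
    from that obtain k where "x = enat k"
      "\<exists>q. (\<forall>i\<le>k. primeideal (q i) S) \<and> (\<forall>i<k. q i \<subset> q (Suc i))" by blast
    then obtain q where k: "x = enat k" "\<forall>i\<le>k. primeideal (q i) S" "\<forall>i<k. q i \<subset> q (Suc i)"
      by (elim exE conjE)
    have "\<not> 2 \<le> k"
    proof
      assume "2 \<le> k"
      then show False using no_prime_chain[of "q 0" "q (Suc 0)" "q (Suc (Suc 0))"] k by auto
    qed
    then show ?thesis using k by auto
  qed
  ultimately have "Sup ?C = enat 1" by (intro antisym Sup_least Sup_upper) auto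
  then show ?thesis by (simp add: krull_dim_def one_enat_def)
qed

text \<open>Modulo a nonzerodivisor, the maximal ideal consists of nilpotents.  Up to a unit and a
  nilpotent, \<open>a\<close> is a polynomial \<open>p\<^sub>1 \<noteq> 0\<close>, and \<open>P\<close> restricts to an ideal \<open>(d)\<close> of \<open>K[X]\<close>.  Factors of
  \<open>p\<^sub>1\<close> outside \<open>(d)\<close> become units in the localization, so a power of \<open>d\<close> lies in the radical, and
  with it all polynomials in \<open>P\<close>.\<close>

lemma nonunit_in_radical:
  assumes a: "a \<in> MS" and nzd: "\<And>y. y \<in> carrier S \<Longrightarrow> a \<otimes>\<^bsub>S\<^esub> y = \<zero>\<^bsub>S\<^esub> \<Longrightarrow> y = \<zero>\<^bsub>S\<^esub>"
    and J: "ideal J S" "a \<in> J" and b: "b \<in> MS"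
  shows "b \<in> ideal_radical S J"
proof -
  let ?rad = "ideal_radical S J"
  have rad: "ideal ?rad S" by (rule S.ideal_radical_ideal[OF J(1)])
  interpret rad: ideal ?rad S by (rule rad)
  have nil_rad: "h v \<in> ?rad" if "v \<in> nil" for v
    using hom_nil[OF that] S.zero_radical_subset[OF J(1)] by blast
  have ac: "a \<in> carrier S" "b \<in> carrier S" using a b by auto
  obtain p1 v1 s1 where d1: "v1 \<in> nil" "s1 \<in> carrier R - P"
    "a \<otimes>\<^bsub>S\<^esub> h s1 = h (\<phi> p1) \<oplus>\<^bsub>S\<^esub> h v1" "\<phi> p1 \<oplus> v1 \<in> P \<longleftrightarrow> \<phi> p1 \<in> P"
    "a \<otimes>\<^bsub>S\<^esub> h s1 = h (\<phi> p1 \<oplus> v1)" using decompose_local[OF ac(1)] .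
  obtain p2 v2 s2 where d2: "v2 \<in> nil" "s2 \<in> carrier R - P"
    "b \<otimes>\<^bsub>S\<^esub> h s2 = h (\<phi> p2) \<oplus>\<^bsub>S\<^esub> h v2" "\<phi> p2 \<oplus> v2 \<in> P \<longleftrightarrow> \<phi> p2 \<in> P"
    "b \<otimes>\<^bsub>S\<^esub> h s2 = h (\<phi> p2 \<oplus> v2)" using decompose_local[OF ac(2)] .
  have vc: "v1 \<in> carrier R" "v2 \<in> carrier R" using d1 d2 nil_closed by auto
  have "a \<in> Units S \<longleftrightarrow> \<phi> p1 \<oplus> v1 \<notin> P" "b \<in> Units S \<longleftrightarrow> \<phi> p2 \<oplus> v2 \<notin> P"
    using vc by (simp_all add: unit_iff[OF ac(1) _ d1(2,5)] unit_iff[OF ac(2) _ d2(2,5)])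
  then have inP: "\<phi> p1 \<in> P" "\<phi> p2 \<in> P"
    using a b d1(4) d2(4) by blast+
  define T where "T = {p. \<phi> p \<in> P}"
  have T: "0 \<in> T" "p \<in> T \<Longrightarrow> q \<in> T \<Longrightarrow> p + q \<in> T" "p \<in> T \<Longrightarrow> q * p \<in> T" for p q
    using P.I_l_closed by (auto simp: T_def phi_zero phi_add phi_mult)
  obtain d where d: "d \<in> T" "\<And>p. p \<in> T \<Longrightarrow> d dvd p" using poly_ideal_principal[OF T] by blast
  have p1: "p1 \<noteq> 0"
  proof
    let ?N = "ideal_radical S {\<zero>\<^bsub>S\<^esub>}"
    assume "p1 = 0"
    then have "a \<otimes>\<^bsub>S\<^esub> h s1 \<in> ?N" using d1(3) hom_nil[OF d1(1)] vc by (simp add: phi_zero)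
    then have "a \<in> ?N"
      using ideal.unit_mult_mem_iff(2)[OF primeideal.axioms(1)[OF nilpotents_prime] hom_unit[OF d1(2)] ac(1)]
      by simp
    then obtain k :: nat where k: "a [^]\<^bsub>S\<^esub> k = \<zero>\<^bsub>S\<^esub>" unfolding ideal_radical_def by blast
    have "a [^]\<^bsub>S\<^esub> n \<noteq> \<zero>\<^bsub>S\<^esub>" for n :: nat
    proof (induction n)
      case (Suc n)
      have "a [^]\<^bsub>S\<^esub> Suc n = a \<otimes>\<^bsub>S\<^esub> a [^]\<^bsub>S\<^esub> n" using ac by (simp add: S.m_comm)
      then show ?case using nzd[of "a [^]\<^bsub>S\<^esub> n"] Suc ac by auto
    qed (simp add: one_ne_zero)
    then show False using k by blast
  qed
  have "a \<otimes>\<^bsub>S\<^esub> h s1 \<in> ?rad"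
    using S.ideal_subset_radical[OF J(1)] J(2) d1(2) rad.I_r_closed by auto
  then have r1: "h (\<phi> p1) \<in> ?rad" using rad.add_mem_iff(1)[OF _ nil_rad[OF d1(1)]] d1(3) by simp
  \<comment> \<open>Powers of \<open>d\<close> are collected in front, since the radical need not be prime.\<close>
  have "h (\<phi> d) \<in> ?rad" if "p \<noteq> 0" "h (\<phi> (d ^ k * p)) \<in> ?rad" for p k
    using that
  proof (induction "degree p" arbitrary: p k rule: less_induct)
    case less
    have phi_pow: "h (\<phi> (d ^ k)) = h (\<phi> d) [^]\<^bsub>S\<^esub> k" for k
      by (induction k) (simp_all add: phi_one phi_mult S.m_comm)
    show ?case
    proof (cases "p \<in> T")
      case False
      then have "h (\<phi> p) \<in> Units S" using hom_unit_iff[of "\<phi> p"] by (simp add: T_def)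
      then have "h (\<phi> d) [^]\<^bsub>S\<^esub> k \<in> ?rad"
        using less.prems(2) rad.unit_mult_mem_iff(2)[of "h (\<phi> p)"] by (simp add: phi_mult phi_pow)
      then show ?thesis using S.radical_pow[of "h (\<phi> d)" k] by simp
    next
      case True
      then obtain q where q: "p = d * q" using d(2) by blast
      have "degree d \<noteq> 0"
      proof
        assume "degree d = 0"
        then obtain c where c: "d = [:c:]" by (metis degree_eq_zeroE)
        have "c \<noteq> 0" using c q less.prems(1) by auto
        then have "[:1/c:] * d = 1" using c by (simp add: one_pCons)
        then have "1 \<in> T" using T(3)[OF d(1)] by metis
        then show False using P.one_imp_carrier P.I_notcarr by (simp add: T_def phi_one)
      qed
      then have "degree q < degree p" "q \<noteq> 0" using q less.prems(1) by (auto simp: degree_mult_eq)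
      moreover have "h (\<phi> (d ^ Suc k * q)) \<in> ?rad" using less.prems(2) q by (simp add: mult_ac)
      ultimately show ?thesis using less.hyps by blast
    qed
  qed
  from this[OF p1, of 0] have "h (\<phi> d) \<in> ?rad" using r1 by simp
  moreover have "d dvd p2" using d(2) inP by (simp add: T_def)
  then obtain q where "p2 = q * d" by (metis dvdE mult.commute)
  then have "h (\<phi> p2) = h (\<phi> q) \<otimes>\<^bsub>S\<^esub> h (\<phi> d)" by (simp add: phi_mult)
  ultimately have "h (\<phi> p2) \<in> ?rad" using rad.I_l_closed by simp
  then have "b \<otimes>\<^bsub>S\<^esub> h s2 \<in> ?rad" using d2(3) nil_rad[OF d2(1)] by simp
  then show ?thesis using rad.unit_mult_mem_iff(2)[OF hom_unit[OF d2(2)] ac(2)] by simp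
qed

lemma regular_sequence_first:
  assumes "regular_sequence S xs" "xs \<noteq> []" "y \<in> carrier S" "xs ! 0 \<otimes>\<^bsub>S\<^esub> y = \<zero>\<^bsub>S\<^esub>"
  shows "y = \<zero>\<^bsub>S\<^esub>"
proof -
  show ?thesis using assms S.genideal_empty unfolding regular_sequence_def
    by (auto dest!: spec[of _ 0])
qed

text \<open>If \<open>a, b\<close> were the beginning of a regular sequence, then some power of \<open>b\<close> would lie in
  \<open>(a)\<close>, and cancelling \<open>b\<close> modulo \<open>a\<close> would give \<open>1 \<in> (a)\<close>.\<close>

lemma depth_le_one: "depth_in MS S \<le> 1"
  unfolding depth_in_def
proof (rule Sup_least, clarify)
  fix xs assume xs: "regular_sequence S xs" "set xs \<subseteq> MS"
  have "\<not> 2 \<le> length xs"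
  proof
    assume len: "2 \<le> length xs"
    let ?J = "Idl\<^bsub>S\<^esub> {xs ! 0}"
    have c: "xs ! 0 \<in> MS" "xs ! 1 \<in> MS"
      using subsetD[OF xs(2) nth_mem[of 0 xs]] subsetD[OF xs(2) nth_mem[of 1 xs]] len by linarith+
    have J: "ideal ?J S" "xs ! 0 \<in> ?J"
      using c(1) by (intro S.genideal_ideal S.genideal_self'; blast)+
    have nz: "xs \<noteq> []" using len by auto
    have "xs ! 1 \<in> ideal_radical S ?J"
      by (rule nonunit_in_radical[OF c(1) regular_sequence_first[OF xs(1) nz] J c(2)])
    then obtain k :: nat where k: "xs ! 1 [^]\<^bsub>S\<^esub> k \<in> ?J" unfolding ideal_radical_def by blast
    have t: "set (take 1 xs) = {xs ! 0}" using len by (cases xs) auto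
    have reg: "y \<in> ?J" if "y \<in> carrier S" "xs ! 1 \<otimes>\<^bsub>S\<^esub> y \<in> ?J" for y
      using xs(1) len that t unfolding regular_sequence_def by (auto dest!: spec[of _ 1])
    have "xs ! 1 [^]\<^bsub>S\<^esub> n \<in> ?J \<Longrightarrow> \<one>\<^bsub>S\<^esub> \<in> ?J" for n :: nat
    proof (induction n)
      case (Suc n)
      then show ?case using reg[of "xs ! 1 [^]\<^bsub>S\<^esub> n"] c by (simp add: S.m_comm)
    qed simp
    then have "\<one>\<^bsub>S\<^esub> \<in> ?J" using k by blast
    moreover have "?J \<subseteq> Idl\<^bsub>S\<^esub> (set xs)"
      using nz xs(2) by (intro S.subset_Idl_subset) auto
    moreover have "ideal (Idl\<^bsub>S\<^esub> (set xs)) S" using xs(2) by (intro S.genideal_ideal) auto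
    ultimately have "Idl\<^bsub>S\<^esub> (set xs) = carrier S" using ideal.one_imp_carrier by blast
    then show False using xs(1) by (simp add: regular_sequence_def)
  qed
  then show "enat (length xs) \<le> 1" by (simp add: one_enat_def)
qed

text \<open>Each maximal ideal contains a nonzero polynomial, which is then a regular sequence of
  length one in the localization.\<close>

lemma depth_ge_oneI:
  assumes "\<And>p y. p \<noteq> 0 \<Longrightarrow> y \<in> carrier R \<Longrightarrow> \<phi> p \<otimes> y = \<zero> \<Longrightarrow> y = \<zero>"
  shows "1 \<le> depth_in MS S"
proof -
  obtain p where p: "p \<noteq> 0" "\<phi> p \<in> P" using exists_poly_in_P by blast
  let ?x = "h (\<phi> p)"
  have x: "?x \<in> MS" using hom_unit_iff[of "\<phi> p"] p by simp
  have "y = \<zero>\<^bsub>S\<^esub>" if y: "y \<in> carrier S" "?x \<otimes>\<^bsub>S\<^esub> y = \<zero>\<^bsub>S\<^esub>" for y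
  proof -
    obtain a s where as: "a \<in> carrier R" "s \<in> carrier R - P" "y \<otimes>\<^bsub>S\<^esub> h s = h a"
      using fraction[OF y(1)] by blast
    have hs: "h s \<in> carrier S" using as by auto
    have "h (\<phi> p \<otimes> a) = (?x \<otimes>\<^bsub>S\<^esub> y) \<otimes>\<^bsub>S\<^esub> h s"
      using as(1) hs y(1) by (simp add: as(3)[symmetric] S.m_assoc)
    then have "h (\<phi> p \<otimes> a) = \<zero>\<^bsub>S\<^esub>" using y hs by simp
    then obtain u where u: "u \<in> carrier R - P" "u \<otimes> (\<phi> p \<otimes> a) = \<zero>"
      using hom_eq_zeroD[of "\<phi> p \<otimes> a"] as by auto
    then have "\<phi> p \<otimes> (u \<otimes> a) = \<zero>" using as(1) by (simp add: R.m_lcomm)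
    then have "u \<otimes> a = \<zero>" using assms[OF p(1), of "u \<otimes> a"] u as(1) by simp
    then have "h u \<otimes>\<^bsub>S\<^esub> h a = \<zero>\<^bsub>S\<^esub>" using u as(1) by (metis DiffD1 hom_mult hom_zero)
    then have "h a = \<zero>\<^bsub>S\<^esub>"
      using ideal.unit_mult_mem_iff(1)[OF S.zeroideal hom_unit[OF u(1)], of "h a"] as(1) by simp
    then show ?thesis
      using hom_mem_iff[OF S.zeroideal y(1) as] by simp
  qed
  moreover have "Idl\<^bsub>S\<^esub> {?x} \<noteq> carrier S"
  proof
    assume e: "Idl\<^bsub>S\<^esub> {?x} = carrier S"
    have "Idl\<^bsub>S\<^esub> {?x} \<subseteq> MS" using x by (intro S.genideal_minimal[OF nonunits_ideal]) simp
    then show False using e S.Units_one_closed by blast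
  qed
  ultimately have "regular_sequence S [?x]" unfolding regular_sequence_def by (simp add: S.genideal_empty)
  then have "enat (length [?x]) \<in> {enat (length xs) | xs. regular_sequence S xs \<and> set xs \<subseteq> MS}"
    using x by (intro CollectI exI[of _ "[?x]"]) simp
  then have "enat (length [?x]) \<le> depth_in MS S" unfolding depth_in_def by (rule Sup_upper)
  then show ?thesis by (simp add: one_enat_def)
qed

lemma exists_nonzerodivisor:
  assumes "cohen_macaulay_local S"
  obtains a where "a \<in> MS" "\<And>y. y \<in> carrier S \<Longrightarrow> a \<otimes>\<^bsub>S\<^esub> y = \<zero>\<^bsub>S\<^esub> \<Longrightarrow> y = \<zero>\<^bsub>S\<^esub>"
proof -
  obtain M where "maximalideal M S" "depth_in M S = krull_dim S"
    using assms by (auto simp: cohen_macaulay_local_def)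
  then have d: "depth_in MS S = 1" using MS_maximal(2) krull_dim_eq_one by metis
  have "\<exists>xs. regular_sequence S xs \<and> set xs \<subseteq> MS \<and> xs \<noteq> []"
  proof (rule ccontr)
    assume *: "\<not> ?thesis"
    have "depth_in MS S \<le> 0" unfolding depth_in_def
      using * by (intro Sup_least) (auto simp: zero_enat_def)
    then show False using d by simp
  qed
  then obtain xs where xs: "regular_sequence S xs" "set xs \<subseteq> MS" "xs \<noteq> []" by blast
  show ?thesis
  proof (rule that)
    show "xs ! 0 \<in> MS" using xs(3) subsetD[OF xs(2) nth_mem[of 0 xs]] by blast
  qed (rule regular_sequence_first[OF xs(1,3)])
qed

end

context line_thickening
begin

lemma localized_thickening:
  assumes "maximalideal P R"
  shows "localized_thickening R \<phi> (localization R P) (\<lambda>a. loc_frac R P a \<one>) P"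
  using assms primeideal.localization_map[OF maximalideal_prime[OF assms]] line_thickening_axioms
  by (simp add: localized_thickening_def localized_thickening_axioms_def)

theorem cohen_macaulayI:
  assumes noeth: "noetherian_ring R"
    and nzd: "\<And>p y. p \<noteq> 0 \<Longrightarrow> y \<in> carrier R \<Longrightarrow> \<phi> p \<otimes> y = \<zero> \<Longrightarrow> y = \<zero>"
  shows "cohen_macaulay R"
  unfolding cohen_macaulay_def
proof (intro conjI allI impI)
  fix P assume P: "maximalideal P R"
  let ?S = "localization R P"
  interpret L: localized_thickening R \<phi> ?S "\<lambda>a. loc_frac R P a \<one>" P
    by (rule localized_thickening[OF P])
  have "depth_in L.MS ?S = krull_dim ?S"
    unfolding L.krull_dim_eq_one using L.depth_le_one L.depth_ge_oneI[OF nzd] by (rule antisym)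
  then show "cohen_macaulay_local ?S"
    unfolding cohen_macaulay_local_def
    using L.S.is_cring L.noetherian_localization[OF noeth] L.MS_maximal by blast
qed (rule is_cring, rule noeth)

text \<open>Localize at the origin.  An element \<open>b\<close> of the maximal ideal is \<open>\<phi> p + v\<close> with \<open>p(0) = 0\<close> and
  \<open>v\<close> nilpotent, so it acts on \<open>y\<close> like \<open>v\<close>.  If \<open>b\<close> becomes a nonzerodivisor, then \<open>y\<close> vanishes in the
  localization, that is, \<open>u y = 0\<close> for some \<open>u\<close> outside the maximal ideal.  This \<open>u\<close> acts on \<open>y\<close> like a
  nonzero constant plus a nilpotent, which is a unit.\<close>

theorem cohen_macaulayD:
  assumes CM: "cohen_macaulay R"
    and y: "y \<in> carrier R" "\<phi> [:0, 1:] \<otimes> y = \<zero>"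
  shows "y = \<zero>"
proof -
  let ?S = "localization R origin" and ?h = "\<lambda>a. loc_frac R origin a \<one>" and ?X = "\<phi> [:0, 1:]"
  interpret L: localized_thickening R \<phi> ?S ?h origin
    by (rule localized_thickening[OF origin_maximal])
  have kill: "\<phi> p \<otimes> y = \<phi> [:poly p 0:] \<otimes> y" for p
  proof -
    obtain q where "p - [:poly p 0:] = [:0, 1:] * q"
      using poly_eq_0_iff_dvd[of "p - [:poly p 0:]" 0] by auto
    then have "p = [:poly p 0:] + q * [:0, 1:]" by (simp add: algebra_simps)
    then have "\<phi> p = \<phi> [:poly p 0:] \<oplus> \<phi> q \<otimes> ?X" by (metis phi_add phi_mult)
    then have "\<phi> p \<otimes> y = \<phi> [:poly p 0:] \<otimes> y \<oplus> \<phi> q \<otimes> (?X \<otimes> y)"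
      using y(1) by (simp add: l_distr m_assoc)
    then show ?thesis using y by simp
  qed
  have kill0: "\<phi> p \<otimes> y = \<zero>" if "poly p 0 = 0" for p
    using kill[of p] that y(1) by (simp add: phi_zero)
  obtain a where a: "a \<in> L.MS"
    and nzd: "\<And>z. z \<in> carrier ?S \<Longrightarrow> a \<otimes>\<^bsub>?S\<^esub> z = \<zero>\<^bsub>?S\<^esub> \<Longrightarrow> z = \<zero>\<^bsub>?S\<^esub>"
    using L.exists_nonzerodivisor CM origin_maximal unfolding cohen_macaulay_def by blast
  have ac: "a \<in> carrier ?S" using a by simp
  obtain b s where b: "b \<in> carrier R" "s \<in> carrier R - origin" "a \<otimes>\<^bsub>?S\<^esub> ?h s = ?h b"
    using L.fraction[OF ac] by blast
  have "b \<in> origin" using L.unit_iff[OF ac b] a by blast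
  then obtain p v where p: "v \<in> nil" "b = \<phi> p \<oplus> v" "poly p 0 = 0" by (rule originE)
  have v: "v \<in> carrier R" using p nil_closed by simp
  have "b \<otimes> y = v \<otimes> y" using p(2) kill0[OF p(3)] v y(1) by (simp add: l_distr)
  then have pow: "b [^] m \<otimes> y = v [^] m \<otimes> y" for m :: nat
    using pow_mult_eq_of_mult_eq b(1) v y(1) by blast
  obtain m :: nat where "v [^] m = \<zero>" using p by (auto simp: ideal_radical_def)
  then have "b [^] m \<otimes> y = \<zero>" using pow y(1) by simp
  then have "?h (b [^] m \<otimes> y) = \<zero>\<^bsub>?S\<^esub>" by simp
  then have z: "?h b [^]\<^bsub>?S\<^esub> m \<otimes>\<^bsub>?S\<^esub> ?h y = \<zero>\<^bsub>?S\<^esub>"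
    using b(1) y(1) L.ring.hom_nat_pow[OF b(1)] by simp
  have hb: "z = \<zero>\<^bsub>?S\<^esub>" if "z \<in> carrier ?S" "?h b \<otimes>\<^bsub>?S\<^esub> z = \<zero>\<^bsub>?S\<^esub>" for z
  proof -
    have hs: "?h s \<in> carrier ?S" using b by auto
    have "a \<otimes>\<^bsub>?S\<^esub> (?h s \<otimes>\<^bsub>?S\<^esub> z) = \<zero>\<^bsub>?S\<^esub>"
      using that hs ac by (simp add: L.S.m_assoc[symmetric] b(3))
    then have "?h s \<otimes>\<^bsub>?S\<^esub> z = \<zero>\<^bsub>?S\<^esub>" using nzd hs that by simp
    then show ?thesis
      using ideal.unit_mult_mem_iff(1)[OF L.S.zeroideal L.hom_unit[OF b(2)] that(1)] by simp
  qed
  have "?h b [^]\<^bsub>?S\<^esub> k \<otimes>\<^bsub>?S\<^esub> ?h y = \<zero>\<^bsub>?S\<^esub> \<Longrightarrow> ?h y = \<zero>\<^bsub>?S\<^esub>" for k :: nat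
  proof (induction k)
    case 0 then show ?case using y(1) by simp
  next
    case (Suc k)
    have "?h b \<otimes>\<^bsub>?S\<^esub> (?h b [^]\<^bsub>?S\<^esub> k \<otimes>\<^bsub>?S\<^esub> ?h y) = ?h b [^]\<^bsub>?S\<^esub> Suc k \<otimes>\<^bsub>?S\<^esub> ?h y"
      using b(1) y(1) by (simp add: L.S.m_ac)
    then show ?case using hb[of "?h b [^]\<^bsub>?S\<^esub> k \<otimes>\<^bsub>?S\<^esub> ?h y"] Suc b(1) y(1) by simp
  qed
  then have "?h y = \<zero>\<^bsub>?S\<^esub>" using z by blast
  then obtain u where u: "u \<in> carrier R - origin" "u \<otimes> y = \<zero>" using L.hom_eq_zeroD y(1) by blast
  obtain q w where q: "w \<in> nil" "u = \<phi> q \<oplus> w" using decompose u(1) by blast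
  have w: "w \<in> carrier R" using q nil_closed by simp
  define c where "c = poly q 0"
  have c: "c \<noteq> 0" using origin_iff[OF q(1), of q] u q(2) c_def by auto
  define w' where "w' = \<phi> [:1/c:] \<otimes> (\<ominus> w)"
  have w': "w' \<in> nil"
    unfolding w'_def using ideal.I_l_closed[OF nil_ideal] q(1)
      additive_subgroup.a_inv_closed[OF ideal.axioms(1)[OF nil_ideal]] by simp
  have w'c: "w' \<in> carrier R" using w' nil_closed by simp
  have "\<phi> [:c:] \<otimes> y \<oplus> w \<otimes> y = \<zero>" using u(2) q(2) kill[of q] w y(1) c_def by (simp add: l_distr)
  then have cw: "\<phi> [:c:] \<otimes> y = (\<ominus> w) \<otimes> y" using w y(1) by (simp add: l_minus sum_zero_eq_neg)
  have "\<one> = \<phi> [:1/c:] \<otimes> \<phi> [:c:]"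
    using c by (simp add: phi_mult[symmetric] phi_one[symmetric] one_pCons)
  then have "\<one> \<otimes> y = \<phi> [:1/c:] \<otimes> (\<phi> [:c:] \<otimes> y)" using y(1) by (simp add: m_assoc)
  also have "\<dots> = w' \<otimes> y" unfolding cw w'_def using w y(1) by (simp add: m_assoc)
  finally have e: "\<one> [^] k \<otimes> y = w' [^] k \<otimes> y" for k :: nat
    using pow_mult_eq_of_mult_eq[OF one_closed w'c y(1)] by blast
  obtain k :: nat where "w' [^] k = \<zero>" using w' by (auto simp: ideal_radical_def)
  then show ?thesis using e[of k] y(1) by simp
qed

end

section \<open>Finite modules over the line\<close>

context line_thickening
begin

primrec phi_span :: "'a list \<Rightarrow> 'a set" where
  "phi_span [] = {\<zero>}"
| "phi_span (e # es) = {\<phi> p \<otimes> e \<oplus> y | p y. y \<in> phi_span es}"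

lemma phi_span_ConsI: "x = \<phi> p \<otimes> e \<oplus> y \<Longrightarrow> y \<in> phi_span es \<Longrightarrow> x \<in> phi_span (e # es)"
  unfolding phi_span.simps by blast

lemma phi_span_closed:
  "set es \<subseteq> carrier R \<Longrightarrow> phi_span es \<subseteq> carrier R"
  by (induction es) auto

lemma zero_in_phi_span: "set es \<subseteq> carrier R \<Longrightarrow> \<zero> \<in> phi_span es"
proof (induction es)
  case (Cons e es)
  then have "\<zero> = \<phi> 0 \<otimes> e \<oplus> \<zero>" by (simp add: phi_zero)
  then show ?case using Cons by (auto intro!: phi_span_ConsI simp del: phi_span.simps)
qed simp

lemma phi_span_add:
  "set es \<subseteq> carrier R \<Longrightarrow> x \<in> phi_span es \<Longrightarrow> y \<in> phi_span es \<Longrightarrow> x \<oplus> y \<in> phi_span es"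
proof (induction es arbitrary: x y)
  case (Cons e es)
  obtain p x' where x: "x = \<phi> p \<otimes> e \<oplus> x'" "x' \<in> phi_span es" using Cons.prems by auto
  obtain q y' where y: "y = \<phi> q \<otimes> e \<oplus> y'" "y' \<in> phi_span es" using Cons.prems by auto
  have c: "e \<in> carrier R" "x' \<in> carrier R" "y' \<in> carrier R"
    using Cons.prems x y phi_span_closed[of es] by auto
  have "x \<oplus> y = (\<phi> p \<oplus> \<phi> q) \<otimes> e \<oplus> (x' \<oplus> y')"
    unfolding x y using c phi_closed[of p] phi_closed[of q] by algebra
  then have "x \<oplus> y = \<phi> (p + q) \<otimes> e \<oplus> (x' \<oplus> y')" by (simp add: phi_add)
  moreover have "x' \<oplus> y' \<in> phi_span es" using Cons x y by simp
  ultimately show ?case by auto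
qed simp

lemma phi_span_mult:
  "set es \<subseteq> carrier R \<Longrightarrow> x \<in> phi_span es \<Longrightarrow> \<phi> q \<otimes> x \<in> phi_span es"
proof (induction es arbitrary: x)
  case (Cons e es)
  obtain p x' where x: "x = \<phi> p \<otimes> e \<oplus> x'" "x' \<in> phi_span es" using Cons.prems by auto
  have c: "e \<in> carrier R" "x' \<in> carrier R"
    using Cons.prems x phi_span_closed[of es] by auto
  have "\<phi> q \<otimes> x = (\<phi> q \<otimes> \<phi> p) \<otimes> e \<oplus> \<phi> q \<otimes> x'"
    unfolding x using c phi_closed[of p] phi_closed[of q] by algebra
  then have "\<phi> q \<otimes> x = \<phi> (q * p) \<otimes> e \<oplus> \<phi> q \<otimes> x'" by (simp add: phi_mult)
  moreover have "\<phi> q \<otimes> x' \<in> phi_span es" using Cons x by simp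
  ultimately show ?case by auto
qed simp

lemma in_phi_span: "set es \<subseteq> carrier R \<Longrightarrow> e \<in> set es \<Longrightarrow> \<phi> p \<otimes> e \<in> phi_span es"
proof (induction es)
  case (Cons a es)
  show ?case
  proof (cases "e = a")
    case True
    have "\<phi> p \<otimes> e = \<phi> p \<otimes> a \<oplus> \<zero>" using True Cons.prems by simp
    then show ?thesis using zero_in_phi_span[of es] Cons.prems by (auto intro!: phi_span_ConsI simp del: phi_span.simps)
  next
    case False
    then have m: "\<phi> p \<otimes> e \<in> phi_span es" using Cons by simp
    have "\<phi> p \<otimes> e = \<phi> 0 \<otimes> a \<oplus> \<phi> p \<otimes> e" using Cons.prems by (auto simp: phi_zero)
    then show ?thesis using m by (rule phi_span_ConsI)
  qed
qed simp

text \<open>The finiteness is proved by splitting off one generator of the module at a time: the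
  coefficients of this generator in elements of \<open>Q\<close> form an ideal of \<open>K[X]\<close>, which is principal.
  The conclusion is phrased through ideals containing \<open>G\<close>, so that for an ideal \<open>Q\<close> it says directly
  that \<open>G\<close> generates \<open>Q\<close>.\<close>

lemma submodule_finitely_generated:
  assumes "set es \<subseteq> carrier R" "Q \<subseteq> phi_span es" "\<zero> \<in> Q"
    and "\<And>x y. x \<in> Q \<Longrightarrow> y \<in> Q \<Longrightarrow> x \<oplus> y \<in> Q" "\<And>p x. x \<in> Q \<Longrightarrow> \<phi> p \<otimes> x \<in> Q"
  shows "\<exists>G\<subseteq>Q. finite G \<and> (\<forall>J. ideal J R \<longrightarrow> G \<subseteq> J \<longrightarrow> Q \<subseteq> J)"
  using assms
proof (induction es arbitrary: Q)
  case Nil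
  then show ?case
    by (intro exI[of _ "{}"]) (auto simp: additive_subgroup.zero_closed ideal.axioms(1))
next
  case (Cons e es)
  have es: "set es \<subseteq> carrier R" "e \<in> carrier R" using Cons.prems by auto
  have spc: "y \<in> carrier R" if "y \<in> phi_span es" for y using phi_span_closed[OF es(1)] that by blast
  define L where "L = {p. \<exists>y\<in>phi_span es. \<phi> p \<otimes> e \<oplus> y \<in> Q}"
  have L0: "0 \<in> L"
  proof -
    have "\<phi> 0 \<otimes> e \<oplus> \<zero> \<in> Q" using Cons.prems(3) es by (simp add: phi_zero)
    then show ?thesis unfolding L_def using zero_in_phi_span[OF es(1)] by blast
  qed
  have Ladd: "p + q \<in> L" if pq: "p \<in> L" "q \<in> L" for p q
  proof -
    obtain y z where y: "y \<in> phi_span es" "\<phi> p \<otimes> e \<oplus> y \<in> Q" and z: "z \<in> phi_span es" "\<phi> q \<otimes> e \<oplus> z \<in> Q"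
      using pq by (auto simp: L_def)
    have "(\<phi> p \<otimes> e \<oplus> y) \<oplus> (\<phi> q \<otimes> e \<oplus> z) = (\<phi> p \<oplus> \<phi> q) \<otimes> e \<oplus> (y \<oplus> z)"
      using spc[OF y(1)] spc[OF z(1)] es(2) phi_closed[of p] phi_closed[of q] by algebra
    then have "\<phi> (p + q) \<otimes> e \<oplus> (y \<oplus> z) \<in> Q" using Cons.prems(4)[OF y(2) z(2)] by (simp add: phi_add)
    then show ?thesis unfolding L_def using phi_span_add[OF es(1) y(1) z(1)] by blast
  qed
  have Lmult: "q * p \<in> L" if p: "p \<in> L" for p q
  proof -
    obtain y where y: "y \<in> phi_span es" "\<phi> p \<otimes> e \<oplus> y \<in> Q" using p by (auto simp: L_def)
    have "\<phi> q \<otimes> (\<phi> p \<otimes> e \<oplus> y) = (\<phi> q \<otimes> \<phi> p) \<otimes> e \<oplus> \<phi> q \<otimes> y"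
      using spc[OF y(1)] es(2) phi_closed[of p] phi_closed[of q] by algebra
    then have "\<phi> (q * p) \<otimes> e \<oplus> \<phi> q \<otimes> y \<in> Q" using Cons.prems(5)[OF y(2), of q] by (simp add: phi_mult)
    then show ?thesis unfolding L_def using phi_span_mult[OF es(1) y(1)] by blast
  qed
  obtain d where d: "d \<in> L" "\<And>p. p \<in> L \<Longrightarrow> d dvd p"
    using poly_ideal_principal[OF L0 Ladd Lmult] by blast
  obtain w where w: "w \<in> phi_span es" "\<phi> d \<otimes> e \<oplus> w \<in> Q" using d(1) by (auto simp: L_def)
  let ?g = "\<phi> d \<otimes> e \<oplus> w"
  have "\<exists>G\<subseteq>Q \<inter> phi_span es. finite G \<and> (\<forall>J. ideal J R \<longrightarrow> G \<subseteq> J \<longrightarrow> Q \<inter> phi_span es \<subseteq> J)"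
  proof (rule Cons.IH[OF es(1)])
    show "x \<oplus> y \<in> Q \<inter> phi_span es" if "x \<in> Q \<inter> phi_span es" "y \<in> Q \<inter> phi_span es" for x y
      using that Cons.prems(4) phi_span_add[OF es(1)] by blast
    show "\<phi> p \<otimes> x \<in> Q \<inter> phi_span es" if "x \<in> Q \<inter> phi_span es" for p x
      using that Cons.prems(5) phi_span_mult[OF es(1)] by blast
  qed (use Cons.prems(3) zero_in_phi_span[OF es(1)] in auto)
  then obtain G where G: "G \<subseteq> Q \<inter> phi_span es" "finite G"
    "\<And>J. ideal J R \<Longrightarrow> G \<subseteq> J \<Longrightarrow> Q \<inter> phi_span es \<subseteq> J" by blast
  have "Q \<subseteq> J" if J: "ideal J R" "insert ?g G \<subseteq> J" for J
  proof
    interpret J: ideal J R by (rule J(1))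
    fix q assume q: "q \<in> Q"
    then obtain p y where y: "q = \<phi> p \<otimes> e \<oplus> y" "y \<in> phi_span es" using Cons.prems(2) by auto
    then have "p \<in> L" using q by (auto simp: L_def)
    then obtain k where k: "p = d * k" using d(2) by blast
    define r where "r = y \<oplus> \<phi> (- k) \<otimes> w"
    have c: "y \<in> carrier R" "w \<in> carrier R" using y w spc by auto
    have r1: "r \<in> phi_span es"
      unfolding r_def by (intro phi_span_add[OF es(1)] phi_span_mult[OF es(1)] y w)
    have "r = q \<oplus> \<phi> (- k) \<otimes> ?g"
      unfolding r_def y k phi_mult phi_uminus
      using c es(2) phi_closed[of k] phi_closed[of d] by algebra
    then have "r \<in> Q" using Cons.prems(4,5) q w(2) by simp
    then have "r \<in> J" using r1 G(3)[OF J(1)] J(2) by blast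
    moreover have "\<phi> k \<otimes> ?g \<in> J" using J(2) by (intro J.I_l_closed) auto
    moreover have "q = r \<oplus> \<phi> k \<otimes> ?g"
      unfolding r_def y k phi_mult phi_uminus
      using c es(2) phi_closed[of k] phi_closed[of d] by algebra
    ultimately show "q \<in> J" by simp
  qed
  then show ?case using G(1,2) w(2) by (intro exI[of _ "insert ?g G"]) auto
qed

theorem noetherian_of_finite:
  assumes es: "set es \<subseteq> carrier R" and span: "carrier R \<subseteq> phi_span es"
  shows "noetherian_ring R"
proof (rule noetherian_ringI)
  fix I assume "ideal I R"
  then interpret I: ideal I R .
  have "\<exists>G\<subseteq>I. finite G \<and> (\<forall>J. ideal J R \<longrightarrow> G \<subseteq> J \<longrightarrow> I \<subseteq> J)"
  proof (rule submodule_finitely_generated[OF es])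
    show "I \<subseteq> phi_span es" using span I.Icarr by blast
  qed (use I.I_l_closed in auto)
  then obtain G where G: "G \<subseteq> I" "finite G" "\<And>J. ideal J R \<Longrightarrow> G \<subseteq> J \<Longrightarrow> I \<subseteq> J" by blast
  have c: "G \<subseteq> carrier R" using G I.Icarr by blast
  have "I = Idl G"
    using genideal_minimal[OF I.is_ideal G(1)] G(3)[OF genideal_ideal[OF c] genideal_self[OF c]] by blast
  then show "\<exists>A\<subseteq>carrier R. finite A \<and> I = Idl A" using c G(2) by blast
qed

end


section \<open>Coefficient sums of polynomials\<close>

lemma sum_single_keys: "f = (\<Sum>m\<in>Poly_Mapping.keys f. Poly_Mapping.single m (Poly_Mapping.lookup f m))"
proof (rule poly_mapping_eqI)
  fix k
  show "Poly_Mapping.lookup f k = Poly_Mapping.lookup (\<Sum>m\<in>Poly_Mapping.keys f. Poly_Mapping.single m (Poly_Mapping.lookup f m)) k"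
    by (simp add: lookup_sum lookup_single when_def in_keys_iff if_distrib cong: if_cong)
qed

lemma mpoly_induct [case_names single add]:
  fixes f :: "('i, 'k::comm_ring_1) mpoly"
  assumes "\<And>m c. Q (Poly_Mapping.single m c)" "\<And>f g. Q f \<Longrightarrow> Q g \<Longrightarrow> Q (f + g)"
  shows "Q f"
proof -
  have "Q (\<Sum>m\<in>A. Poly_Mapping.single m (Poly_Mapping.lookup f m))" if "finite A" for A
    using that
  proof induction
    case empty
    show ?case using assms(1)[of 0 0] by simp
  qed (simp add: assms)
  then show ?thesis using sum_single_keys[of f] finite_keys by metis
qed

definition coeff_sum :: "('i \<Rightarrow>\<^sub>0 nat) set \<Rightarrow> ('i, 'k::comm_ring_1) mpoly \<Rightarrow> 'k" where
  "coeff_sum C f = (\<Sum>m\<in>Poly_Mapping.keys f \<inter> C. Poly_Mapping.lookup f m)"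

lemma coeff_sum_superset:
  "finite A \<Longrightarrow> Poly_Mapping.keys f \<subseteq> A \<Longrightarrow> coeff_sum C f = (\<Sum>m\<in>A \<inter> C. Poly_Mapping.lookup f m)"
  unfolding coeff_sum_def by (rule sum.mono_neutral_left) (auto simp: in_keys_iff)

lemma coeff_sum_add: "coeff_sum C (f + g) = coeff_sum C f + coeff_sum C g"
proof -
  let ?A = "Poly_Mapping.keys f \<union> Poly_Mapping.keys g"
  have "Poly_Mapping.keys (f + g) \<subseteq> ?A" by (rule Poly_Mapping.keys_add)
  then show ?thesis
    by (simp add: coeff_sum_superset[of ?A] lookup_add sum.distrib)
qed

lemma coeff_sum_zero: "coeff_sum C 0 = 0"
  by (simp add: coeff_sum_def)

lemma coeff_sum_diff: "coeff_sum C (f - g) = coeff_sum C f - coeff_sum C g"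
  using coeff_sum_add[of C "f - g" g] by simp

lemma coeff_sum_single: "coeff_sum C (Poly_Mapping.single m c) = (if m \<in> C then c else 0)"
  by (auto simp: coeff_sum_def)

lemma coeff_sum_empty: "coeff_sum {} f = 0"
  by (simp add: coeff_sum_def)

lemma coeff_sum_single_mult:
  "coeff_sum C (Poly_Mapping.single u c * f) = c * coeff_sum {m. u + m \<in> C} f"
  by (induction f rule: mpoly_induct)
    (simp_all add: mult_single coeff_sum_single coeff_sum_add distrib_left)

text \<open>Multiplication by a monomial with exponents \<open>u\<close> replaces \<open>C\<close> by its shift by \<open>u\<close>.\<close>

lemma coeff_sum_mult_zero:
  assumes "\<And>u. coeff_sum {m. u + m \<in> C} f = 0"
  shows "coeff_sum C (g * f) = 0"
  by (induction g rule: mpoly_induct)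
    (simp_all add: coeff_sum_single_mult assms distrib_right coeff_sum_add)


section \<open>The polynomial ring\<close>

lemma mpoly_ring_simps [simp]:
  "carrier mpoly_ring = UNIV" "a \<otimes>\<^bsub>mpoly_ring\<^esub> b = a * b" "\<one>\<^bsub>mpoly_ring\<^esub> = 1"
  "\<zero>\<^bsub>mpoly_ring\<^esub> = 0" "a \<oplus>\<^bsub>mpoly_ring\<^esub> b = a + b"
  by (simp_all add: mpoly_ring_def)

lemma mpoly_cring: "cring (mpoly_ring :: ('i, 'k::comm_ring_1) mpoly ring)"
proof (rule cringI)
  show "abelian_group (mpoly_ring :: ('i, 'k) mpoly ring)"
  proof (rule abelian_groupI)
    show "\<exists>y\<in>carrier mpoly_ring. y \<oplus>\<^bsub>mpoly_ring\<^esub> x = \<zero>\<^bsub>mpoly_ring\<^esub>" for x :: "('i, 'k) mpoly"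
      by (intro bexI[of _ "- x"]) auto
  qed (auto simp: algebra_simps)
  show "Group.comm_monoid (mpoly_ring :: ('i, 'k) mpoly ring)"
    by (rule comm_monoidI) (auto simp: algebra_simps)
qed (auto simp: algebra_simps)

lemma mpoly_ring_minus: "(a :: ('i, 'k::comm_ring_1) mpoly) \<ominus>\<^bsub>mpoly_ring\<^esub> b = a - b"
proof -
  interpret cring "mpoly_ring :: ('i, 'k) mpoly ring" by (rule mpoly_cring)
  have "\<ominus>\<^bsub>mpoly_ring\<^esub> b = - b" by (rule minus_equality) auto
  then show ?thesis by (simp add: minus_eq)
qed

lemma mpoly_idealI:
  fixes J :: "('i, 'k::comm_ring_1) mpoly set"
  assumes "0 \<in> J" "\<And>f g. f \<in> J \<Longrightarrow> g \<in> J \<Longrightarrow> f + g \<in> J" "\<And>f g. f \<in> J \<Longrightarrow> g * f \<in> J"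
  shows "ideal J mpoly_ring"
proof -
  interpret cring "mpoly_ring :: ('i, 'k) mpoly ring" by (rule mpoly_cring)
  show ?thesis
    by (rule ideal_of_closed) (use assms in \<open>auto simp: mult.commute\<close>)
qed

lemma mpoly_idealD:
  fixes J :: "('i, 'k::comm_ring_1) mpoly set"
  assumes "ideal J mpoly_ring"
  shows "0 \<in> J" "f \<in> J \<Longrightarrow> g \<in> J \<Longrightarrow> f + g \<in> J" "f \<in> J \<Longrightarrow> g * f \<in> J" "f \<in> J \<Longrightarrow> g \<in> J \<Longrightarrow> f - g \<in> J"
proof -
  interpret ideal J mpoly_ring by (rule assms)
  show "0 \<in> J" using additive_subgroup.zero_closed[OF ideal.axioms(1)[OF assms]] by simp
  show add: "f \<in> J \<Longrightarrow> g \<in> J \<Longrightarrow> f + g \<in> J" for f g using additive_subgroup.a_closed[OF ideal.axioms(1)[OF assms], of f g] by simp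
  show mult: "f \<in> J \<Longrightarrow> g * f \<in> J" for f g using I_l_closed[of f g] by simp
  show "f \<in> J \<Longrightarrow> g \<in> J \<Longrightarrow> f - g \<in> J" using add[of f "- 1 * g"] mult[of g "- 1"] by simp
qed

lemma mpoly_ideal_sum:
  assumes "ideal J mpoly_ring" "\<And>x. x \<in> A \<Longrightarrow> F x \<in> J"
  shows "sum F A \<in> J"
  using assms(2) by (induction A rule: infinite_finite_induct) (auto intro: mpoly_idealD[OF assms(1)])


section \<open>Weights\<close>

definition wt :: "('i::finite \<Rightarrow> nat) \<Rightarrow> ('i \<Rightarrow>\<^sub>0 nat) \<Rightarrow> nat" where
  "wt n m = (\<Sum>i\<in>UNIV. Poly_Mapping.lookup m i * n i)"

lemma wt_add: "wt n (a + b) = wt n a + wt n b"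
  by (simp add: wt_def lookup_add algebra_simps sum.distrib)

lemma wt_single [simp]: "wt n (Poly_Mapping.single i k) = k * n i"
  by (simp add: wt_def lookup_single when_def if_distrib[of "\<lambda>x. x * _"] cong: if_cong)

lemma mdeg_add: "mdeg (a + b) = mdeg a + mdeg b"
  by (simp add: mdeg_def lookup_add sum.distrib)

lemma mdeg_single [simp]: "mdeg (Poly_Mapping.single i k) = k"
  by (simp add: mdeg_def lookup_single when_def)

lemma coeff_curve_hom:
  fixes f :: "('i::finite, 'k::field) mpoly"
  shows "Polynomial.coeff (curve_hom n f) s = coeff_sum {m. wt n m = s} f"
proof -
  have p: "(\<Prod>i\<in>A. (Polynomial.monom (1::'k) (n i)) ^ e i) = Polynomial.monom 1 (\<Sum>i\<in>A. e i * n i)"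
    if "finite A" for A and e :: "'i \<Rightarrow> nat"
    using that
    by induction (simp_all add: monom_power mult_monom mult.commute flip: monom_eq_1)
  have "Polynomial.coeff (curve_hom n f) s = (\<Sum>m\<in>Poly_Mapping.keys f. if wt n m = s then Poly_Mapping.lookup f m else 0)"
    unfolding curve_hom_def Polynomial.coeff_sum by (rule sum.cong) (auto simp: p wt_def)
  also have "\<dots> = coeff_sum {m. wt n m = s} f"
    unfolding coeff_sum_def by (subst sum.inter_restrict) auto
  finally show ?thesis .
qed

lemma curve_ideal_iff: "f \<in> curve_ideal n \<longleftrightarrow> (\<forall>s. coeff_sum {m. wt n m = s} f = 0)"
  by (simp add: curve_ideal_def poly_eq_iff coeff_curve_hom)

lemma binomial_in_curve_ideal_iff:
  "Poly_Mapping.single m 1 - Poly_Mapping.single m' 1 \<in> (curve_ideal n :: ('i::finite, 'k::field) mpoly set)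
    \<longleftrightarrow> wt n m = wt n m'"
  by (auto simp: curve_ideal_iff coeff_sum_diff coeff_sum_single)

definition top_monomials :: "('i::finite \<Rightarrow> nat) \<Rightarrow> nat \<Rightarrow> ('i \<Rightarrow>\<^sub>0 nat) set" where
  "top_monomials n s = {m. wt n m = s \<and> (\<forall>m'. wt n m' = s \<longrightarrow> mdeg m' \<le> mdeg m)}"

lemma top_wt: "m \<in> top_monomials n s \<Longrightarrow> wt n m = s"
  by (simp add: top_monomials_def)

text \<open>If \<open>u + m\<close> is top, then so is \<open>m\<close>, and then all top monomials of the weight of \<open>m\<close> become
  top after adding \<open>u\<close>, having the same degree.\<close>

lemma shift_top_monomials:
  "{m. u + m \<in> top_monomials n s} = {} \<or>
    (\<exists>t. t + wt n u = s \<and> {m. u + m \<in> top_monomials n s} = top_monomials n t)"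
proof (cases "{m. u + m \<in> top_monomials n s} = {}")
  case False
  then obtain m where m: "u + m \<in> top_monomials n s" by blast
  define t where "t = wt n m"
  have s: "s = wt n u + t" using m by (simp add: top_monomials_def wt_add t_def)
  have top: "mdeg m' \<le> mdeg m" if "wt n m' = t" for m'
    using m that s unfolding top_monomials_def by (auto simp: wt_add mdeg_add dest!: spec[of _ "u + m'"])
  have "u + m' \<in> top_monomials n s \<longleftrightarrow> m' \<in> top_monomials n t" for m'
  proof
    assume a: "u + m' \<in> top_monomials n s"
    then have "wt n m' = t" using s by (simp add: top_monomials_def wt_add)
    moreover have "mdeg (u + m) \<le> mdeg (u + m')"
      using a m unfolding top_monomials_def by blast
    then have "mdeg m \<le> mdeg m'" by (simp add: mdeg_add)
    ultimately show "m' \<in> top_monomials n t" using top unfolding top_monomials_def by force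
  next
    assume a: "m' \<in> top_monomials n t"
    then have "mdeg m \<le> mdeg m'" "wt n m' = t" by (simp_all add: top_monomials_def t_def)
    then show "u + m' \<in> top_monomials n s"
      using m unfolding top_monomials_def by (fastforce simp: wt_add mdeg_add t_def)
  qed
  then show ?thesis using s by (intro disjI2 exI[of _ t]) auto
qed simp

text \<open>This is the initial ideal of the curve ideal, as shown in \<open>initial_ideal_curve\<close>.\<close>

definition tops_ideal :: "('i::finite \<Rightarrow> nat) \<Rightarrow> ('i, 'k::comm_ring_1) mpoly set" where
  "tops_ideal n = {f. \<forall>s. coeff_sum (top_monomials n s) f = 0}"

text \<open>The bound on \<open>t\<close> is what an argument by lowest weights needs.\<close>

lemma coeff_sum_top_mult:
  assumes "\<And>t. t \<le> s \<Longrightarrow> coeff_sum (top_monomials n t) f = 0"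
  shows "coeff_sum (top_monomials n s) (g * f) = 0"
proof (rule coeff_sum_mult_zero)
  fix u
  show "coeff_sum {m. u + m \<in> top_monomials n s} f = 0"
    using shift_top_monomials[of u n s] assms by (auto simp: coeff_sum_empty)
qed

lemma tops_ideal_ideal: "ideal (tops_ideal n) mpoly_ring"
  by (rule mpoly_idealI)
    (auto simp: tops_ideal_def coeff_sum_zero coeff_sum_add coeff_sum_top_mult)

lemma single_in_tops_ideal_iff:
  "Poly_Mapping.single m (1::'k::field) \<in> tops_ideal n \<longleftrightarrow> m \<notin> top_monomials n (wt n m)"
  by (auto simp: tops_ideal_def coeff_sum_single dest: top_wt)

lemma lookup_initial_form:
  "Poly_Mapping.lookup (initial_form f) k =
    (if k \<in> Poly_Mapping.keys f \<and> mdeg k = Min (mdeg ` Poly_Mapping.keys f) then Poly_Mapping.lookup f k else 0)"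
  by (simp add: initial_form_def lookup_sum lookup_single when_def if_distrib cong: if_cong)

text \<open>If the order \<open>d\<close> of \<open>f\<close> is the largest degree in weight \<open>s\<close>, then all terms of \<open>f\<close> of weight
  \<open>s\<close> have degree \<open>d\<close> and are top, so their coefficients sum to zero because \<open>f\<close> lies in the curve
  ideal.  Otherwise the initial form has no top terms of weight \<open>s\<close>.\<close>

lemma initial_form_in_tops_ideal:
  assumes "f \<in> curve_ideal n"
  shows "initial_form f \<in> tops_ideal n"
  unfolding tops_ideal_def
proof (intro CollectI allI)
  fix s
  let ?d = "Min (mdeg ` Poly_Mapping.keys f)"
  let ?K = "Poly_Mapping.keys f"
  have "Poly_Mapping.keys (initial_form f) \<subseteq> ?K"
    by (auto simp: in_keys_iff lookup_initial_form split: if_splits)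
  then have "coeff_sum (top_monomials n s) (initial_form f) =
    (\<Sum>m\<in>?K \<inter> top_monomials n s. if mdeg m = ?d then Poly_Mapping.lookup f m else 0)"
    by (subst coeff_sum_superset[of ?K]) (auto simp: lookup_initial_form intro!: sum.cong)
  also have "\<dots> = 0"
  proof (cases "\<exists>m\<in>top_monomials n s. mdeg m = ?d")
    case False
    then show ?thesis by (intro sum.neutral) auto
  next
    case True
    then obtain m0 where m0: "m0 \<in> top_monomials n s" "mdeg m0 = ?d" by blast
    have *: "m \<in> top_monomials n s \<and> mdeg m = ?d" if m: "m \<in> ?K" "wt n m = s" for m
    proof -
      have "?d \<le> mdeg m" using m by simp
      moreover have "mdeg m \<le> mdeg m0" using m0 m by (simp add: top_monomials_def)
      ultimately have "mdeg m = ?d" using m0 by simp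
      moreover have "\<forall>m'. wt n m' = s \<longrightarrow> mdeg m' \<le> ?d" using m0 by (simp add: top_monomials_def)
      ultimately show ?thesis using m by (simp add: top_monomials_def)
    qed
    have "(\<Sum>m\<in>?K \<inter> top_monomials n s. if mdeg m = ?d then Poly_Mapping.lookup f m else 0)
      = (\<Sum>m\<in>?K \<inter> {m. wt n m = s}. Poly_Mapping.lookup f m)"
      by (rule sum.cong) (use * in \<open>auto dest: top_wt\<close>)
    also have "\<dots> = 0" using assms by (simp add: curve_ideal_iff coeff_sum_def)
    finally show ?thesis .
  qed
  finally show "coeff_sum (top_monomials n s) (initial_form f) = 0" .
qed

lemma single_sum: "Poly_Mapping.single k (\<Sum>x\<in>A. F x) = (\<Sum>x\<in>A. Poly_Mapping.single k (F x))"
  by (induction A rule: infinite_finite_induct) (simp_all add: single_add)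

locale positive_weights =
  fixes n :: "'i::finite \<Rightarrow> nat"
  assumes pos: "\<And>i. 0 < n i"
begin

lemma mdeg_le_wt: "mdeg m \<le> wt n m"
proof -
  have "Poly_Mapping.lookup m i * 1 \<le> Poly_Mapping.lookup m i * n i" for i
    using pos[of i] by (intro mult_left_mono) auto
  then show ?thesis unfolding mdeg_def wt_def by (intro sum_mono) simp
qed

lemma top_monomial_exists:
  obtains m' where "m' \<in> top_monomials n (wt n m)"
proof -
  have "\<exists>m'. wt n m' = wt n m \<and> (\<forall>y. wt n y = wt n m \<longrightarrow> mdeg y \<le> mdeg m')"
    by (rule ex_has_greatest_nat[of _ m _ "Suc (wt n m)"]) (auto simp: less_Suc_eq_le intro: order_trans[OF mdeg_le_wt])
  then show ?thesis using that by (auto simp: top_monomials_def)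
qed

text \<open>Modulo the initial ideal, non-top monomials vanish and top monomials of equal weight agree,
  as both kinds of relations are initial forms of binomials.  Choosing a top monomial \<open>\<mu> s\<close> in each
  weight, \<open>f\<close> is congruent to \<open>\<Sum>\<^sub>s c\<^sub>s \<mu> s\<close>, where \<open>c\<^sub>s\<close> is the coefficient sum of \<open>f\<close> over the top monomials
  of weight \<open>s\<close>.\<close>

lemma tops_ideal_subset:
  fixes K :: "('i, 'k::field) mpoly set"
  assumes K: "ideal K mpoly_ring" and sub: "initial_form ` curve_ideal n \<subseteq> K"
  shows "tops_ideal n \<subseteq> K"
proof
  fix f :: "('i, 'k) mpoly" assume f: "f \<in> tops_ideal n"
  note K' = mpoly_idealD[OF K]
  let ?x = "\<lambda>m. Poly_Mapping.single m (1::'k)"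
  have keys: "Poly_Mapping.keys (?x m - ?x m') = {m, m'}" if "m \<noteq> m'" for m m' :: "'i \<Rightarrow>\<^sub>0 nat"
    using that by (auto simp: in_keys_iff lookup_minus lookup_single when_def split: if_splits)
  have non_top: "?x m \<in> K" if m: "m \<notin> top_monomials n (wt n m)" for m
  proof -
    obtain m' where m': "wt n m' = wt n m" "mdeg m < mdeg m'"
      using m by (auto simp: top_monomials_def not_le)
    then have ne: "m \<noteq> m'" by auto
    have "Min (mdeg ` Poly_Mapping.keys (?x m - ?x m')) = mdeg m"
      using m' by (simp add: keys[OF ne])
    then have "initial_form (?x m - ?x m') = ?x m"
      using m' ne by (intro poly_mapping_eqI)
        (auto simp: lookup_initial_form keys lookup_minus lookup_single when_def)
    moreover have "?x m - ?x m' \<in> curve_ideal n" using m' by (simp add: binomial_in_curve_ideal_iff)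
    ultimately show ?thesis using sub by (metis imageI subsetD)
  qed
  have top: "?x m - ?x m' \<in> K" if m: "m \<in> top_monomials n s" "m' \<in> top_monomials n s" for m m' s
  proof (cases "m = m'")
    case True then show ?thesis using K' by simp
  next
    case False
    have d: "mdeg m = mdeg m'" "wt n m = wt n m'"
      using m by (auto simp: top_monomials_def intro: antisym)
    have "Min (mdeg ` Poly_Mapping.keys (?x m - ?x m')) = mdeg m"
      using d by (simp add: keys[OF False])
    then have "initial_form (?x m - ?x m') = ?x m - ?x m'"
      using d False by (intro poly_mapping_eqI)
        (auto simp: lookup_initial_form keys lookup_minus lookup_single when_def)
    moreover have "?x m - ?x m' \<in> curve_ideal n" using d by (simp add: binomial_in_curve_ideal_iff)
    ultimately show ?thesis using sub by (metis imageI subsetD)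
  qed
  obtain \<mu> where \<mu>: "\<And>m. \<mu> (wt n m) \<in> top_monomials n (wt n m)"
  proof -
    have "\<exists>m'. m' \<in> top_monomials n (wt n m)" for m using top_monomial_exists by metis
    then have "(SOME m'. m' \<in> top_monomials n (wt n m)) \<in> top_monomials n (wt n m)" for m
      by (rule someI_ex)
    then show ?thesis using that[of "\<lambda>s. SOME m'. m' \<in> top_monomials n s"] by blast
  qed
  let ?F = "Poly_Mapping.keys f" and ?l = "Poly_Mapping.lookup f"
  define r where "r m = (if m \<in> top_monomials n (wt n m) then Poly_Mapping.single (\<mu> (wt n m)) (?l m) else 0)" for m
  have "(\<Sum>m\<in>?F. r m) = (\<Sum>s\<in>wt n ` ?F. \<Sum>m\<in>{m \<in> ?F. wt n m = s}. r m)"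
    by (rule sum.group[symmetric]) auto
  also have "\<dots> = 0"
  proof (rule sum.neutral, rule ballI)
    fix s assume "s \<in> wt n ` ?F"
    have "(\<Sum>m\<in>{m \<in> ?F. wt n m = s}. r m)
      = (\<Sum>m\<in>?F \<inter> top_monomials n s. Poly_Mapping.single (\<mu> s) (?l m))"
      by (rule sum.mono_neutral_cong_right) (auto simp: r_def dest: top_wt)
    also have "\<dots> = Poly_Mapping.single (\<mu> s) (coeff_sum (top_monomials n s) f)"
      by (simp add: coeff_sum_def single_sum)
    finally show "(\<Sum>m\<in>{m \<in> ?F. wt n m = s}. r m) = 0" using f by (simp add: tops_ideal_def)
  qed
  finally have r0: "(\<Sum>m\<in>?F. r m) = 0" .
  have "Poly_Mapping.single m (?l m) - r m \<in> K" for m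
  proof (cases "m \<in> top_monomials n (wt n m)")
    case True
    have "Poly_Mapping.single 0 (?l m) * (?x m - ?x (\<mu> (wt n m))) \<in> K"
      by (rule K'(3)[OF top[OF True \<mu>]])
    then show ?thesis using True by (simp add: r_def right_diff_distrib mult_single)
  next
    case False
    have "Poly_Mapping.single 0 (?l m) * ?x m \<in> K" by (rule K'(3)[OF non_top[OF False]])
    then show ?thesis using False by (simp add: r_def mult_single)
  qed
  then have "(\<Sum>m\<in>?F. Poly_Mapping.single m (?l m) - r m) \<in> K" by (rule mpoly_ideal_sum[OF K])
  then show "f \<in> K" using r0 sum_single_keys[of f] by (simp add: sum_subtractf)
qed

theorem initial_ideal_curve: "initial_ideal (curve_ideal n) = (tops_ideal n :: ('i, 'k::field) mpoly set)"
proof -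
  interpret R: cring "mpoly_ring :: ('i, 'k) mpoly ring" by (rule mpoly_cring)
  show ?thesis
    unfolding initial_ideal_def
  proof
    show "Idl\<^bsub>mpoly_ring\<^esub> (initial_form ` curve_ideal n) \<subseteq> (tops_ideal n :: ('i, 'k) mpoly set)"
      by (rule R.genideal_minimal[OF tops_ideal_ideal]) (auto intro: initial_form_in_tops_ideal)
    show "(tops_ideal n :: ('i, 'k) mpoly set) \<subseteq> Idl\<^bsub>mpoly_ring\<^esub> (initial_form ` curve_ideal n)"
      by (rule tops_ideal_subset[OF R.genideal_ideal R.genideal_self]) auto
  qed
qed

end

section \<open>The tangent cone as a thickening of the line\<close>

text \<open>The polynomial \<open>p(x\<^sub>z)\<close>.\<close>

definition line_poly :: "'i \<Rightarrow> 'k::field poly \<Rightarrow> ('i, 'k) mpoly" where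
  "line_poly z p = poly (map_poly (Poly_Mapping.single 0) p) (Poly_Mapping.single (Poly_Mapping.single z 1) 1)"

abbreviation X :: "'i \<Rightarrow> ('i, 'k::field) mpoly" where
  "X z \<equiv> Poly_Mapping.single (Poly_Mapping.single z 1) 1"

lemma line_poly_0 [simp]: "line_poly z 0 = 0"
  by (simp add: line_poly_def)

lemma line_poly_pCons: "line_poly z (pCons a p) = Poly_Mapping.single 0 a + X z * line_poly z p"
  by (simp add: line_poly_def map_poly_pCons)

lemma line_poly_1: "line_poly z 1 = 1"
  by (simp add: one_pCons line_poly_pCons)

lemma line_poly_X: "line_poly z [:0, 1:] = X z"
  by (simp add: line_poly_pCons mult_single)

lemma line_poly_add: "line_poly z (p + q) = line_poly z p + line_poly z q"
  by (induction p q rule: poly_induct2) (simp_all add: line_poly_pCons algebra_simps single_add)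

lemma line_poly_smult: "line_poly z (Polynomial.smult a p) = Poly_Mapping.single 0 a * line_poly z p"
  by (induction p) (simp_all add: line_poly_pCons algebra_simps mult_single)

lemma line_poly_mult: "line_poly z (p * q) = line_poly z p * line_poly z q"
  by (induction p) (simp_all add: line_poly_pCons line_poly_add line_poly_smult algebra_simps)

lemma line_poly_pow: "line_poly z (p ^ k) = line_poly z p ^ k"
  by (induction k) (simp_all add: line_poly_1 line_poly_mult)

lemma X_pow: "X z ^ k = Poly_Mapping.single (Poly_Mapping.single z k) 1"
  by (induction k) (simp_all add: mult_single single_add[symmetric])

lemma line_poly_monom: "line_poly z (Polynomial.monom c k) = Poly_Mapping.single (Poly_Mapping.single z k) c"
  by (induction k) (simp_all add: monom_0 monom_Suc line_poly_pCons mult_single single_add[symmetric])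

lemma quot_eq_iff:
  fixes J :: "('i, 'k::comm_ring_1) mpoly set"
  assumes "ideal J mpoly_ring"
  shows "J +>\<^bsub>mpoly_ring\<^esub> f = J +>\<^bsub>mpoly_ring\<^esub> g \<longleftrightarrow> f - g \<in> J"
  using ring.quotient_eq_iff_same_a_r_cos[OF cring.axioms(1)[OF mpoly_cring] assms, of f g]
  by (simp add: mpoly_ring_minus)

lemma quot_carrier: "carrier (mpoly_ring Quot J) = range (\<lambda>f. J +>\<^bsub>mpoly_ring\<^esub> f)"
  by (auto simp: FactRing_def A_RCOSETS_def')

lemma quot_hom:
  fixes J :: "('i, 'k::comm_ring_1) mpoly set"
  assumes "ideal J mpoly_ring"
  shows "ring_hom_cring mpoly_ring (mpoly_ring Quot J) (\<lambda>f. J +>\<^bsub>mpoly_ring\<^esub> f)"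
  using ideal.rcos_ring_hom_cring[OF assms mpoly_cring] .

lemma finite_bounded_exponents:
  "finite {u :: 'i::finite \<Rightarrow>\<^sub>0 nat. \<forall>i. Poly_Mapping.lookup u i < N}"
proof -
  have "finite (PiE (UNIV :: 'i set) (\<lambda>_. {..<N}))" by (rule finite_PiE) auto
  moreover have "Poly_Mapping.lookup ` {u :: 'i::finite \<Rightarrow>\<^sub>0 nat. \<forall>i. Poly_Mapping.lookup u i < N} \<subseteq> PiE UNIV (\<lambda>_. {..<N})"
    by auto
  ultimately have "finite (Poly_Mapping.lookup ` {u :: 'i::finite \<Rightarrow>\<^sub>0 nat. \<forall>i. Poly_Mapping.lookup u i < N})"
    by (rule finite_subset[rotated])
  then show ?thesis by (rule finite_imageD) (simp add: inj_on_def)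
qed

text \<open>The coordinate axis of the variable \<open>x\<^sub>z\<close> of smallest weight becomes the line of which the
  tangent cone is a thickening.  The parameter \<open>field_type\<close> only fixes the coefficient field, so
  that the quotient ring can be a constant of the locale.\<close>

locale smallest_weight = positive_weights n for n :: "'i::finite \<Rightarrow> nat" +
  fixes z :: 'i and field_type :: "'k::field itself"
  assumes smallest: "\<And>i. i \<noteq> z \<Longrightarrow> n z < n i"
begin

abbreviation J :: "('i, 'k) mpoly set" where "J \<equiv> tops_ideal n"
abbreviation A :: "('i, 'k) mpoly set ring" where "A \<equiv> mpoly_ring Quot J"
abbreviation h :: "('i, 'k) mpoly \<Rightarrow> ('i, 'k) mpoly set" where "h f \<equiv> J +>\<^bsub>mpoly_ring\<^esub> f"
abbreviation \<phi> :: "'k poly \<Rightarrow> ('i, 'k) mpoly set" where "\<phi> p \<equiv> h (line_poly z p)"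

lemmas J_D = mpoly_idealD[OF tops_ideal_ideal[where 'b = 'k and n = n]]

sublocale H: ring_hom_cring "mpoly_ring :: ('i, 'k) mpoly ring" A h
  by (rule quot_hom[OF tops_ideal_ideal])

lemma h_simps: "h f \<otimes>\<^bsub>A\<^esub> h g = h (f * g)" "h f \<oplus>\<^bsub>A\<^esub> h g = h (f + g)" "\<one>\<^bsub>A\<^esub> = h 1" "\<zero>\<^bsub>A\<^esub> = h 0"
  using H.hom_mult[of f g] H.hom_add[of f g] H.hom_one H.hom_zero by simp_all

lemma h_eq_zero_iff: "h f = \<zero>\<^bsub>A\<^esub> \<longleftrightarrow> f \<in> J"
  by (simp add: h_simps quot_eq_iff[OF tops_ideal_ideal])

lemma h_closed: "h f \<in> carrier A"
  using H.hom_closed[of f] by simp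

lemma h_pow: "h f [^]\<^bsub>A\<^esub> (k::nat) = h (f ^ k)"
  by (induction k) (simp_all add: h_simps mult.commute)

lemma h_minus: "h f \<ominus>\<^bsub>A\<^esub> h g = h (f - g)"
proof -
  have "\<ominus>\<^bsub>A\<^esub> h g = h (- g)"
    by (rule H.S.minus_equality) (simp_all add: h_simps h_closed)
  then show ?thesis by (simp add: H.S.minus_eq h_simps)
qed

abbreviation nilA where "nilA \<equiv> ideal_radical A {\<zero>\<^bsub>A\<^esub>}"

lemma nil_iff: "h f \<in> nilA \<longleftrightarrow> (\<exists>k::nat. f ^ k \<in> J)"
  by (simp add: ideal_radical_def h_pow h_eq_zero_iff h_closed)

lemma nil_ideal: "ideal nilA A"
  by (rule H.S.ideal_radical_ideal[OF H.S.zeroideal])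

lemma nil_add: "h f \<in> nilA \<Longrightarrow> h g \<in> nilA \<Longrightarrow> h (f + g) \<in> nilA"
  using additive_subgroup.a_closed[OF ideal.axioms(1)[OF nil_ideal], of "h f" "h g"] by (simp add: h_simps)

lemma nil_mult: "h f \<in> nilA \<Longrightarrow> h (g * f) \<in> nilA"
  using ideal.I_l_closed[OF nil_ideal, of "h f" "h g"] by (simp add: h_simps h_closed)

lemma monomial_split:
  fixes m :: "'j \<Rightarrow>\<^sub>0 nat"
  assumes "k \<le> Poly_Mapping.lookup m i"
  obtains m' where "m = Poly_Mapping.single i k + m'"
proof
  show "m = Poly_Mapping.single i k + (m - Poly_Mapping.single i k)"
    using assms by (intro poly_mapping_eqI) (auto simp: lookup_add lookup_minus lookup_single when_def)
qed

text \<open>The monomials \<open>x\<^sub>i\<^bsup>n z\<^esup>\<close> and \<open>x\<^sub>z\<^bsup>n i\<^esup>\<close> have the same weight, and the second one has the larger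
  degree.\<close>

lemma power_in_J:
  assumes "i \<noteq> z" "n z \<le> Poly_Mapping.lookup m i"
  shows "Poly_Mapping.single m c \<in> J"
proof -
  obtain m' where m': "m = Poly_Mapping.single i (n z) + m'" using monomial_split[OF assms(2)] .
  have "Poly_Mapping.single i (n z) \<notin> top_monomials n (wt n (Poly_Mapping.single i (n z)))"
    using smallest[OF assms(1)]
    by (auto simp: top_monomials_def mult.commute intro!: exI[of _ "Poly_Mapping.single z (n i)"])
  then have "Poly_Mapping.single (Poly_Mapping.single i (n z)) 1 \<in> J"
    by (simp add: single_in_tops_ideal_iff)
  then have "Poly_Mapping.single m' c * Poly_Mapping.single (Poly_Mapping.single i (n z)) 1 \<in> J"
    by (rule J_D(3))
  then show ?thesis by (simp add: mult_single m' add.commute)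
qed

lemma monomial_nilpotent:
  assumes "i \<noteq> z" "0 < Poly_Mapping.lookup m i"
  shows "h (Poly_Mapping.single m c) \<in> nilA"
proof -
  have "1 \<le> Poly_Mapping.lookup m i" using assms by simp
  then obtain m' where m': "m = Poly_Mapping.single i 1 + m'" by (rule monomial_split)
  have "X i ^ n z \<in> J" unfolding X_pow by (rule power_in_J[OF assms(1)]) simp
  then have "h (X i) \<in> nilA" using nil_iff by blast
  then have "h (Poly_Mapping.single m' c * X i) \<in> nilA" by (rule nil_mult)
  then show ?thesis by (simp add: mult_single m' add.commute)
qed

lemma line_monomial: "(\<And>i. i \<noteq> z \<Longrightarrow> Poly_Mapping.lookup m i = 0) \<Longrightarrow>
  m = Poly_Mapping.single z (Poly_Mapping.lookup m z)"
  by (intro poly_mapping_eqI) (auto simp: lookup_single when_def)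

lemma decomposition: "\<exists>p. h f \<ominus>\<^bsub>A\<^esub> \<phi> p \<in> nilA"
proof (induction f rule: mpoly_induct)
  case (single m c)
  show ?case
  proof (cases "\<exists>i. i \<noteq> z \<and> 0 < Poly_Mapping.lookup m i")
    case True
    then show ?thesis using monomial_nilpotent by (intro exI[of _ 0]) (auto simp: h_minus)
  next
    case False
    then have "m = Poly_Mapping.single z (Poly_Mapping.lookup m z)" by (intro line_monomial) auto
    then have "line_poly z (Polynomial.monom c (Poly_Mapping.lookup m z)) = Poly_Mapping.single m c"
      by (simp add: line_poly_monom)
    moreover have "h 0 \<in> nilA" using nil_iff[of 0] J_D(1) by (auto intro: exI[of _ 1])
    ultimately show ?thesis by (metis h_minus diff_self)
  qed
next
  case (add f g)
  then obtain p q where "h (f - line_poly z p) \<in> nilA" "h (g - line_poly z q) \<in> nilA"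
    by (auto simp: h_minus)
  then have "h ((f - line_poly z p) + (g - line_poly z q)) \<in> nilA" by (rule nil_add)
  then show ?case by (intro exI[of _ "p + q"]) (simp add: h_minus line_poly_add algebra_simps)
qed

lemma wt_ge: "mdeg m * n z \<le> wt n m"
  and wt_eqD: "wt n m = mdeg m * n z \<Longrightarrow> m = Poly_Mapping.single z (mdeg m)"
proof -
  have le: "Poly_Mapping.lookup m i * n z \<le> Poly_Mapping.lookup m i * n i" for i
    using smallest[of i] by (cases "i = z") auto
  then show ge: "mdeg m * n z \<le> wt n m"
    unfolding mdeg_def wt_def sum_distrib_right by (intro sum_mono)
  assume eq: "wt n m = mdeg m * n z"
  have "Poly_Mapping.lookup m i = 0" if i: "i \<noteq> z" for i
  proof (rule ccontr)
    assume "Poly_Mapping.lookup m i \<noteq> 0"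
    then have "Poly_Mapping.lookup m i * n z < Poly_Mapping.lookup m i * n i" using smallest[OF i] by simp
    then have "mdeg m * n z < wt n m"
      unfolding mdeg_def wt_def sum_distrib_right
      using le by (intro sum_strict_mono_ex1) auto
    then show False using eq by simp
  qed
  then have m: "m = Poly_Mapping.single z (Poly_Mapping.lookup m z)" by (rule line_monomial)
  then have "mdeg m = Poly_Mapping.lookup m z" by (metis mdeg_single)
  then show "m = Poly_Mapping.single z (mdeg m)" using m by simp
qed

text \<open>Powers of \<open>x\<^sub>z\<close> are the only top monomials of their weight, since they have the lightest
  possible factors.  Hence they stay linearly independent in the tangent cone.\<close>

lemma top_line: "top_monomials n (k * n z) = {Poly_Mapping.single z k}"
proof -
  have nz: "0 < n z" by (rule pos)
  have le: "mdeg m \<le> k" if "wt n m = k * n z" for m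
    using wt_ge[of m] that nz by simp
  show ?thesis
  proof (intro Set.equalityI subsetI)
    fix m assume m: "m \<in> top_monomials n (k * n z)"
    then have w: "wt n m = k * n z" by (simp add: top_monomials_def)
    have "mdeg (Poly_Mapping.single z k) \<le> mdeg m" using m wt_single[of n z k] unfolding top_monomials_def by blast
    then have "mdeg m = k" using le[OF w] by simp
    then show "m \<in> {Poly_Mapping.single z k}" using wt_eqD[of m] w by simp
  qed (use le in \<open>auto simp: top_monomials_def\<close>)
qed

lemma coeff_sum_line_poly: "coeff_sum (top_monomials n (k * n z)) (line_poly z p) = Polynomial.coeff p k"
proof (induction p arbitrary: k)
  case (pCons a p)
  show ?case
  proof (cases k)
    case 0
    have "{m. Poly_Mapping.single z (Suc 0) + m = (0 :: 'i \<Rightarrow>\<^sub>0 nat)} = {}"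
    proof -
      have "Poly_Mapping.lookup (Poly_Mapping.single z (Suc 0) + m) z \<noteq> Poly_Mapping.lookup 0 z" for m :: "'i \<Rightarrow>\<^sub>0 nat"
        by (simp add: lookup_add)
      then show ?thesis by (metis (mono_tags, lifting) Collect_empty_eq)
    qed
    then show ?thesis
      unfolding top_line line_poly_pCons coeff_sum_add coeff_sum_single_mult
      using 0 by (simp add: coeff_sum_single coeff_sum_empty)
  next
    case (Suc l)
    have e: "Poly_Mapping.single z (Suc l) = Poly_Mapping.single z 1 + Poly_Mapping.single z l"
      by (simp add: single_add[symmetric])
    have "{m. Poly_Mapping.single z 1 + m = Poly_Mapping.single z (Suc l)} = {Poly_Mapping.single z l}"
      unfolding e by auto
    moreover have "(0 :: 'i \<Rightarrow>\<^sub>0 nat) \<noteq> Poly_Mapping.single z (Suc l)"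
      by (metis lookup_single_eq lookup_zero nat.distinct(1))
    ultimately show ?thesis
      using pCons.IH[of l]
      unfolding top_line line_poly_pCons coeff_sum_add coeff_sum_single_mult
      using Suc by (simp add: coeff_sum_single)
  qed
qed (simp add: coeff_sum_zero)

lemma line_poly_in_J: "line_poly z p \<in> J \<Longrightarrow> p = 0"
proof -
  assume "line_poly z p \<in> J"
  then have "Polynomial.coeff p k = 0" for k
    using coeff_sum_line_poly[of k p] by (simp add: tops_ideal_def)
  then show "p = 0" by (simp add: poly_eq_iff)
qed

sublocale T: line_thickening A \<phi>
proof (unfold_locales)
  show "\<exists>p. r \<ominus>\<^bsub>A\<^esub> \<phi> p \<in> nilA" if "r \<in> carrier A" for r
    using that decomposition by (auto simp: quot_carrier)
  show "p = 0" if p: "\<phi> p \<in> nilA" for p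
  proof -
    obtain k where "line_poly z p ^ k \<in> J" using p unfolding nil_iff by blast
    then have "line_poly z (p ^ k) \<in> J" unfolding line_poly_pow .
    then have "p ^ k = 0" by (rule line_poly_in_J)
    then show "p = 0" using power_not_zero by blast
  qed
qed (simp_all add: h_simps h_closed line_poly_add line_poly_mult line_poly_1)

text \<open>The tangent cone is a finite module over the line: exponents of the other variables may be
  taken smaller than \<open>n z\<close>.\<close>

lemma noetherian_tangent_cone: "noetherian_ring A"
proof -
  obtain us :: "('i \<Rightarrow>\<^sub>0 nat) list" where us: "set us = {u. \<forall>i. Poly_Mapping.lookup u i < n z}"
    using finite_list[OF finite_bounded_exponents] by blast
  let ?es = "map (\<lambda>u. h (Poly_Mapping.single u 1)) us"
  have es: "set ?es \<subseteq> carrier A" by (auto intro: h_closed)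
  have "h f \<in> T.phi_span ?es" for f
  proof (induction f rule: mpoly_induct)
    case (single m c)
    show ?case
    proof (cases "\<exists>i. i \<noteq> z \<and> n z \<le> Poly_Mapping.lookup m i")
      case True
      then have "h (Poly_Mapping.single m c) = \<zero>\<^bsub>A\<^esub>" using h_eq_zero_iff power_in_J by blast
      then show ?thesis using T.zero_in_phi_span[OF es] by simp
    next
      case False
      define k where "k = Poly_Mapping.lookup m z"
      obtain u where u: "m = Poly_Mapping.single z k + u" using monomial_split[of k m z] k_def by blast
      have "Poly_Mapping.lookup u i < n z" for i
      proof (cases "i = z")
        case True
        then have "Poly_Mapping.lookup u i = 0"
          using arg_cong[OF u, of "\<lambda>m. Poly_Mapping.lookup m z"] by (simp add: lookup_add k_def)
        then show ?thesis using pos by simp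
      next
        case i: False
        have "Poly_Mapping.lookup u i = Poly_Mapping.lookup m i" using u i by (simp add: lookup_add lookup_single)
        then show ?thesis using False i by auto
      qed
      then have "h (Poly_Mapping.single u 1) \<in> set ?es" using us by auto
      then have "\<phi> (Polynomial.monom c k) \<otimes>\<^bsub>A\<^esub> h (Poly_Mapping.single u 1) \<in> T.phi_span ?es"
        by (rule T.in_phi_span[OF es])
      then show ?thesis by (simp add: h_simps line_poly_monom mult_single u)
    qed
  next
    case (add f g)
    then show ?case using T.phi_span_add[OF es, of "h f" "h g"] by (simp add: h_simps)
  qed
  then have "carrier A \<subseteq> T.phi_span ?es" by (auto simp: quot_carrier)
  then show ?thesis by (rule T.noetherian_of_finite[OF es])
qed

abbreviation e where "e \<equiv> Poly_Mapping.single z (1::nat)"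

lemma X_mult_in_J:
  assumes lift: "\<And>m. m \<in> top_monomials n (wt n m) \<Longrightarrow> e + m \<in> top_monomials n (wt n (e + m))"
    and f: "X z * f \<in> J"
  shows "f \<in> J"
  unfolding tops_ideal_def
proof (intro CollectI allI)
  fix s
  show "coeff_sum (top_monomials n s) f = 0"
  proof (cases "top_monomials n s = {}")
    case False
    then obtain m where m: "m \<in> top_monomials n s" by blast
    then have w: "wt n m = s" by (rule top_wt)
    have "m \<in> {m. e + m \<in> top_monomials n (wt n e + s)}"
      using lift[of m] m w by (simp add: wt_add)
    then have "{m. e + m \<in> top_monomials n (wt n e + s)} = top_monomials n s"
      using shift_top_monomials[of e n "wt n e + s"] by auto
    then show ?thesis
      using f coeff_sum_single_mult[of "top_monomials n (wt n e + s)" e 1 f] by (simp add: tops_ideal_def)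
  qed (simp add: coeff_sum_empty)
qed

text \<open>The case of \<open>p(0) \<noteq> 0\<close> is settled by induction on the weight: in the lowest weight in which
  \<open>f\<close> could be nonzero, only the constant term of \<open>p\<close> contributes to \<open>p f\<close>.  The general case splits
  off factors \<open>x\<^sub>z\<close>.\<close>

lemma line_poly_mult_in_J:
  assumes lift: "\<And>m. m \<in> top_monomials n (wt n m) \<Longrightarrow> e + m \<in> top_monomials n (wt n (e + m))"
  shows "p \<noteq> 0 \<Longrightarrow> line_poly z p * f \<in> J \<Longrightarrow> f \<in> J"
proof (induction p)
  case (pCons a p)
  show ?case
  proof (cases "a = 0")
    case True
    then have "X z * (line_poly z p * f) \<in> J" using pCons.prems(2) by (simp add: line_poly_pCons mult.assoc)
    then have "line_poly z p * f \<in> J" using X_mult_in_J lift by blast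
    then show ?thesis using pCons.IH pCons.hyps True by auto
  next
    case False
    have "coeff_sum (top_monomials n s) f = 0" for s
    proof (induction s rule: less_induct)
      case (less s)
      let ?g = "line_poly z p * f"
      have "coeff_sum {m. e + m \<in> top_monomials n s} ?g = 0"
      proof (cases "{m. e + m \<in> top_monomials n s} = {}")
        case False
        then obtain t where t: "t + wt n e = s" "{m. e + m \<in> top_monomials n s} = top_monomials n t"
          using shift_top_monomials[of e n s] by blast
        have "t < s" using t(1) pos[of z] by auto
        then show ?thesis unfolding t(2) by (intro coeff_sum_top_mult less.IH) simp
      qed (simp add: coeff_sum_empty)
      moreover have "line_poly z (pCons a p) * f = Poly_Mapping.single 0 a * f + X z * ?g"
        by (simp add: line_poly_pCons algebra_simps)
      then have "coeff_sum (top_monomials n s) (Poly_Mapping.single 0 a * f + X z * ?g) = 0"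
        using pCons.prems(2) by (simp add: tops_ideal_def)
      ultimately have "a * coeff_sum (top_monomials n s) f = 0"
        unfolding coeff_sum_add coeff_sum_single_mult by simp
      then show ?case using False by simp
    qed
    then show ?thesis by (simp add: tops_ideal_def)
  qed
qed simp

text \<open>A top monomial \<open>m\<close> for which \<open>x\<^sub>z m\<close> is not top is a nonzero element of the tangent cone
  killed by \<open>x\<^sub>z\<close>; if there is none, then multiplication by \<open>x\<^sub>z\<close> sends the basis elements,
  one for each weight, to distinct basis elements.\<close>

theorem cm_tangent_cone_iff_lift:
  "cm_tangent_cone (curve_ideal n :: ('i, 'k) mpoly set) \<longleftrightarrow>
    (\<forall>m. m \<in> top_monomials n (wt n m) \<longrightarrow> e + m \<in> top_monomials n (wt n (e + m)))"
proof -
  have "cohen_macaulay A \<longleftrightarrow>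
    (\<forall>m. m \<in> top_monomials n (wt n m) \<longrightarrow> e + m \<in> top_monomials n (wt n (e + m)))" (is "_ \<longleftrightarrow> ?lift")
  proof
    assume CM: "cohen_macaulay A"
    show ?lift
    proof (intro allI impI, rule ccontr)
      fix m assume m: "m \<in> top_monomials n (wt n m)" and no: "e + m \<notin> top_monomials n (wt n (e + m))"
      let ?y = "h (Poly_Mapping.single m 1)"
      have "X z * Poly_Mapping.single m 1 \<in> J" using no by (simp add: mult_single single_in_tops_ideal_iff)
      then have "\<phi> [:0, 1:] \<otimes>\<^bsub>A\<^esub> ?y = \<zero>\<^bsub>A\<^esub>" by (simp only: line_poly_X h_simps(1) h_eq_zero_iff)
      then have "?y = \<zero>\<^bsub>A\<^esub>" using T.cohen_macaulayD[OF CM h_closed] by blast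
      then have "Poly_Mapping.single m 1 \<in> J" by (simp only: h_eq_zero_iff)
      then show False using m by (simp add: single_in_tops_ideal_iff)
    qed
  next
    assume lift: ?lift
    show "cohen_macaulay A"
    proof (rule T.cohen_macaulayI[OF noetherian_tangent_cone])
      fix p y assume p: "p \<noteq> 0" and y: "y \<in> carrier A" "\<phi> p \<otimes>\<^bsub>A\<^esub> y = \<zero>\<^bsub>A\<^esub>"
      obtain f where f: "y = h f" using y(1) by (auto simp: quot_carrier)
      then have "line_poly z p * f \<in> J" using y(2) by (simp only: h_simps(1) h_eq_zero_iff)
      then have "f \<in> J" using line_poly_mult_in_J lift p by blast
      then show "y = \<zero>\<^bsub>A\<^esub>" using f by (simp only: h_eq_zero_iff)
    qed
  qed
  then show ?thesis by (simp only: cm_tangent_cone_def initial_ideal_curve)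
qed

end

text \<open>Adding \<open>x\<^sub>z\<close> preserves top monomials iff in each weight of the form \<open>n z + s\<close> the largest
  degree is attained by a monomial divisible by \<open>x\<^sub>z\<close>.\<close>

theorem (in smallest_weight) cm_tangent_cone_iff:
  "cm_tangent_cone (curve_ideal n :: ('i, 'k) mpoly set) \<longleftrightarrow>
    (\<forall>m w. wt n m = n z + wt n w \<longrightarrow>
      (\<exists>N. 0 < Poly_Mapping.lookup N z \<and> wt n N = wt n m \<and> mdeg m \<le> mdeg N))"
  (is "_ \<longleftrightarrow> ?star")
  unfolding cm_tangent_cone_iff_lift
proof (intro iffI allI impI)
  fix m w assume lift: "\<forall>m. m \<in> top_monomials n (wt n m) \<longrightarrow> e + m \<in> top_monomials n (wt n (e + m))"
    and m: "wt n m = n z + wt n w"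
  obtain t where t: "t \<in> top_monomials n (wt n w)" by (rule top_monomial_exists)
  then have wt: "wt n t = wt n w" by (rule top_wt)
  then have top: "e + t \<in> top_monomials n (wt n (e + t))" using lift t by simp
  have w: "wt n (e + t) = wt n m" using m wt by (simp add: wt_add)
  show "\<exists>N. 0 < Poly_Mapping.lookup N z \<and> wt n N = wt n m \<and> mdeg m \<le> mdeg N"
    using top w by (intro exI[of _ "e + t"]) (auto simp: lookup_add top_monomials_def)
next
  fix m assume star: ?star and m: "m \<in> top_monomials n (wt n m)"
  have "mdeg m' \<le> mdeg (e + m)" if m': "wt n m' = wt n (e + m)" for m'
  proof -
    have "wt n m' = n z + wt n m" using m' by (simp add: wt_add)
    then obtain N where N: "0 < Poly_Mapping.lookup N z" "wt n N = wt n m'" "mdeg m' \<le> mdeg N"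
      using star by blast
    have "1 \<le> Poly_Mapping.lookup N z" using N by simp
    then obtain N' where N': "N = e + N'" by (rule monomial_split)
    have "wt n N' = wt n m" using N(2) m' by (simp add: N' wt_add)
    then have "mdeg N' \<le> mdeg m" using m by (simp add: top_monomials_def)
    then show ?thesis using N(3) by (simp add: N' mdeg_add)
  qed
  then show "e + m \<in> top_monomials n (wt n (e + m))" by (simp add: top_monomials_def)
qed

section \<open>Binomial moves\<close>

text \<open>If \<open>C\<close> is closed under the moves \<open>v + a \<leftrightarrow> v + b\<close>, then the coefficient sum over \<open>C\<close>, or over
  a shift of \<open>C\<close>, vanishes on the binomials and hence on the ideal that they generate.\<close>

lemma binomial_ideal_class:
  fixes B :: "(('i \<Rightarrow>\<^sub>0 nat) \<times> ('i \<Rightarrow>\<^sub>0 nat)) set"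
  assumes closed: "\<And>a b v. (a, b) \<in> B \<Longrightarrow> v + a \<in> C \<longleftrightarrow> v + b \<in> C"
    and mem: "Poly_Mapping.single m 1 - Poly_Mapping.single m' (1::'k::comm_ring_1)
      \<in> Idl\<^bsub>mpoly_ring\<^esub> ((\<lambda>(a, b). Poly_Mapping.single a 1 - Poly_Mapping.single b 1) ` B)"
  shows "m \<in> C \<longleftrightarrow> m' \<in> C"
proof -
  let ?K = "{f :: ('i, 'k) mpoly. \<forall>u. coeff_sum {m. u + m \<in> C} f = 0}"
  interpret R: cring "mpoly_ring :: ('i, 'k) mpoly ring" by (rule mpoly_cring)
  have "ideal ?K mpoly_ring"
  proof (rule mpoly_idealI)
    fix f g assume f: "f \<in> ?K"
    show "g * f \<in> ?K"
    proof (intro CollectI allI coeff_sum_mult_zero)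
      fix u u'
      show "coeff_sum {m. u' + m \<in> {m. u + m \<in> C}} f = 0"
        using f by (simp add: add.assoc[symmetric])
    qed
  qed (auto simp: coeff_sum_zero coeff_sum_add)
  then have "Idl\<^bsub>mpoly_ring\<^esub> ((\<lambda>(a, b). Poly_Mapping.single a 1 - Poly_Mapping.single b 1) ` B) \<subseteq> ?K"
    by (rule R.genideal_minimal) (auto simp: coeff_sum_diff coeff_sum_single closed)
  then have "coeff_sum {m. 0 + m \<in> C} (Poly_Mapping.single m (1::'k) - Poly_Mapping.single m' 1) = 0"
    using mem by blast
  then show ?thesis by (simp add: coeff_sum_diff coeff_sum_single split: if_splits)
qed


section \<open>Monomials in four variables\<close>

definition expo :: "nat \<Rightarrow> nat \<Rightarrow> nat \<Rightarrow> nat \<Rightarrow> 4 \<Rightarrow>\<^sub>0 nat" where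
  "expo p q r s = Poly_Mapping.single 1 p + Poly_Mapping.single 2 q + Poly_Mapping.single 3 r + Poly_Mapping.single 4 s"

lemma lookup_expo [simp]:
  "Poly_Mapping.lookup (expo p q r s) 1 = p" "Poly_Mapping.lookup (expo p q r s) 2 = q"
  "Poly_Mapping.lookup (expo p q r s) 3 = r" "Poly_Mapping.lookup (expo p q r s) 4 = s"
  by (simp_all add: expo_def lookup_add lookup_single when_def)

lemma four_cases: "(i::4) = 1 \<or> i = 2 \<or> i = 3 \<or> i = 4"
  using UNIV_4(1) by blast

lemma expo_lookup: "expo (Poly_Mapping.lookup m 1) (Poly_Mapping.lookup m 2) (Poly_Mapping.lookup m 3)
  (Poly_Mapping.lookup m 4) = m"
proof (rule poly_mapping_eqI)
  fix i :: 4
  show "Poly_Mapping.lookup (expo (Poly_Mapping.lookup m 1) (Poly_Mapping.lookup m 2) (Poly_Mapping.lookup m 3)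
    (Poly_Mapping.lookup m 4)) i = Poly_Mapping.lookup m i"
    using four_cases[of i] by (elim disjE) (simp_all only: lookup_expo)
qed

lemma expo_cases: obtains p q r s where "m = expo p q r s"
  using expo_lookup by metis

lemma expo_eq_iff [simp]: "expo p q r s = expo p' q' r' s' \<longleftrightarrow> p = p' \<and> q = q' \<and> r = r' \<and> s = s'"
  by (metis lookup_expo)

lemma expo_add [simp]: "expo p q r s + expo p' q' r' s' = expo (p + p') (q + q') (r + r') (s + s')"
  by (simp add: expo_def single_add algebra_simps)

lemma sum_four: "(\<Sum>i\<in>UNIV. F (i::4)) = F 1 + F 2 + F 3 + (F 4 :: nat)"
  using UNIV_4(2) unfolding UNIV_4(1) by (simp add: add.assoc)

lemma wt_expo [simp]: "wt n (expo p q r s) = p * n 1 + q * n 2 + r * n 3 + s * n 4"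
  unfolding wt_def sum_four lookup_expo ..

lemma mdeg_expo [simp]: "mdeg (expo p q r s) = p + q + r + s"
  unfolding mdeg_def sum_four lookup_expo ..

lemma var_pow: "(var i :: ('i, 'k::field) mpoly) ^ k = Poly_Mapping.single (Poly_Mapping.single i k) 1"
  unfolding var_def monomial_def by (rule X_pow)

lemma num_semigroup_four: "num_semigroup n = range (\<lambda>m. wt (n :: 4 \<Rightarrow> nat) m)"
proof -
  have "(\<exists>m. x = wt n m) \<longleftrightarrow> (\<exists>g. x = (\<Sum>i\<in>UNIV. g i * n i))" for x
  proof
    assume "\<exists>g. x = (\<Sum>i\<in>UNIV. g i * n i)"
    then obtain g where "x = (\<Sum>i\<in>UNIV. g i * n i)" by blast
    then have "x = wt n (expo (g 1) (g 2) (g 3) (g 4))" by (simp add: sum_four)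
    then show "\<exists>m. x = wt n m" by blast
  qed (auto simp: wt_def)
  then show ?thesis unfolding num_semigroup_def by auto
qed

theorem proposition3p23:
  fixes n :: "4 \<Rightarrow> nat"
    and I :: "(4, 'k::field) mpoly set"
    and a1 a2 a3 a4 a12 a13 a21 a24 a32 a34 a41 a43 :: nat
  assumes pos: "\<And>i. 0 < n i"
    and gcd: "Gcd (range n) = 1"
    and order: "n 1 < n 2" "n 2 < n 3" "n 3 < n 4"
    and I_def: "I = curve_ideal n"
    and gorenstein: "gorenstein_curve n"
    and not_ci: "\<not> complete_intersection_curve I"
    and exponents:
      "0 < a12" "a12 < a2"  "0 < a32" "a32 < a2"
      "0 < a13" "a13 < a3"  "0 < a43" "a43 < a3"
      "0 < a21" "a21 < a1"  "0 < a41" "a41 < a1"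
      "0 < a24" "a24 < a4"  "0 < a34" "a34 < a4"
    and bresinsky: "a1 = a21 + a41" "a2 = a12 + a32" "a3 = a13 + a43" "a4 = a24 + a34"
    and generators: "minimally_generates
      {var 1 ^ a1 - var 2 ^ a12 * var 3 ^ a13,
       var 2 ^ a2 - var 1 ^ a21 * var 4 ^ a24,
       var 3 ^ a3 - var 2 ^ a32 * var 4 ^ a34,
       var 4 ^ a4 - var 1 ^ a41 * var 3 ^ a43,
       var 1 ^ a41 * var 2 ^ a32 - var 3 ^ a13 * var 4 ^ a24} I"
  shows "cm_tangent_cone I \<longleftrightarrow>
    a2 \<le> a21 + a24 \<and>
    (\<forall>u2 u3 u4 M.
       M = Poly_Mapping.single 2 u2 + Poly_Mapping.single 3 u3 + Poly_Mapping.single 4 u4 \<and>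
       u2 < a12 \<and> u3 \<ge> a3 \<and> u4 < a24 \<and>
       u2 * n 2 + u3 * n 3 + u4 * n 4 \<in> (\<lambda>m. n 1 + m) ` num_semigroup n \<longrightarrow>
       (\<exists>N. 1 \<in> Poly_Mapping.keys N \<and> monomial M - monomial N \<in> I \<and> mdeg M \<le> mdeg N))"
    (is "_ \<longleftrightarrow> ?c1 \<and> ?c2")
proof -
  interpret smallest_weight n 1 "TYPE('k)"
  proof unfold_locales
    show "n 1 < n i" if "i \<noteq> 1" for i using four_cases[of i] that order by auto
  qed (rule pos)
  let ?bin = "\<lambda>(a, b). Poly_Mapping.single a 1 - Poly_Mapping.single b (1::'k)"
  let ?B = "{(expo a1 0 0 0, expo 0 a12 a13 0), (expo 0 a2 0 0, expo a21 0 0 a24),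
    (expo 0 0 a3 0, expo 0 a32 0 a34), (expo 0 0 0 a4, expo a41 0 a43 0),
    (expo a41 a32 0 0, expo 0 0 a13 a24)}"
  have "{var 1 ^ a1 - var 2 ^ a12 * var 3 ^ a13,
       var 2 ^ a2 - var 1 ^ a21 * var 4 ^ a24,
       var 3 ^ a3 - var 2 ^ a32 * var 4 ^ a34,
       var 4 ^ a4 - var 1 ^ a41 * var 3 ^ a43,
       var 1 ^ a41 * var 2 ^ a32 - var 3 ^ a13 * var 4 ^ a24} = ?bin ` ?B"
    by (simp only: image_insert image_empty prod.case)
      (simp add: var_pow mult_single expo_def)
  then have I: "I = Idl\<^bsub>mpoly_ring\<^esub> (?bin ` ?B)"
    using generators by (simp only: minimally_generates_def)
  have bin_iff: "?bin (m, m') \<in> I \<longleftrightarrow> wt n m = wt n m'" for m m'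
    unfolding I_def prod.case by (rule binomial_in_curve_ideal_iff)
  have invariant: "m \<in> C \<longleftrightarrow> m' \<in> C"
    if "\<And>a b v. (a, b) \<in> ?B \<Longrightarrow> v + a \<in> C \<longleftrightarrow> v + b \<in> C" "wt n m = wt n m'" for C m m'
    using binomial_ideal_class[of ?B C m m', where 'k = 'k] that bin_iff[of m m'] unfolding I by simp
  have "?bin ` ?B \<subseteq> I"
    unfolding I by (rule ring.genideal_self[OF cring.axioms(1)[OF mpoly_cring]]) simp
  then have B_wt: "wt n m = wt n m'" if "(m, m') \<in> ?B" for m m'
    using that bin_iff[of m m'] by blast
  have w1: "a1 * n 1 = a12 * n 2 + a13 * n 3" using B_wt[of "expo a1 0 0 0" "expo 0 a12 a13 0"] by simp
  have w2: "a2 * n 2 = a21 * n 1 + a24 * n 4" using B_wt[of "expo 0 a2 0 0" "expo a21 0 0 a24"] by simp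
  have w4: "a4 * n 4 = a41 * n 1 + a43 * n 3" using B_wt[of "expo 0 0 0 a4" "expo a41 0 a43 0"] by simp
  have w5: "a41 * n 1 + a32 * n 2 = a13 * n 3 + a24 * n 4" using B_wt[of "expo a41 a32 0 0" "expo 0 0 a13 a24"] by simp
  have cm: "cm_tangent_cone I \<longleftrightarrow> (\<forall>m w. wt n m = n 1 + wt n w \<longrightarrow>
      (\<exists>N. 0 < Poly_Mapping.lookup N 1 \<and> wt n N = wt n m \<and> mdeg m \<le> mdeg N))" (is "_ \<longleftrightarrow> ?star")
    unfolding I_def by (rule cm_tangent_cone_iff)
  have c2_iff: "?c2 \<longleftrightarrow> (\<forall>u2 u3 u4 w. u2 < a12 \<and> a3 \<le> u3 \<and> u4 < a24 \<and>
      wt n (expo 0 u2 u3 u4) = n 1 + wt n w \<longrightarrow>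
      (\<exists>N. 0 < Poly_Mapping.lookup N 1 \<and> wt n N = wt n (expo 0 u2 u3 u4) \<and> mdeg (expo 0 u2 u3 u4) \<le> mdeg N))"
    (is "_ \<longleftrightarrow> ?c2'")
  proof -
    have e: "Poly_Mapping.single 2 u2 + Poly_Mapping.single 3 u3 + Poly_Mapping.single 4 u4 = expo 0 u2 u3 u4"
      for u2 u3 u4 by (simp add: expo_def)
    have k: "1 \<in> Poly_Mapping.keys N \<longleftrightarrow> 0 < Poly_Mapping.lookup N 1" for N :: "4 \<Rightarrow>\<^sub>0 nat"
      by (simp add: in_keys_iff)
    have b: "monomial M - monomial N \<in> I \<longleftrightarrow> wt n N = wt n M" for M N
      using bin_iff[of M N] by (auto simp: monomial_def)
    have s: "u2 * n 2 + u3 * n 3 + u4 * n 4 \<in> (\<lambda>m. n 1 + m) ` num_semigroup n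
      \<longleftrightarrow> (\<exists>w. wt n (expo 0 u2 u3 u4) = n 1 + wt n w)" for u2 u3 u4
      by (auto simp: num_semigroup_four)
    show ?thesis unfolding e k b s by blast
  qed
  have "?star \<longleftrightarrow> ?c1 \<and> ?c2'"
  proof
    assume star: ?star
    have ?c1
    proof -
      have "wt n (expo 0 a2 0 0) = n 1 + wt n (expo (a21 - 1) 0 0 a24)"
        using exponents(9) w2 by (cases a21) auto
      then obtain N where N: "0 < Poly_Mapping.lookup N 1" "wt n N = wt n (expo 0 a2 0 0)"
        "mdeg (expo 0 a2 0 0) \<le> mdeg N" using star by blast
      \<comment> \<open>The class of \<open>x\<^sub>2\<^bsup>a2\<^esup>\<close> has just two elements, so \<open>N\<close> is the second one.\<close>
      let ?C = "{expo 0 a2 0 0, expo a21 0 0 a24}"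
      have "expo 0 a2 0 0 \<in> ?C \<longleftrightarrow> N \<in> ?C"
      proof (rule invariant)
        show "v + a \<in> ?C \<longleftrightarrow> v + b \<in> ?C" if "(a, b) \<in> ?B" for a b v
        proof -
          obtain p q r s where "v = expo p q r s" by (rule expo_cases)
          then show ?thesis using that exponents bresinsky by auto
        qed
      qed (simp only: N(2))
      then have "N = expo a21 0 0 a24" using N(1) by auto
      then show ?thesis using N(3) by simp
    qed
    then show "?c1 \<and> ?c2'" using star by blast
  next
    assume "?c1 \<and> ?c2'"
    then have c1: ?c1 and c2: ?c2' by blast+
    show ?star
    proof (intro allI impI)
      fix m w assume mw: "wt n m = n 1 + wt n w"
      obtain p q r s where m: "m = expo p q r s" by (rule expo_cases)
      let ?found = "\<exists>N. 0 < Poly_Mapping.lookup N 1 \<and> wt n N = wt n m \<and> mdeg m \<le> mdeg N"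
      have found: ?found if "0 < p'" "wt n (expo p' q' r' s') = wt n m" "p + q + r + s \<le> p' + q' + r' + s'"
        for p' q' r' s'
        using that m by (intro exI[of _ "expo p' q' r' s'"]) simp
      \<comment> \<open>Cases 2 to 5 are the moves along \<open>f\<^sub>1, f\<^sub>2, f\<^sub>4, f\<^sub>5\<close> that create \<open>x\<^sub>1\<close>.\<close>
      consider "0 < p" | "a12 \<le> q" "a13 \<le> r" | "a2 \<le> q" | "a4 \<le> s" | "a13 \<le> r" "a24 \<le> s"
        | "p = 0" "q < a12" "a3 \<le> r" "s < a24"
        | "p = 0" "\<not> (a12 \<le> q \<and> a13 \<le> r)" "q < a2" "s < a4" "\<not> (a13 \<le> r \<and> a24 \<le> s)" "r < a3"
        using exponents(6) by linarith
      then show ?found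
      proof cases
        case 1
        then show ?thesis using m by (intro found[of p q r s]) auto
      next
        case 2
        then obtain q' r' where e: "q = a12 + q'" "r = a13 + r'" by (metis le_Suc_ex)
        have "(a12 + a13) * n 1 \<le> a12 * n 2 + a13 * n 3"
          using order by (simp add: add_mult_distrib add_mono)
        then have "a12 + a13 \<le> a1" using w1 pos[of 1] by (metis mult_le_cancel2)
        then show ?thesis using w1 e exponents m
          by (intro found[of "p + a1" q' r' s]) (auto simp: add_mult_distrib)
      next
        case 3
        then obtain q' where e: "q = a2 + q'" by (metis le_Suc_ex)
        then show ?thesis using w2 e exponents m c1
          by (intro found[of "p + a21" q' r "s + a24"]) (auto simp: add_mult_distrib)
      next
        case 4
        then obtain s' where e: "s = a4 + s'" by (metis le_Suc_ex)
        have "a41 * n 1 + a43 * n 3 \<le> (a41 + a43) * n 4"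
          using order by (simp add: add_mult_distrib add_mono)
        then have "a4 \<le> a41 + a43" using w4 pos[of 4] by (metis mult_le_cancel2)
        then show ?thesis using w4 e exponents m
          by (intro found[of "p + a41" q "r + a43" s']) (auto simp: add_mult_distrib)
      next
        case 5
        then obtain r' s' where e: "r = a13 + r'" "s = a24 + s'" by (metis le_Suc_ex)
        have "(a13 + a24) * n 2 \<le> a13 * n 3 + a24 * n 4" "a41 * n 1 + a32 * n 2 \<le> (a41 + a32) * n 2"
          using order by (simp_all add: add_mult_distrib add_mono)
        then have "(a13 + a24) * n 2 \<le> (a41 + a32) * n 2" using w5 by linarith
        then have "a13 + a24 \<le> a41 + a32" using pos[of 2] by (metis mult_le_cancel2)
        then show ?thesis using w5 e exponents m
          by (intro found[of "p + a41" "q + a32" r' s']) (auto simp: add_mult_distrib)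
      next
        case 6
        then show ?thesis using c2 mw m by blast
      next
        case 7
        \<comment> \<open>Only \<open>f\<^sub>3\<close> can be applied, and after its first use \<open>x\<^sub>2\<close> and \<open>x\<^sub>4\<close> have exponents below
          \<open>a12\<close> and \<open>a24\<close>, which again rules out all other moves.  So the class of \<open>m\<close> is the
          following set, free of \<open>x\<^sub>1\<close>.\<close>
        define C where "C = {expo 0 x y z | x y z. \<exists>k. x + k * a32 = q \<and> y = r + k * a3 \<and> z + k * a34 = s}"
        have C: "expo x0 x y z \<in> C \<longleftrightarrow> x0 = 0 \<and> (\<exists>k. x + k * a32 = q \<and> y = r + k * a3 \<and> z + k * a34 = s)"
          for x0 x y z by (auto simp: C_def)
        have "m \<in> C \<longleftrightarrow> expo 1 0 0 0 + w \<in> C"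
        proof (rule invariant)
          show "v + a \<in> C \<longleftrightarrow> v + b \<in> C" if ab: "(a, b) \<in> ?B" for a b v
          proof -
            obtain x0 x y z where v: "v = expo x0 x y z" by (rule expo_cases)
            have step: "(\<exists>k::nat. P k) \<longleftrightarrow> P 0 \<or> (\<exists>k. P (Suc k))" for P
              by (metis not0_implies_Suc)
            have 1: "\<not> (x + a12 + k * a32 = q \<and> y + a13 = r + k * a3 \<and> z + k * a34 = s)" for k
            proof (cases k)
              case 0
              then show ?thesis using 7 by auto
            next
              case (Suc l)
              then have "k * a32 = a32 + l * a32" by simp
              then show ?thesis using 7 bresinsky(2) by linarith
            qed
            have 5: "\<not> (x + k * a32 = q \<and> y + a13 = r + k * a3 \<and> z + a24 + k * a34 = s)" for k
            proof (cases k)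
              case 0
              then show ?thesis using 7 by auto
            next
              case (Suc l)
              then have "k * a34 = a34 + l * a34" by simp
              then show ?thesis using 7 bresinsky(4) by linarith
            qed
            have 3: "(\<exists>k. x + k * a32 = q \<and> y + a3 = r + k * a3 \<and> z + k * a34 = s)
              \<longleftrightarrow> (\<exists>k. x + a32 + k * a32 = q \<and> y = r + k * a3 \<and> z + a34 + k * a34 = s)"
              by (subst step) (use 7 in \<open>simp add: add.assoc add.left_commute\<close>)
            have 2: "\<not> (x + a2 + k * a32 = q)" and 4: "\<not> (z + a4 + k * a34 = s)" for k
              using 7 by auto
            have nz: "x0 + a1 \<noteq> 0" "x0 + a21 \<noteq> 0" "x0 + a41 \<noteq> 0"
              using exponents by auto
            from ab consider "a = expo a1 0 0 0" "b = expo 0 a12 a13 0"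
              | "a = expo 0 a2 0 0" "b = expo a21 0 0 a24" | "a = expo 0 0 a3 0" "b = expo 0 a32 0 a34"
              | "a = expo 0 0 0 a4" "b = expo a41 0 a43 0" | "a = expo a41 a32 0 0" "b = expo 0 0 a13 a24"
              by blast
            then show ?thesis
              by cases (simp only: v expo_add C add_0_right, use 1 2 3 4 5 nz in blast)+
          qed
        qed (simp add: mw wt_add)
        moreover have "m \<in> C" using m 7 by (auto simp: C intro: exI[of _ 0])
        moreover have "expo 1 0 0 0 + w \<notin> C"
        proof -
          obtain x0 x y z where "w = expo x0 x y z" by (rule expo_cases)
          then show ?thesis by (simp add: C)
        qed
        ultimately show ?thesis by blast
      qed
    qed
  qed
  then show ?thesis unfolding cm c2_iff .
qed

end
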